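(* Consider an $\varepsilon$-irreducible system of dimension $n$ $$[A_{\sigma_A}]\qquad \xi_A^{h}\,x^{p}\,\partial F=A(x,\xi_A)F=\sum_{k=0}^{\infty}A_k(x)\,\xi_A^k\,F,\qquad \xi_A=x^{\sigma_A}\varepsilon ,$$ with $h>0$, and let $$\det\Big(\lambda I-\frac{A(x,\xi_A)}{x^p\xi_A^h}\Big)=\lambda^n+\alpha_{n-1}(x,\xi_A)\lambda^{n-1}+\dots+\alpha_0(x,\xi_A),\qquad \alpha_n=1,$$ with $\alpha_i(x,\xi_A)=\sum_{j\ge val_\varepsilon(\alpha_i)}\alpha_{i,j}(x)\xi_A^j\in\mathcal K$. If $h>n-\operatorname{rank}(A_0(x))$, then the $\varepsilon$-exponential order of $[A_{\sigma_A}]$ is $$\omega_\varepsilon(A)=\max_{0\le i<n}\Big(\frac{-val_\varepsilon(\alpha_i)}{n-i}\Big),$$ and its corresponding $\varepsilon$-polynomial is given by $$E_\varepsilon(X)=\sum_{k=0}^{\ell}x^{\sigma_A\cdot val_\varepsilon(\alpha_{i_k})}\,\alpha_{i_k,\,val_\varepsilon(\alpha_{i_k})}(x)\,X^{\,i_k-i_0},$$ where $0\le i_0<i_1<\dots<i_\ell=n$ are the integers $i$ for which $\omega_\varepsilon(A)(n-i)=-val_\varepsilon(\alpha_i)$, and $\alpha_{i,val_\varepsilon(\alpha_i)}(x)=\xi_A^{-val_\varepsilon(\alpha_i)}\alpha_i(x,\xi_A)|_{\xi_A=0}$.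
   Context: $\partial=d/dx$ acts coefficientwise on $\mathbb C((x))((\varepsilon))$, the field of formal Laurent series in $\varepsilon$ with coefficients in $\mathbb C((x))$. $val_x$, $val_\varepsilon$ are the orders in $x$ and $\varepsilon$ ($+\infty$ at $0$), extended to matrices by the minimum over entries. $\mathbb Q^-=\{q\in\mathbb Q:q\le0\}$. $\mathcal K$ is the differential field of all $f=\sum_kf_k(x)\varepsilon^k\in\mathbb C((x))((\varepsilon))$ for which there are $\sigma\in\mathbb Q^-$, $p\in\mathbb Q$ with $val_x(f_k)\ge\sigma k+p$ for all $k$. A system $[A_{\sigma_A}]$ is a system $\partial F=MF$, $M\in\mathcal M_n(\mathcal K)$, written as $\xi_A^hx^p\partial F=\sum_{k\ge0}A_k(x)\xi_A^kF$, with $\xi_A=x^{\sigma_A}\varepsilon$, $\sigma_A\in\mathbb Q^-$, $p\in\mathbb Q$, $h\in\mathbb Z$, $A_k\in\mathcal M_n(\mathbb C[[x]])$, $A_0(0)\neq0$. The integer $h$ is its $\varepsilon$-rank; $A_0(x)$ is its leading coefficient matrix, with rank taken over $\mathbb C((x))$. For $T\in GL_n(\mathcal K)$, $F=TG$ gives the equivalent system $T[A_{\sigma_A}]$: $\partial G=(T^{-1}MT-T^{-1}\partial T)G$, rewritten in the same form. $m_\varepsilon(A)=\max(0,h+\operatorname{rank}(A_0(x))/n)$, $\mu_\varepsilon(A)=\min\{m_\varepsilon(T[A_{\sigma_A}]):T\in GL_n(\mathcal K)\}$; the system is $\varepsilon$-irreducible if $m_\varepsilon(A)=\mu_\varepsilon(A)$.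 Every system is equivalent (over $GL_n(\mathcal K)$) to the companion system of a scalar equation $\partial^nf+a_{n-1}\partial^{n-1}f+\dots+a_0f=0$, $a_i\in\mathcal K$, $a_n=1$ (via $[f,\partial f,\dots,\partial^{n-1}f]^T$). The $\varepsilon$-exponential order is $\omega_\varepsilon(A)=\max_{0\le i<n}\big(0,-val_\varepsilon(a_i)/(n-i)\big)$. The corresponding $\varepsilon$-polynomial is $\sum_k a_{i_k,val_\varepsilon(a_{i_k})}(x)X^{i_k-i_0}$, where $i_0<\dots<i_\ell=n$ are the integers $i$ with $\omega_\varepsilon(A)(n-i)=-val_\varepsilon(a_i)$ and $a_{i,val_\varepsilon(a_i)}(x)$ is the coefficient of $\varepsilon^{val_\varepsilon(a_i)}$ in $a_i$. These do not depend on the chosen equivalent scalar equation. *)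

theory Defs
  imports
    "HOL-Computational_Algebra.Computational_Algebra"
    "HOL-Library.Extended_Real"
    "Jordan_Normal_Form.Char_Poly"
    "Jordan_Normal_Form.DL_Rank"
    "Jordan_Normal_Form.Gauss_Jordan_Elimination"
begin

(* The type complex fls fls is C((x))((eps)): the outer series is in eps, the coefficients in x. *)

definition val :: "'a::zero fls \<Rightarrow> ereal" where
  "val f = (if f = 0 then \<infinity> else ereal (of_int (fls_subdegree f)))"

definition ddx :: "complex fls fls \<Rightarrow> complex fls fls" where
  "ddx f = Abs_fls (\<lambda>k. fls_deriv (fls_nth f k))"

lemma nth_ddx: "fls_nth (ddx f) k = fls_deriv (fls_nth f k)"
  unfolding ddx_def
  by (rule nth_Abs_fls_lower_bound[of "fls_subdegree f"]) simp

definition KK :: "complex fls fls set" where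
  "KK = {f. \<exists>\<sigma> p :: rat. \<sigma> \<le> 0 \<and>
            (\<forall>k::int. val (fls_nth f k) \<ge> ereal (of_rat (\<sigma> * of_int k + p)))}"

definition KK_mat :: "nat \<Rightarrow> complex fls fls mat set" where
  "KK_mat n = {M \<in> carrier_mat n n. elements_mat M \<subseteq> KK}"

definition GL_KK :: "nat \<Rightarrow> complex fls fls mat set" where
  "GL_KK n = {T \<in> KK_mat n. \<exists>S \<in> KK_mat n. inverts_mat T S \<and> inverts_mat S T}"

(* The matrix of the system satisfied by G, when F = T G and F' = M F. *)
definition gauge :: "complex fls fls mat \<Rightarrow> complex fls fls mat \<Rightarrow> complex fls fls mat" where
  "gauge T M = (let S = the (mat_inverse T) in S * M * T - S * map_mat ddx T)"

(* Rational powers of x live in C((t)) with t^s = x, for a common denominator s of the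
   exponents; this is again represented by complex fls. The embedding C((x)) -> C((t)) and its
   extension to series in eps are ram_x s and ram s. *)

definition ram_x :: "nat \<Rightarrow> complex fls \<Rightarrow> complex fls" where
  "ram_x s f = fls_compose_fps f (fps_X ^ s)"

definition ram :: "nat \<Rightarrow> complex fls fls \<Rightarrow> complex fls fls" where
  "ram s f = Abs_fls (\<lambda>k. ram_x s (fls_nth f k))"

lemma nth_ram: "fls_nth (ram s f) k = ram_x s (fls_nth f k)"
  unfolding ram_def
  by (rule nth_Abs_fls_lower_bound[of "fls_subdegree f"]) (simp add: ram_x_def)

(* x^r = t^(s r); only used when s r is an integer. *)
definition xpow :: "nat \<Rightarrow> rat \<Rightarrow> complex fls" where
  "xpow s r = fls_X powi \<lfloor>of_nat s * r\<rfloor>"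

definition xi :: "nat \<Rightarrow> rat \<Rightarrow> complex fls fls" where
  "xi s \<sigma> = fls_const (xpow s \<sigma>) * fls_X"

(* The sum over k of c k * xi^k. The coefficients c k must vanish for all sufficiently small k. *)
definition xi_series :: "nat \<Rightarrow> rat \<Rightarrow> (int \<Rightarrow> complex fls) \<Rightarrow> complex fls fls" where
  "xi_series s \<sigma> c = Abs_fls (\<lambda>k. c k * xpow s \<sigma> powi k)"

lemma nth_xi_series:
  assumes "\<And>k. k < b \<Longrightarrow> c k = 0"
  shows "fls_nth (xi_series s \<sigma> c) k = c k * xpow s \<sigma> powi k"
  unfolding xi_series_def
  by (rule nth_Abs_fls_lower_bound[of b]) (simp add: assms)

(* F' = M F, written as xi^h x^p F' = (A 0 + A 1 xi + A 2 xi^2 + ...) F with xi = x^\<sigma> eps.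
   The identity is taken in C((x^(1/s)))((eps)). *)
definition eps_system ::
  "nat \<Rightarrow> complex fls fls mat \<Rightarrow> nat \<Rightarrow> rat \<Rightarrow> rat \<Rightarrow> int \<Rightarrow> (nat \<Rightarrow> complex fps mat) \<Rightarrow> bool" where
  "eps_system n M s \<sigma> p h A \<longleftrightarrow>
     M \<in> KK_mat n \<and> \<sigma> \<le> 0 \<and>
     s > 0 \<and> of_nat s * \<sigma> \<in> \<int> \<and> of_nat s * p \<in> \<int> \<and>
     (\<forall>k. A k \<in> carrier_mat n n) \<and>
     map_mat (\<lambda>f. fps_nth f 0) (A 0) \<noteq> 0\<^sub>m n n \<and>
     (\<forall>i<n. \<forall>j<n.
        xi s \<sigma> powi h * fls_const (xpow s p) * ram s (M $$ (i, j)) =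
        xi_series s \<sigma> (\<lambda>k. if k < 0 then 0 else ram_x s (fps_to_fls (A (nat k) $$ (i, j)))))"

definition lead_rank :: "nat \<Rightarrow> complex fps mat \<Rightarrow> nat" where
  "lead_rank n A0 = vec_space.rank n (map_mat fps_to_fls A0)"

definition m_eps :: "nat \<Rightarrow> int \<Rightarrow> complex fps mat \<Rightarrow> real" where
  "m_eps n h A0 = max 0 (of_int h + real (lead_rank n A0) / real n)"

(* The set below consists of nonnegative multiples of 1/n, so its infimum is a minimum if it is
   nonempty. The zero matrix has no leading coefficient and contributes no value. *)
definition mu_eps :: "nat \<Rightarrow> complex fls fls mat \<Rightarrow> real" where
  "mu_eps n M = Inf {m_eps n h (A 0) | T s \<sigma> p h A.
                       T \<in> GL_KK n \<and> eps_system n (gauge T M) s \<sigma> p h A}"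

definition eps_irreducible ::
  "nat \<Rightarrow> complex fls fls mat \<Rightarrow> int \<Rightarrow> (nat \<Rightarrow> complex fps mat) \<Rightarrow> bool" where
  "eps_irreducible n M h A \<longleftrightarrow> m_eps n h (A 0) = mu_eps n M"

(* Scalar equation f^(n) + a (n-1) f^(n-1) + ... + a 0 f = 0 and its matrix for the vector
   (f, f', ..., f^(n-1)). *)
definition companion :: "nat \<Rightarrow> (nat \<Rightarrow> complex fls fls) \<Rightarrow> complex fls fls mat" where
  "companion n a = mat n n (\<lambda>(i, j).
     if i + 1 < n then (if j = i + 1 then 1 else 0) else - a j)"

definition scalar_equation_of ::
  "nat \<Rightarrow> complex fls fls mat \<Rightarrow> (nat \<Rightarrow> complex fls fls) \<Rightarrow> bool" where
  "scalar_equation_of n M a \<longleftrightarrow>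
     (\<forall>i<n. a i \<in> KK) \<and> a n = 1 \<and> (\<exists>T \<in> GL_KK n. companion n a = gauge T M)"

definition scalar_exp_order :: "nat \<Rightarrow> (nat \<Rightarrow> complex fls fls) \<Rightarrow> ereal" where
  "scalar_exp_order n a = Max (insert 0 ((\<lambda>i. (- val (a i)) / ereal (real (n - i))) ` {..<n}))"

(* The indices i_0 < ... < i_l = n on the edge of slope w. *)
definition edge_indices :: "nat \<Rightarrow> ereal \<Rightarrow> (nat \<Rightarrow> complex fls fls) \<Rightarrow> nat set" where
  "edge_indices n w a = {i. i \<le> n \<and> w * ereal (real (n - i)) = - val (a i)}"

definition scalar_eps_poly :: "nat \<Rightarrow> (nat \<Rightarrow> complex fls fls) \<Rightarrow> complex fls poly" where
  "scalar_eps_poly n a =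
     (let I = edge_indices n (scalar_exp_order n a) a
      in \<Sum>i\<in>I. Polynomial.monom (fls_nth (a i) (fls_subdegree (a i))) (i - Min I))"

(* The following two are invariants of the system: an equivalent scalar equation exists and
   the values do not depend on its choice. *)

definition exp_order :: "nat \<Rightarrow> complex fls fls mat \<Rightarrow> ereal" where
  "exp_order n M = (THE w. \<exists>a. scalar_equation_of n M a \<and> w = scalar_exp_order n a)"

definition eps_poly :: "nat \<Rightarrow> complex fls fls mat \<Rightarrow> complex fls poly" where
  "eps_poly n M = (THE E. \<exists>a. scalar_equation_of n M a \<and> E = scalar_eps_poly n a)"

end

theory Submission
  imports Defs
begin

text \<open>
  Since \<open>eps\<close> is a constant for the derivation and differentiation does not lower orders in \<open>eps\<close>, a
  gauge transformation is a conjugation up to a logarithmic derivative.  By the Smith form over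
  \<open>C((x))[[eps]]\<close> every transformation is a product of unimodular and diagonal ones, whose logarithmic
  derivatives are integral.  Hence if two equivalent matrices both have pole order at most \<open>w\<close> with
  \<open>w > 0\<close>, the coefficients of weight \<open>w\<close> of their characteristic polynomials agree.

  Let \<open>r\<close> be the rank of the leading matrix.  After ramification in \<open>eps\<close>, the steepest slope \<open>w\<close> of the
  characteristic polynomial of \<open>M\<close> becomes an integer, and the lattice spanned by the
  \<open>eps^(jw) M^j e\<close> with \<open>j < n\<close> makes the pole order of the conjugated matrix equal to \<open>w\<close>, by
  Cayley-Hamilton.  The logarithmic derivative of the base change has pole order at most
  \<open>(n - 1)(h - w)\<close>, which is less than \<open>w\<close> as soon as \<open>w \<ge> h - (n - r) / n\<close>, because \<open>h > n - r\<close>.  A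
  companion matrix becomes of pole order equal to its own steepest slope under a diagonal
  transformation, so the comparison above gives the result.

  The inequality for \<open>w\<close> follows from irreducibility: the lattices obtained from the standard one by
  repeatedly applying \<open>eps^(h-1) \<nabla>\<close> have, relative to it, length exactly \<open>k r\<close> after \<open>k\<close> steps,
  because the rank of the leading matrix can never drop; comparing with an adapted lattice of smaller
  slope would force slower growth.
\<close>

subsection \<open>Orders of Laurent series\<close>

text \<open>Two estimates explain the constants. Let \<open>w\<close> be the steepest slope,
  \<open>r\<close> the leading rank and \<open>d = n - r\<close>. One step of the lattice sequence
  lowers the order of the determinant by exactly \<open>r\<close>, whereas in an adapted basis it
  costs at most \<open>w - (h - 1)\<close> in each of \<open>n\<close> directions; so
  \<open>n (w - h + 1) >= r\<close>, which is \<open>w >= h - d / n\<close>. The adapted basis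
  distorts by up to \<open>(n - 1) (h - w)\<close>, and \<open>(n - 1) (h - w) < w\<close> means
  \<open>n w > (n - 1) h\<close>; since \<open>n w >= n h - d\<close>, this follows from
  \<open>h > d\<close>. The characteristic polynomials cannot be compared on \<open>M\<close>
  directly: its pole order \<open>h\<close> may exceed \<open>w\<close>, and then the coefficients
  of weight \<open>w\<close> are not those of a leading matrix. Both \<open>M\<close> and the
  companion matrix are therefore brought to pole order \<open>w\<close> first.
  \<open>exp_order\<close> and \<open>eps_poly\<close> are definite descriptions, so agreement over
  all scalar equations and existence of one have to be proved together. Existence is the cyclic
  vector lemma over \<open>KK\<close>, for which \<open>KK\<close> has to be a field closed under
  \<open>ddx\<close>.\<close>

definition ord_ge :: "int \<Rightarrow> 'a::zero fls \<Rightarrow> bool" where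
  "ord_ge k f \<longleftrightarrow> (\<forall>j<k. fls_nth f j = 0)"

lemma ord_geI: "(\<And>j. j < k \<Longrightarrow> fls_nth f j = 0) \<Longrightarrow> ord_ge k f"
  by (simp add: ord_ge_def)

lemma ord_geD: "ord_ge k f \<Longrightarrow> j < k \<Longrightarrow> fls_nth f j = 0"
  by (simp add: ord_ge_def)

text \<open>The subdegree of 0 is 0 by convention, so the zero series, whose order is infinite, has
  to be listed separately. Working with vanishing coefficients avoids this case distinction
  elsewhere.\<close>

lemma ord_ge_iff: "ord_ge k f \<longleftrightarrow> f = 0 \<or> k \<le> fls_subdegree f"
  by (metis fls_eq0_below_subdegree fls_zero_nth linorder_not_less nth_fls_subdegree_zero_iff
      ord_ge_def order_less_le_trans)

lemma ord_ge_mono: "ord_ge k f \<Longrightarrow> l \<le> k \<Longrightarrow> ord_ge l f"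
  by (simp add: ord_ge_def)

lemma ord_ge_0 [simp]: "ord_ge k 0"
  by (simp add: ord_ge_def)

lemma ord_ge_const [simp]: "k \<le> 0 \<Longrightarrow> ord_ge k (fls_const c)"
  by (simp add: ord_ge_def)

lemma ord_ge_1 [simp]: "k \<le> 0 \<Longrightarrow> ord_ge k (1 :: 'a::zero_neq_one fls)"
  by (simp add: ord_ge_def)

lemma ord_ge_add: "ord_ge k f \<Longrightarrow> ord_ge k g \<Longrightarrow> ord_ge k (f + g)"
  for f g :: "'a::monoid_add fls"
  by (simp add: ord_ge_def)

lemma ord_ge_diff: "ord_ge k f \<Longrightarrow> ord_ge k g \<Longrightarrow> ord_ge k (f - g)"
  for f g :: "'a::group_add fls"
  by (simp add: ord_ge_def)

lemma ord_ge_uminus: "ord_ge k f \<Longrightarrow> ord_ge k (- f)"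
  for f :: "'a::group_add fls"
  by (simp add: ord_ge_def)

lemma ord_ge_sum: "(\<And>i. i \<in> I \<Longrightarrow> ord_ge k (f i)) \<Longrightarrow> ord_ge k (sum f I)"
  for f :: "'b \<Rightarrow> 'a::comm_monoid_add fls"
  by (induction I rule: infinite_finite_induct) (auto intro: ord_ge_add)

text \<open>The bounds may lie below the true orders. This lets several products be expanded over
  one common range of summation, and makes the coefficient at \<open>a + b\<close> a single
  term.\<close>

lemma fls_nth_mult_bounds:
  fixes f g :: "'a::comm_ring_1 fls"
  assumes "ord_ge a f" "ord_ge b g"
  shows "fls_nth (f * g) k = (\<Sum>i=a..k-b. fls_nth f i * fls_nth g (k - i))"
proof (cases "f = 0 \<or> g = 0")
  case False
  then have ab: "a \<le> fls_subdegree f" "b \<le> fls_subdegree g"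
    using assms by (auto simp: ord_ge_iff)
  show ?thesis unfolding fls_times_nth(2)
    by (rule sum.mono_neutral_left) (use ab in \<open>auto simp: not_le\<close>)
qed auto

lemma fls_nth_mult_lead:
  fixes f g :: "'a::comm_ring_1 fls"
  assumes "ord_ge a f" "ord_ge b g"
  shows "fls_nth (f * g) (a + b) = fls_nth f a * fls_nth g b"
  by (simp add: fls_nth_mult_bounds[OF assms])

lemma ord_ge_mult:
  fixes f g :: "'a::comm_ring_1 fls"
  assumes "ord_ge a f" "ord_ge b g" "c \<le> a + b"
  shows "ord_ge c (f * g)"
  by (rule ord_geI) (use assms in \<open>auto simp: fls_nth_mult_bounds[OF assms(1,2)] intro!: sum.neutral\<close>)

text \<open>The Laurent monomial of exponent \<open>k\<close>, used both for eps in the outer series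
  and for x or its root in the coefficients. Written as a shift, its coefficients and products are
  immediate.\<close>

definition X_pow :: "int \<Rightarrow> 'a::field fls" where
  "X_pow k = fls_shift (- k) 1"

lemma nth_X_pow: "fls_nth (X_pow k) m = (if m = k then 1 else 0)"
  by (auto simp: X_pow_def)

lemma X_pow_0 [simp]: "X_pow 0 = 1"
  by (simp add: X_pow_def)

lemma X_pow_1: "X_pow 1 = fls_X"
  unfolding X_pow_def by (rule fls_eqI) auto

lemma X_pow_nonzero [simp]: "X_pow k \<noteq> 0"
  by (simp add: X_pow_def)

lemma X_pow_add: "X_pow (k + l) = X_pow k * X_pow l"
  by (simp add: X_pow_def fls_X_intpow_times_fls_X_intpow)

lemma X_pow_minus: "X_pow (- k) = inverse (X_pow k)"
  using X_pow_add[of k "- k", symmetric] by (simp add: field_simps inverse_unique)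

lemma X_pow_minus_mult [simp]: "X_pow (- k) * X_pow k = 1" "X_pow k * X_pow (- k) = 1"
  using X_pow_add[of k "- k", symmetric] X_pow_add[of "- k" k, symmetric] by simp_all

lemma X_pow_power: "X_pow k ^ n = X_pow (int n * k)"
  by (induction n) (auto simp: algebra_simps simp flip: X_pow_add)

lemma X_pow_powi: "fls_X powi k = X_pow k"
  unfolding X_pow_def by simp

lemma X_pow_power_int: "X_pow k powi l = X_pow (k * l)"
  by (simp only: power_int_mult flip: X_pow_powi)

lemma fls_subdegree_X_pow [simp]: "fls_subdegree (X_pow k) = k"
  by (simp add: X_pow_def)

lemma nth_X_pow_mult: "fls_nth (X_pow k * f) m = fls_nth f (m - k)"
  by (simp add: X_pow_def fls_X_intpow_times_conv_shift)

lemma ord_ge_X_pow_mult: "ord_ge l (X_pow k * f) \<longleftrightarrow> ord_ge (l - k) f"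
  by (auto simp: ord_ge_def nth_X_pow_mult) (metis add.commute add_diff_cancel_left' diff_add_cancel diff_less_eq)

lemma ord_ge_X_pow: "l \<le> k \<Longrightarrow> ord_ge l (X_pow k)"
  by (simp add: ord_ge_def nth_X_pow)

subsection \<open>Matrices over Laurent series\<close>

definition mat_ord_ge :: "int \<Rightarrow> 'a::zero fls mat \<Rightarrow> bool" where
  "mat_ord_ge k M \<longleftrightarrow> (\<forall>i<dim_row M. \<forall>j<dim_col M. ord_ge k (M $$ (i, j)))"

lemma mat_ord_geD: "mat_ord_ge k M \<Longrightarrow> M \<in> carrier_mat m n \<Longrightarrow> i < m \<Longrightarrow> j < n \<Longrightarrow> ord_ge k (M $$ (i, j))"
  by (auto simp: mat_ord_ge_def)

lemma mat_ord_geI: "M \<in> carrier_mat m n \<Longrightarrow> (\<And>i j. i < m \<Longrightarrow> j < n \<Longrightarrow> ord_ge k (M $$ (i, j))) \<Longrightarrow> mat_ord_ge k M"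
  by (auto simp: mat_ord_ge_def)

lemma mat_ord_ge_mono: "mat_ord_ge k M \<Longrightarrow> l \<le> k \<Longrightarrow> mat_ord_ge l M"
  by (auto simp: mat_ord_ge_def intro: ord_ge_mono)

lemma mat_ord_ge_add:
  fixes M N :: "'a::monoid_add fls mat"
  assumes "M \<in> carrier_mat m n" "N \<in> carrier_mat m n" "mat_ord_ge k M" "mat_ord_ge k N"
  shows "mat_ord_ge k (M + N)"
  using assms by (auto simp: mat_ord_ge_def intro!: ord_ge_add)

lemma mat_ord_ge_diff:
  fixes M N :: "'a::group_add fls mat"
  assumes "M \<in> carrier_mat m n" "N \<in> carrier_mat m n" "mat_ord_ge k M" "mat_ord_ge k N"
  shows "mat_ord_ge k (M - N)"
  using assms by (auto simp: mat_ord_ge_def intro!: ord_ge_diff)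

lemma index_mult_mat_sum:
  assumes "A \<in> carrier_mat m l" "B \<in> carrier_mat l n" "i < m" "j < n"
  shows "(A * B) $$ (i, j) = (\<Sum>k<l. A $$ (i, k) * B $$ (k, j))"
  using assms by (auto simp: scalar_prod_def lessThan_atLeast0)

lemma mat_ord_ge_mult:
  fixes A B :: "'a::comm_ring_1 fls mat"
  assumes "A \<in> carrier_mat m l" "B \<in> carrier_mat l n" "mat_ord_ge a A" "mat_ord_ge b B" "c \<le> a + b"
  shows "mat_ord_ge c (A * B)"
proof (rule mat_ord_geI)
  show "A * B \<in> carrier_mat m n" using assms by simp
  show "ord_ge c ((A * B) $$ (i, j))" if "i < m" "j < n" for i j
    unfolding index_mult_mat_sum[OF assms(1,2) that]
    by (intro ord_ge_sum ord_ge_mult[OF _ _ assms(5)])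
      (use that assms mat_ord_geD[OF assms(3,1)] mat_ord_geD[OF assms(4,2)] in auto)
qed

lemma mat_ord_ge_one [simp]: "mat_ord_ge 0 (1\<^sub>m n :: 'a::{zero_neq_one} fls mat)"
  by (auto simp: mat_ord_ge_def)

lemma mat_ord_ge_smult:
  fixes A :: "'a::comm_ring_1 fls mat"
  assumes "mat_ord_ge a A" "ord_ge b c" "d \<le> b + a"
  shows "mat_ord_ge d (c \<cdot>\<^sub>m A)"
  using assms by (auto simp: mat_ord_ge_def intro!: ord_ge_mult[OF assms(2) _ assms(3)])

lemma ord_ge_prod:
  fixes f :: "'b \<Rightarrow> 'a::comm_ring_1 fls"
  assumes "\<And>i. i \<in> I \<Longrightarrow> ord_ge k (f i)"
  shows "ord_ge (int (card I) * k) (prod f I)"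
  using assms
proof (induction I rule: infinite_finite_induct)
  case (insert x I)
  then show ?case
    by (auto simp: algebra_simps intro!: ord_ge_mult[of k _ "k * int (card I)"])
qed auto

text \<open>Converts an entrywise pole bound of a lattice basis into a bound of its determinant; the
  growth argument for the slopes ends with it.\<close>

lemma ord_ge_det:
  fixes A :: "'a::comm_ring_1 fls mat"
  assumes A: "A \<in> carrier_mat n n" and k: "mat_ord_ge k A"
  shows "ord_ge (int n * k) (det A)"
proof -
  have "ord_ge (int n * k) (signof p * (\<Prod>i = 0..<n. A $$ (i, p i)))" if p: "p permutes {0..<n}" for p
  proof -
    have "ord_ge (int (card {0..<n}) * k) (\<Prod>i = 0..<n. A $$ (i, p i))"
      using p permutes_in_image[OF p] by (intro ord_ge_prod) (use mat_ord_geD[OF k A] in auto)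
    then have "ord_ge (int n * k) (\<Prod>i = 0..<n. A $$ (i, p i))" by simp
    then show ?thesis
      by (auto simp: sign_def intro: ord_ge_uminus)
  qed
  then show ?thesis
    unfolding det_def'[OF A] by (intro ord_ge_sum) auto
qed

subsection \<open>The derivation\<close>

lemma ddx_add [simp]: "ddx (f + g) = ddx f + ddx g"
  and ddx_0 [simp]: "ddx 0 = 0"
  by (rule fls_eqI; simp add: nth_ddx)+

lemma ddx_1 [simp]: "ddx 1 = 0"
  by (rule fls_eqI; simp add: nth_ddx fls_one_nth)

lemma ddx_sum: "ddx (sum f I) = (\<Sum>i\<in>I. ddx (f i))"
  by (induction I rule: infinite_finite_induct) auto

lemma ord_ge_ddx: "ord_ge k f \<Longrightarrow> ord_ge k (ddx f)"
  by (auto simp: ord_ge_def nth_ddx)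

lemma fls_deriv_sum: "fls_deriv (sum f I) = (\<Sum>i\<in>I. fls_deriv (f i))"
  by (induction I rule: infinite_finite_induct) auto

lemma ord_ge_subdegree [simp]: "ord_ge (fls_subdegree f) f"
  by (simp add: ord_ge_def)

lemma ddx_mult: "ddx (f * g) = ddx f * g + f * ddx g"
proof (rule fls_eqI)
  fix k
  \<comment> \<open>A derivative may have larger order than the series; keeping the bounds of
    \<open>f\<close> and \<open>g\<close> for the derivatives gives all three convolutions the same
    range.\<close>
  note b = ord_ge_subdegree[of f] ord_ge_subdegree[of g]
  note b' = b[THEN ord_ge_ddx]
  show "fls_nth (ddx (f * g)) k = fls_nth (ddx f * g + f * ddx g) k"
    by (simp add: nth_ddx fls_nth_mult_bounds[OF b] fls_nth_mult_bounds[OF b(1) b'(2)]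
        fls_nth_mult_bounds[OF b'(1) b(2)] fls_deriv_sum sum.distrib)
qed

lemma ddx_const: "ddx (fls_const c) = fls_const (fls_deriv c)"
  by (rule fls_eqI; simp add: nth_ddx)

lemma ddx_X_pow [simp]: "ddx (X_pow k) = 0"
  by (rule fls_eqI; simp add: nth_ddx nth_X_pow)

lemma mat_ord_ge_ddx: "mat_ord_ge k M \<Longrightarrow> mat_ord_ge k (map_mat ddx M)"
  by (auto simp: mat_ord_ge_def intro: ord_ge_ddx)

lemma map_mat_ddx_mult:
  assumes "A \<in> carrier_mat m l" "B \<in> carrier_mat l n"
  shows "map_mat ddx (A * B) = map_mat ddx A * B + A * map_mat ddx B"
  by (rule eq_matI)
    (use assms in \<open>auto simp: index_mult_mat_sum[of _ m l _ n] ddx_sum ddx_mult sum.distrib simp del: index_mult_mat(1)\<close>)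

section \<open>Substitution of eps^v for eps\<close>

lemma compose_power_hom: "v > 0 \<Longrightarrow> field_hom (\<lambda>f. fls_compose_power f v :: 'a::field fls)"
  by unfold_locales auto

lemma ord_ge_compose_power:
  assumes v: "v > 0"
  shows "ord_ge (int v * k) (fls_compose_power f v) \<longleftrightarrow> ord_ge k f"
proof
  assume L: "ord_ge (int v * k) (fls_compose_power f v)"
  show "ord_ge k f"
  proof (rule ord_geI)
    fix j assume "j < k"
    then have "int v * j < int v * k" using v by simp
    then show "fls_nth f j = 0"
      using ord_geD[OF L, of "int v * j"] v by (simp add: fls_nth_compose_power)
  qed
qed (use v in \<open>auto simp: ord_ge_def fls_nth_compose_power\<close>)

lemma ddx_compose_power: "v > 0 \<Longrightarrow> ddx (fls_compose_power f v) = fls_compose_power (ddx f) v"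
  by (rule fls_eqI; simp add: nth_ddx fls_nth_compose_power)

subsection \<open>The field \<^term>\<open>KK\<close>\<close>

text \<open>A bound symmetric in \<open>k\<close> and with a single natural constant: closure under
  products becomes the triangle inequality. The two forms agree because only finitely many negative
  \<open>k\<close> occur in a given series.\<close>

lemma KK_iff:
  "f \<in> KK \<longleftrightarrow> (\<exists>c::nat. \<forall>k. ord_ge (- int c * (1 + \<bar>k\<bar>)) (fls_nth f k))"
proof
  assume "f \<in> KK"
  then obtain \<sigma> p :: rat where \<sigma>: "\<sigma> \<le> 0"
    and b: "\<And>k. val (fls_nth f k) \<ge> ereal (of_rat (\<sigma> * of_int k + p))"
    by (auto simp: KK_def)
  define c where "c = nat \<lceil>max \<bar>\<sigma>\<bar> \<bar>p\<bar>\<rceil>"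
  have "max \<bar>\<sigma>\<bar> \<bar>p\<bar> \<le> of_int \<lceil>max \<bar>\<sigma>\<bar> \<bar>p\<bar>\<rceil>" by (rule le_of_int_ceiling)
  then have "\<bar>\<sigma>\<bar> \<le> of_int \<lceil>max \<bar>\<sigma>\<bar> \<bar>p\<bar>\<rceil>" "\<bar>p\<bar> \<le> of_int \<lceil>max \<bar>\<sigma>\<bar> \<bar>p\<bar>\<rceil>"
    by linarith+
  moreover have "0 \<le> \<lceil>max \<bar>\<sigma>\<bar> \<bar>p\<bar>\<rceil>" by
      (simp add: le_ceiling_iff less_max_iff_disj less_le_trans[OF _ abs_ge_zero])
  ultimately have c: "\<bar>\<sigma>\<bar> \<le> of_nat c" "\<bar>p\<bar> \<le> of_nat c"
    unfolding c_def by (simp_all add: of_nat_nat)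
  have "ord_ge (- int c * (1 + \<bar>k\<bar>)) (fls_nth f k)" for k
  proof (cases "fls_nth f k = 0")
    case False
    then have "real_of_rat (\<sigma> * of_int k + p) \<le> real_of_int (fls_subdegree (fls_nth f k))"
      using b[of k] by (simp add: val_def)
    also have "\<dots> = real_of_rat (of_int (fls_subdegree (fls_nth f k)))" by simp
    finally have 1: "\<sigma> * of_int k + p \<le> of_int (fls_subdegree (fls_nth f k))"
      by (simp only: of_rat_less_eq)
    have "\<bar>\<sigma> * of_int k\<bar> \<le> of_nat c * of_int \<bar>k\<bar>"
      using c(1) by (simp add: abs_mult mult_right_mono)
    then have "- (of_nat c * of_int (1 + \<bar>k\<bar>)) \<le> \<sigma> * of_int k + p"
      using c(2) by (simp add: algebra_simps)
    then have "rat_of_int (- int c * (1 + \<bar>k\<bar>)) \<le> of_int (fls_subdegree (fls_nth f k))"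
      using 1 by simp
    then show ?thesis unfolding of_int_le_iff by (simp add: ord_ge_iff)
  qed simp
  then show "\<exists>c::nat. \<forall>k. ord_ge (- int c * (1 + \<bar>k\<bar>)) (fls_nth f k)" by blast
next
  assume "\<exists>c::nat. \<forall>k. ord_ge (- int c * (1 + \<bar>k\<bar>)) (fls_nth f k)"
  then obtain c :: nat where c: "\<And>k. ord_ge (- int c * (1 + \<bar>k\<bar>)) (fls_nth f k)" by blast
  \<comment> \<open>\<open>m\<close> bounds the pole order, so every \<open>k\<close> in the support
    satisfies |k| <= k + 2 m; the constant \<open>q\<close> absorbs the difference.\<close>
  define m where "m = nat (- fls_subdegree f)"
  define q where "q = - int c * (1 + 2 * int m)"
  have "val (fls_nth f k) \<ge> ereal (of_rat (of_int (- int c) * of_int k + of_int q))" for k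
  proof (cases "fls_nth f k = 0")
    case False
    then have "k \<ge> fls_subdegree f" by (meson fls_eq0_below_subdegree not_le)
    then have "\<bar>k\<bar> \<le> k + 2 * int m" unfolding m_def by linarith
    then have "int c * \<bar>k\<bar> \<le> int c * (k + 2 * int m)" by (rule mult_left_mono) simp
    then have "- int c * k + q \<le> - int c * (1 + \<bar>k\<bar>)"
      unfolding q_def by (simp add: algebra_simps)
    also have "\<dots> \<le> fls_subdegree (fls_nth f k)" using c[of k] False by (simp add: ord_ge_iff)
    finally have "real_of_int (- int c * k + q) \<le> real_of_int (fls_subdegree (fls_nth f k))"
      by (simp only: of_int_le_iff)
    then show ?thesis using False by (simp add: val_def of_rat_add of_rat_mult of_rat_minus of_rat_diff)
  qed (simp add: val_def)
  then show "f \<in> KK" unfolding KK_def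
    by (intro CollectI exI[of _ "of_int (- int c)"] exI[of _ "of_int q"]) auto
qed

lemma KK_0 [simp]: "0 \<in> KK"
  by (auto simp: KK_iff)

lemma KK_const [simp]: "fls_const c \<in> KK"
proof -
  have "ord_ge (- int (nat (- fls_subdegree c)) * (1 + \<bar>k\<bar>)) (fls_nth (fls_const c) k)" for k
    by (cases "k = 0") (auto simp: ord_ge_iff)
  then show ?thesis unfolding KK_iff by blast
qed

lemma KK_1 [simp]: "1 \<in> KK"
  using KK_const[of 1] by simp

lemma KK_X_pow [simp]: "X_pow k \<in> KK"
  unfolding KK_iff by (intro exI[of _ 0]) (auto simp: nth_X_pow)

lemma KK_add: assumes "f \<in> KK" "g \<in> KK" shows "f + g \<in> KK"
proof -
  obtain c d :: nat where c: "\<And>k. ord_ge (- int c * (1 + \<bar>k\<bar>)) (fls_nth f k)"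
    and d: "\<And>k. ord_ge (- int d * (1 + \<bar>k\<bar>)) (fls_nth g k)"
    using assms unfolding KK_iff by blast
  have "ord_ge (- int (c + d) * (1 + \<bar>k\<bar>)) (fls_nth (f + g) k)" for k
    unfolding fls_plus_nth
    by (intro ord_ge_add ord_ge_mono[OF c[of k]] ord_ge_mono[OF d[of k]])
      (simp_all only: mult_minus_left neg_le_iff_le, simp_all add: mult_right_mono)
  then show ?thesis unfolding KK_iff by blast
qed

lemma KK_uminus: "f \<in> KK \<Longrightarrow> - f \<in> KK"
  unfolding KK_iff by (auto intro: ord_ge_uminus)

lemma KK_diff: "f \<in> KK \<Longrightarrow> g \<in> KK \<Longrightarrow> f - g \<in> KK"
  using KK_add[of f "- g"] KK_uminus[of g] by simp

lemma KK_sum: "(\<And>i. i \<in> I \<Longrightarrow> f i \<in> KK) \<Longrightarrow> sum f I \<in> KK"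
  by (induction I rule: infinite_finite_induct) (auto intro: KK_add)

lemma KK_mult: assumes "f \<in> KK" "g \<in> KK" shows "f * g \<in> KK"
proof -
  obtain c d :: nat where c: "\<And>k. ord_ge (- int c * (1 + \<bar>k\<bar>)) (fls_nth f k)"
    and d: "\<And>k. ord_ge (- int d * (1 + \<bar>k\<bar>)) (fls_nth g k)"
    using assms unfolding KK_iff by blast
  define m where "m = nat \<bar>fls_subdegree f\<bar> + nat \<bar>fls_subdegree g\<bar>"
  have b: "ord_ge (- int m) f" "ord_ge (- int m) g"
    by (auto simp: m_def ord_ge_iff)
  \<comment> \<open>The summands satisfy |i|, |k - i| <= m + |k|, and 1 + m + |k| <= (1 + m)(1 +
    |k|); so this constant covers both factors.\<close>
  define e where "e = (c + d) * (1 + m)"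
  have "ord_ge (- int e * (1 + \<bar>k\<bar>)) (fls_nth (f * g) k)" for k
    unfolding fls_nth_mult_bounds[OF b]
  proof (intro ord_ge_sum ord_ge_mult[OF c d])
    fix i assume "i \<in> {- int m..k - - int m}"
    then have i: "\<bar>i\<bar> \<le> int m + \<bar>k\<bar>" "\<bar>k - i\<bar> \<le> int m + \<bar>k\<bar>" by auto
    have "1 + (int m + \<bar>k\<bar>) \<le> (1 + int m) * (1 + \<bar>k\<bar>)" by (simp add: algebra_simps)
    then have i': "1 + \<bar>i\<bar> \<le> (1 + int m) * (1 + \<bar>k\<bar>)" "1 + \<bar>k - i\<bar> \<le> (1 + int m) * (1 + \<bar>k\<bar>)"
      using i by linarith+
    have "int c * (1 + \<bar>i\<bar>) \<le> int c * ((1 + int m) * (1 + \<bar>k\<bar>))"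
      "int d * (1 + \<bar>k - i\<bar>) \<le> int d * ((1 + int m) * (1 + \<bar>k\<bar>))"
      using i' by (auto intro!: mult_left_mono)
    then show "- int e * (1 + \<bar>k\<bar>) \<le> - int c * (1 + \<bar>i\<bar>) + - int d * (1 + \<bar>k - i\<bar>)"
      unfolding e_def by (simp add: algebra_simps)
  qed
  then show ?thesis unfolding KK_iff by blast
qed

lemma KK_prod: "(\<And>i. i \<in> I \<Longrightarrow> f i \<in> KK) \<Longrightarrow> prod f I \<in> KK"
  by (induction I rule: infinite_finite_induct) (auto intro: KK_mult)

lemma KK_ddx: assumes "f \<in> KK" shows "ddx f \<in> KK"
proof -
  obtain c :: nat where c: "\<And>k. ord_ge (- int c * (1 + \<bar>k\<bar>)) (fls_nth f k)"
    using assms unfolding KK_iff by blast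
  have "ord_ge (- int (c + 1) * (1 + \<bar>k\<bar>)) (fls_nth (ddx f) k)" for k
  proof (rule ord_geI)
    fix j assume "j < - int (c + 1) * (1 + \<bar>k\<bar>)"
    then have "j + 1 < - int c * (1 + \<bar>k\<bar>)" by (simp add: algebra_simps)
    then show "fls_nth (fls_nth (ddx f) k) j = 0"
      using ord_geD[OF c[of k]] by (simp add: nth_ddx)
  qed
  then show ?thesis unfolding KK_iff by blast
qed

text \<open>The coefficients of the inverse obey a convolution recursion. The bound
  \<open>- 2 c k\<close> has no constant term and is therefore additive; the constant in
  \<open>c (1 + i)\<close> is absorbed by \<open>c (1 + i) <= 2 c i\<close>, valid as
  \<open>i >= 1\<close>.\<close>

lemma KK_inverse_unit:
  assumes f: "f \<in> KK" and "ord_ge 0 f" and f0: "fls_nth f 0 = 1"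
  shows "inverse f \<in> KK"
proof -
  obtain c :: nat where c: "\<And>k. ord_ge (- int c * (1 + \<bar>k\<bar>)) (fls_nth f k)"
    using f unfolding KK_iff by blast
  have fnz: "f \<noteq> 0" using f0 by auto
  have sub: "fls_subdegree f = 0"
    by (rule fls_subdegree_eqI) (use assms in \<open>auto simp: ord_ge_def\<close>)
  define g where "g = inverse f"
  have "fls_subdegree g = 0" unfolding g_def using sub by (simp add: fls_inverse_subdegree)
  then have g0: "ord_ge 0 g" by (simp add: ord_ge_iff)
  have fg: "f * g = 1" unfolding g_def using fnz by simp
  have "ord_ge (- int (2 * c) * int k) (fls_nth g (int k))" for k
  proof (induction k rule: less_induct)
    case (less k)
    have eq: "(\<Sum>i=0..int k. fls_nth f i * fls_nth g (int k - i)) = fls_nth 1 (int k)"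
      using fls_nth_mult_bounds[OF assms(2) g0, of "int k"] fg by simp
    have split: "{0..int k} = insert 0 {1..int k}" by auto
    have g_eq: "fls_nth g (int k) = fls_nth 1 (int k) - (\<Sum>i=1..int k. fls_nth f i * fls_nth g (int k - i))"
      using eq f0 unfolding split by (subst (asm) sum.insert) (auto simp: algebra_simps)
    show ?case unfolding g_eq
    proof (intro ord_ge_diff ord_ge_sum)
      show "ord_ge (- int (2 * c) * int k) (fls_nth (1::complex fls fls) (int k))" by
          (simp add: fls_one_nth)
      fix i assume i: "i \<in> {1..int k}"
      then have ki: "int k - i = int (nat (int k - i))" by simp
      have "ord_ge (- int (2 * c) * (int k - i)) (fls_nth g (int k - i))"
        using less[of "nat (int k - i)"] i unfolding ki[symmetric] by auto
      moreover have "int c * (1 + \<bar>i\<bar>) \<le> int c * (2 * i)" using i by (intro mult_left_mono) auto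
      ultimately show "ord_ge (- int (2 * c) * int k) (fls_nth f i * fls_nth g (int k - i))"
        by (intro ord_ge_mult[OF c]) (auto simp: algebra_simps)
    qed
  qed
  moreover have "fls_nth g k = 0" if "k < 0" for k using g0 that by (simp add: ord_ge_def)
  ultimately have "ord_ge (- int (2 * c) * (1 + \<bar>k\<bar>)) (fls_nth g k)" for k
  proof (cases "k < 0")
    case False
    then have "ord_ge (- int (2 * c) * k) (fls_nth g k)"
      using \<open>\<And>k. ord_ge (- int (2 * c) * int k) (fls_nth g (int k))\<close>[of "nat k"] by simp
    then show ?thesis using False by (rule_tac ord_ge_mono) (auto simp: algebra_simps)
  qed auto
  then show ?thesis unfolding KK_iff g_def by blast
qed

lemma KK_inverse: assumes f: "f \<in> KK" shows "inverse f \<in> KK"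
proof (cases "f = 0")
  case False
  define m where "m = fls_subdegree f"
  define a where "a = fls_nth f m"
  define u where "u = fls_const (inverse a) * X_pow (- m) * f"
  have a: "a \<noteq> 0" unfolding a_def m_def using False by simp
  have nu: "fls_nth u k = inverse a * fls_nth f (k + m)" for k
    unfolding u_def by (simp add: mult.assoc nth_X_pow_mult)
  have "u \<in> KK" unfolding u_def by (intro KK_mult f KK_const KK_X_pow)
  moreover have "ord_ge 0 u" by (rule ord_geI) (simp add: nu m_def)
  moreover have "fls_nth u 0 = 1" using a by (simp add: nu a_def)
  ultimately have "inverse u \<in> KK" by (rule KK_inverse_unit)
  moreover have "inverse f = fls_const (inverse a) * X_pow (- m) * inverse u"
  proof (rule inverse_unique)
    have "u \<noteq> 0" unfolding u_def using a False by (simp add: fls_const_nonzero)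
    then have "u * inverse u = 1" by simp
    then show "f * (fls_const (inverse a) * X_pow (- m) * inverse u) = 1"
      unfolding u_def by (simp only: ac_simps)
  qed
  ultimately show ?thesis by (auto intro!: KK_mult)
qed simp

subsection \<open>Gauge transformations\<close>

definition inverse_mats :: "nat \<Rightarrow> 'a::semiring_1 mat \<Rightarrow> 'a mat \<Rightarrow> bool" where
  "inverse_mats n T S \<longleftrightarrow> T \<in> carrier_mat n n \<and> S \<in> carrier_mat n n \<and> T * S = 1\<^sub>m n \<and> S * T = 1\<^sub>m n"

lemma inverse_mats_carrier:
  assumes "inverse_mats n T S"
  shows "T \<in> carrier_mat n n" "S \<in> carrier_mat n n" "T * S = 1\<^sub>m n" "S * T = 1\<^sub>m n"
  using assms by (auto simp: inverse_mats_def)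

lemma inverse_mats_sym: "inverse_mats n T S \<Longrightarrow> inverse_mats n S T"
  by (auto simp: inverse_mats_def)

lemma inverse_mats_one: "inverse_mats n (1\<^sub>m n) (1\<^sub>m n)"
  by (auto simp: inverse_mats_def)

lemma inverse_mats_cancel:
  assumes "inverse_mats n T S" "A \<in> carrier_mat n m"
  shows "T * (S * A) = A" "S * (T * A) = A"
  using assms by (auto simp: inverse_mats_def simp flip: assoc_mult_mat)

lemma inverse_mats_cancel_right:
  assumes "inverse_mats n T S" "A \<in> carrier_mat m n"
  shows "A * T * S = A" "A * S * T = A"
  using assms by (auto simp: inverse_mats_def assoc_mult_mat[where ?n\<^sub>1 = m and ?n\<^sub>2 = n and ?n\<^sub>3 = n
      and ?n\<^sub>4 = n])

lemma inverse_mats_mult: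
  assumes "inverse_mats n T S" "inverse_mats n T' S'"
  shows "inverse_mats n (T * T') (S' * S)"
proof -
  note c = inverse_mats_carrier[OF assms(1)] inverse_mats_carrier[OF assms(2)]
  have "T * T' * (S' * S) = T * (T' * (S' * S))" "S' * S * (T * T') = S' * (S * (T * T'))"
    using c by (auto intro!: assoc_mult_mat[where ?n\<^sub>1 = n and ?n\<^sub>2 = n and ?n\<^sub>3 = n and ?n\<^sub>4 = n])
  then show ?thesis
    using inverse_mats_cancel[OF assms(2), of S n] inverse_mats_cancel[OF assms(1), of T' n] c
    by (auto simp: inverse_mats_def)
qed

lemma inverse_mats_unique:
  assumes "inverse_mats n T S" "inverse_mats n T S'"
  shows "S = S'"
proof -
  have "S' = S * (T * S')"
    using inverse_mats_cancel(2)[OF assms(1)] inverse_mats_carrier(2)[OF assms(2)] by simp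
  also have "\<dots> = S"
    using inverse_mats_carrier(2)[OF assms(1)] inverse_mats_carrier(3)[OF assms(2)] by simp
  finally show ?thesis ..
qed

lemma inverse_mats_det:
  fixes T :: "'a::comm_ring_1 mat"
  assumes "inverse_mats n T S"
  shows "det T * det S = 1"
  using assms det_mult[of T n S] by (auto simp: inverse_mats_def)

lemma adj_mat_inverse:
  fixes T :: "'a::field mat"
  assumes T: "T \<in> carrier_mat n n" and d: "det T \<noteq> 0"
  shows "inverse_mats n T (inverse (det T) \<cdot>\<^sub>m adj_mat T)"
proof -
  note a = adj_mat[OF T]
  have "T * (inverse (det T) \<cdot>\<^sub>m adj_mat T) = inverse (det T) \<cdot>\<^sub>m (det T \<cdot>\<^sub>m 1\<^sub>m n)"
    using a(2) T a(1) by (simp add: mult_smult_distrib[of _ n n _ n])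
  moreover have "(inverse (det T) \<cdot>\<^sub>m adj_mat T) * T = inverse (det T) \<cdot>\<^sub>m (det T \<cdot>\<^sub>m 1\<^sub>m n)"
    using a(3) T a(1) by (simp add: mult_smult_assoc_mat[of _ n n _ n])
  moreover have "inverse (det T) \<cdot>\<^sub>m (det T \<cdot>\<^sub>m 1\<^sub>m n) = (1\<^sub>m n :: 'a mat)"
    using d by (intro eq_matI) auto
  ultimately show ?thesis using T a by (auto simp: inverse_mats_def)
qed

lemma inverse_mats_exists:
  fixes T :: "'a::field mat"
  assumes "T \<in> carrier_mat n n" "det T \<noteq> 0"
  obtains S where "inverse_mats n T S"
  using that[OF adj_mat_inverse[OF assms]] .

lemma mat_inverse_eq:
  fixes T :: "'a::field mat"
  assumes "inverse_mats n T S"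
  shows "mat_inverse T = Some S"
proof (cases "mat_inverse T")
  case None
  then have "T \<notin> Units (ring_mat TYPE('a) n ())"
    by (rule mat_inverse(1)[OF inverse_mats_carrier(1)[OF assms]])
  moreover have "T \<in> Units (ring_mat TYPE('a) n ())"
    using inverse_mats_carrier[OF assms] unfolding Units_def ring_mat_def
    by (simp, intro bexI[of _ S] conjI)
  ultimately show ?thesis by simp
next
  case (Some S')
  then have "inverse_mats n T S'"
    using mat_inverse(2)[OF inverse_mats_carrier(1)[OF assms]] inverse_mats_carrier(1)[OF assms]
    unfolding inverse_mats_def by simp
  then show ?thesis using Some inverse_mats_unique[OF assms] by blast
qed

lemma gauge_eq:
  assumes "inverse_mats n T S"
  shows "gauge T M = S * M * T - S * map_mat ddx T"
  using mat_inverse_eq[OF assms] by (simp add: gauge_def)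

lemma gauge_carrier:
  assumes "inverse_mats n T S" "M \<in> carrier_mat n n"
  shows "gauge T M \<in> carrier_mat n n"
  using inverse_mats_carrier[OF assms(1)] assms(2) by (simp add: gauge_eq[OF assms(1)] minus_carrier_mat)

text \<open>An inverse-free form: the connection v -> M v - v' sends the columns of \<open>T\<close>
  to their combinations given by the columns of \<open>gauge T M\<close>. The composition rule and
  the lattice recursion are derived from it.\<close>

lemma mult_gauge:
  assumes T: "inverse_mats n T S" and M: "M \<in> carrier_mat n n"
  shows "T * gauge T M = M * T - map_mat ddx T"
proof -
  note c = inverse_mats_carrier[OF T]
  have 1: "S * M * T = S * (M * T)" using c M by simp
  have "T * gauge T M = T * (S * (M * T)) - T * (S * map_mat ddx T)"
    unfolding gauge_eq[OF T] 1 using c M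
    by (intro mult_minus_distrib_mat[of _ n n _ n]) auto
  also have "\<dots> = M * T - map_mat ddx T"
    using inverse_mats_cancel(1)[OF T] c M by (metis map_carrier_mat mult_carrier_mat)
  finally show ?thesis .
qed

lemma gauge_mult:
  assumes T: "inverse_mats n T S" and U: "inverse_mats n U V" and M: "M \<in> carrier_mat n n"
  shows "gauge (T * U) M = gauge U (gauge T M)"
proof -
  note t = inverse_mats_carrier[OF T] note u = inverse_mats_carrier[OF U]
  note TU = inverse_mats_mult[OF T U]
  note g = gauge_carrier[OF T M]
  have "T * (U * gauge U (gauge T M)) = T * (gauge T M * U - map_mat ddx U)"
    using mult_gauge[OF U g] by simp
  also have "\<dots> = T * (gauge T M * U) - T * map_mat ddx U"
    using t u g by (intro mult_minus_distrib_mat[of _ n n _ n]) auto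
  also have "T * (gauge T M * U) = T * gauge T M * U" using t u g by simp
  also have "\<dots> = (M * T - map_mat ddx T) * U" using mult_gauge[OF T M] by simp
  also have "\<dots> = M * T * U - map_mat ddx T * U"
    using t u M by (intro minus_mult_distrib_mat[of _ n n]) auto
  also have "M * T * U = M * (T * U)" using t u M by simp
  also have "M * (T * U) - map_mat ddx T * U - T * map_mat ddx U = M * (T * U) - map_mat ddx (T * U)"
    using t u M by (intro eq_matI) (auto simp: map_mat_ddx_mult[of T n n U n])
  also have "\<dots> = (T * U) * gauge (T * U) M" using mult_gauge[OF TU M] by simp
  finally have eq: "(T * U) * gauge U (gauge T M) = (T * U) * gauge (T * U) M"
    using t u gauge_carrier[OF U g] by simp
  show ?thesis
    using inverse_mats_cancel(2)[OF TU gauge_carrier[OF TU M]]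
      inverse_mats_cancel(2)[OF TU gauge_carrier[OF U g]] eq by simp
qed

lemma gauge_one:
  assumes M: "M \<in> carrier_mat n n"
  shows "gauge (1\<^sub>m n) M = M"
proof -
  have "map_mat ddx (1\<^sub>m n) = 0\<^sub>m n n" by (rule eq_matI) auto
  moreover have "M - 0\<^sub>m n n = M" using M by (intro eq_matI) auto
  ultimately show ?thesis using M by (simp add: gauge_eq[OF inverse_mats_one])
qed

lemma gauge_inverse:
  assumes T: "inverse_mats n T S" and M: "M \<in> carrier_mat n n"
  shows "gauge S (gauge T M) = M"
  using gauge_mult[OF T inverse_mats_sym[OF T] M] gauge_one[OF M] inverse_mats_carrier[OF T] by simp

lemma KK_mat_iff: "M \<in> KK_mat n \<longleftrightarrow> M \<in> carrier_mat n n \<and> (\<forall>i<n. \<forall>j<n. M $$ (i, j) \<in> KK)"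
  unfolding KK_mat_def elements_mat_def by (auto simp: UN_subset_iff image_subset_iff)

lemma KK_mat_carrier: "M \<in> KK_mat n \<Longrightarrow> M \<in> carrier_mat n n"
  by (simp add: KK_mat_def)

lemma KK_mat_mult: "A \<in> KK_mat n \<Longrightarrow> B \<in> KK_mat n \<Longrightarrow> A * B \<in> KK_mat n"
  by (auto simp: KK_mat_iff index_mult_mat_sum[of _ n n _ n] intro!: KK_sum KK_mult simp del: index_mult_mat(1))

lemma KK_mat_diff: "A \<in> KK_mat n \<Longrightarrow> B \<in> KK_mat n \<Longrightarrow> A - B \<in> KK_mat n"
  by (auto simp: KK_mat_iff intro!: KK_diff)

lemma KK_mat_smult: "A \<in> KK_mat n \<Longrightarrow> c \<in> KK \<Longrightarrow> c \<cdot>\<^sub>m A \<in> KK_mat n"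
  by (auto simp: KK_mat_iff intro!: KK_mult)

lemma KK_mat_ddx: "A \<in> KK_mat n \<Longrightarrow> map_mat ddx A \<in> KK_mat n"
  by (auto simp: KK_mat_iff intro!: KK_ddx)

lemma KK_mat_one: "1\<^sub>m n \<in> KK_mat n"
  by (auto simp: KK_mat_iff)

lemma KK_det:
  assumes A: "A \<in> carrier_mat n n" and K: "\<And>i j. i < n \<Longrightarrow> j < n \<Longrightarrow> A $$ (i, j) \<in> KK"
  shows "det A \<in> KK"
proof -
  have "signof p * (\<Prod>i = 0..<n. A $$ (i, p i)) \<in> KK" if p: "p permutes {0..<n}" for p
  proof -
    have "(\<Prod>i = 0..<n. A $$ (i, p i)) \<in> KK"
      using permutes_in_image[OF p] by (intro KK_prod) (auto intro: K)
    then show ?thesis by (auto simp: sign_def intro: KK_uminus)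
  qed
  then show ?thesis unfolding det_def'[OF A] by (intro KK_sum) auto
qed

text \<open>The adjugate formula keeps the inverse over \<open>KK\<close>, which is closed under
  sums, products and inverses.\<close>

lemma GL_KK_iff: "T \<in> GL_KK n \<longleftrightarrow> T \<in> KK_mat n \<and> det T \<noteq> 0"
proof
  assume "T \<in> GL_KK n"
  then obtain S where T: "T \<in> KK_mat n" "S \<in> KK_mat n" "T * S = 1\<^sub>m n"
    by (auto simp: GL_KK_def inverts_mat_def KK_mat_def)
  then have "det T * det S = 1"
    using det_mult[of T n S] by (auto simp: KK_mat_def)
  then show "T \<in> KK_mat n \<and> det T \<noteq> 0" using T by auto
next
  assume T: "T \<in> KK_mat n \<and> det T \<noteq> 0"
  then have Tc: "T \<in> carrier_mat n n" by (simp add: KK_mat_def)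
  define S where "S = inverse (det T) \<cdot>\<^sub>m adj_mat T"
  have I: "inverse_mats n T S" unfolding S_def using adj_mat_inverse[OF Tc] T by simp
  have "adj_mat T \<in> KK_mat n"
  proof -
    have "cofactor T j i \<in> KK" if "i < n" "j < n" for i j
    proof -
      have "det (mat_delete T j i) \<in> KK"
      proof (rule KK_det[of _ "n - 1"])
        show "mat_delete T j i $$ (a, b) \<in> KK" if "a < n - 1" "b < n - 1" for a b
          using T Tc that \<open>i < n\<close> \<open>j < n\<close> unfolding mat_delete_def KK_mat_iff by auto
      qed (use Tc mat_delete_carrier in auto)
      moreover have "(- 1 :: complex fls fls) ^ (j + i) \<in> KK"
        by (cases "even (i + j)") (auto simp: add.commute intro: KK_uminus)
      ultimately show ?thesis unfolding cofactor_def by (rule KK_mult[rotated])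
    qed
    then show ?thesis using Tc by (auto simp: adj_mat_def KK_mat_iff)
  qed
  then have "S \<in> KK_mat n" unfolding S_def
    using T by (intro KK_mat_smult KK_inverse KK_det[of _ n]) (auto simp: KK_mat_iff)
  then show "T \<in> GL_KK n"
    using T I by (auto simp: GL_KK_def inverts_mat_def inverse_mats_def KK_mat_def)
qed

lemma GL_KK_inverse:
  assumes "T \<in> GL_KK n"
  obtains S where "inverse_mats n T S" "S \<in> GL_KK n"
  using assms by (auto simp: GL_KK_def inverts_mat_def inverse_mats_def KK_mat_def)

lemma GL_KK_mult: "T \<in> GL_KK n \<Longrightarrow> U \<in> GL_KK n \<Longrightarrow> T * U \<in> GL_KK n"
  by (auto simp: GL_KK_iff KK_mat_mult det_mult[of _ n] KK_mat_carrier)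

lemma KK_mat_gauge:
  assumes "T \<in> GL_KK n" "M \<in> KK_mat n"
  shows "gauge T M \<in> KK_mat n"
proof -
  obtain S where S: "inverse_mats n T S" "S \<in> GL_KK n" using GL_KK_inverse[OF assms(1)] .
  then show ?thesis using assms
    by (auto simp: gauge_eq[OF S(1)] GL_KK_iff intro!: KK_mat_diff KK_mat_mult KK_mat_ddx)
qed

subsection \<open>Rank and the Cayley-Hamilton theorem\<close>

context vec_space
begin

lemma rank_eq_if_col_space_eq: "col_space A = col_space B \<Longrightarrow> rank A = rank B"
  by (simp add: rank_def col_space_def)

lemma rank_smult:
  assumes A: "A \<in> carrier_mat n nc" and c: "c \<noteq> 0"
  shows "rank (c \<cdot>\<^sub>m A) = rank A"
proof (rule rank_eq_if_col_space_eq)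
  have 1: "(c \<cdot>\<^sub>m A) *\<^sub>v x = A *\<^sub>v (c \<cdot>\<^sub>v x)" if "x \<in> carrier_vec nc" for x
    using A that by (intro eq_vecI) (auto simp: scalar_prod_def sum_distrib_left ac_simps)
  have 2: "A *\<^sub>v x = (c \<cdot>\<^sub>m A) *\<^sub>v (inverse c \<cdot>\<^sub>v x)" if "x \<in> carrier_vec nc" for x
    using A that c by (subst 1) (auto simp: smult_smult_assoc)
  have cA: "c \<cdot>\<^sub>m A \<in> carrier_mat n nc" using A by simp
  show "col_space (c \<cdot>\<^sub>m A) = col_space A"
    unfolding col_space_eq[OF A] col_space_eq[OF cA]
  proof (intro Collect_cong conj_cong iffI)
    fix y assume "\<exists>x\<in>carrier_vec (dim_col (c \<cdot>\<^sub>m A)). c \<cdot>\<^sub>m A *\<^sub>v x = y"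
    then obtain x where "x \<in> carrier_vec nc" "c \<cdot>\<^sub>m A *\<^sub>v x = y" using A by auto
    then show "\<exists>x\<in>carrier_vec (dim_col A). A *\<^sub>v x = y"
      using A 1 by (intro bexI[of _ "c \<cdot>\<^sub>v x"]) auto
  next
    fix y assume "\<exists>x\<in>carrier_vec (dim_col A). A *\<^sub>v x = y"
    then obtain x where "x \<in> carrier_vec nc" "A *\<^sub>v x = y" using A by auto
    then show "\<exists>x\<in>carrier_vec (dim_col (c \<cdot>\<^sub>m A)). c \<cdot>\<^sub>m A *\<^sub>v x = y"
      using A 2 by (intro bexI[of _ "inverse c \<cdot>\<^sub>v x"]) auto
  qed auto
qed

lemma invertible_cols_lin_indpt:
  assumes P: "P \<in> carrier_mat n n" and d: "det P \<noteq> 0"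
  shows "distinct (cols P)" "lin_indpt (set (cols P))"
proof -
  have r: "rank P = n" using det_rank_iff[OF P] d by simp
  then show "distinct (cols P)" using non_distinct_low_rank[OF P] by auto
  then show "lin_indpt (set (cols P))" using full_rank_lin_indpt[OF P r] by simp
qed

text \<open>Gauss-Jordan elimination gives \<open>E = Q * A\<close>, and \<open>P\<close> is the
  inverse of \<open>Q\<close>. Pivot columns of \<open>E\<close> are unit vectors, so
  \<open>A = P * E\<close> shows that the corresponding columns of \<open>P\<close> are columns of
  \<open>A\<close>: they form a basis of the image, completed by the rest of \<open>P\<close>. The
  last claim records the zero rows of \<open>E\<close>.\<close>

lemma rank_decomposition:
  assumes A: "A \<in> carrier_mat n n"
  obtains P Q f where "inverse_mats n P Q" "inj_on f {..<rank A}"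
    "\<And>j. j < rank A \<Longrightarrow> f j < n"
    "\<And>i j. j < rank A \<Longrightarrow> i < n \<Longrightarrow> P $$ (i, j) = A $$ (i, f j)"
    "\<And>i j. rank A \<le> i \<Longrightarrow> i < n \<Longrightarrow> j < n \<Longrightarrow> (Q * A) $$ (i, j) = 0"
proof -
  define E where "E = gauss_jordan_single A"
  note g = gauss_jordan_single[OF A E_def[symmetric]]
  obtain Q P where E: "E = Q * A" and QP: "inverse_mats n P Q"
    using g(4) by (auto simp: inverse_mats_def)
  note c = inverse_mats_carrier[OF QP]
  obtain f where f: "pivot_fun E f n" using g(2,3) by (auto simp: row_echelon_form_def)
  have dE: "dim_row E = n" using g(2) by auto
  note fD = pivot_funD[OF dE f]
  \<comment> \<open>The number of nonzero rows of \<open>E\<close>; a pivot position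
    \<open>n\<close> marks a zero row.\<close>
  define p where "p = (LEAST k. k \<ge> n \<or> f k = n)"
  have p: "p \<ge> n \<or> f p = n" unfolding p_def by (rule LeastI[of _ n]) simp
  have pn: "p \<le> n" unfolding p_def by (rule Least_le) simp
  have lt: "f i < n" if "i < p" for i
    using not_less_Least[of i "\<lambda>k. k \<ge> n \<or> f k = n"] that fD(1)[of i] unfolding p_def[symmetric]
    by (auto simp: not_le le_less)
  have ge: "f i = n" if "p \<le> i" "i < n" for i
    using that pivot_bound[OF dE f, of p "i - p"] p fD(1)[of i] by auto
  have Erow: "E $$ (i, j) = 0" if "p \<le> i" "i < n" "j < n" for i j
    using fD(2)[of i j] ge[OF that(1,2)] that by simp
  have Epiv: "E $$ (k, f i) = (if k = i then 1 else 0)" if "i < p" "k < n" for i k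
    using fD(4)[of i] fD(5)[of i k] lt[OF that(1)] that pn by auto
  have inj: "inj_on f {..<p}"
  proof (rule inj_onI)
    fix i j assume "i \<in> {..<p}" "j \<in> {..<p}" "f i = f j"
    then have "E $$ (j, f i) = 1" "i < p" "j < n" using Epiv[of j j] pn by simp_all
    then show "i = j" using Epiv[of i j] by (cases "j = i") simp_all
  qed
  have PE: "P * E = A" unfolding E using inverse_mats_cancel(1)[OF QP A] .
  have Pcol: "P $$ (i, j) = A $$ (i, f j)" if "j < p" "i < n" for i j
  proof -
    have "A $$ (i, f j) = (\<Sum>k<n. P $$ (i, k) * E $$ (k, f j))"
      unfolding PE[symmetric] using c g(2) that lt[OF that(1)] by (intro index_mult_mat_sum) auto
    also have "\<dots> = (\<Sum>k<n. if k = j then P $$ (i, j) else 0)"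
      using that by (intro sum.cong) (auto simp: Epiv)
    also have "\<dots> = P $$ (i, j)" using that pn by simp
    finally show ?thesis ..
  qed
  define ws where "ws = map (col P) [0..<p]"
  define B where "B = mat_of_cols n ws"
  have ws: "set ws \<subseteq> carrier_vec n" using c unfolding ws_def by auto
  have lws: "length ws = p" by (simp add: ws_def)
  have B: "B \<in> carrier_mat n p" unfolding B_def using lws by auto
  have colsB: "cols B = ws" unfolding B_def using ws by (simp add: cols_mat_of_cols)
  have Bij: "B $$ (i, j) = P $$ (i, j)" if "i < n" "j < p" for i j
    using that pn c unfolding B_def ws_def by (auto simp: mat_of_cols_index)
  have dP: "det P \<noteq> 0" using inverse_mats_det[OF QP] by auto
  note li = invertible_cols_lin_indpt[OF c(1) dP]
  have ws_take: "ws = take p (cols P)"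
    unfolding ws_def cols_def using c pn by (auto simp: take_map)
  have rB: "rank B = p"
  proof (rule lin_indpt_full_rank[OF B])
    show "distinct (cols B)" unfolding colsB ws_take using li(1) by (rule distinct_take)
    show "lin_indpt (set (cols B))" unfolding colsB ws_take
      by (rule subset_li_is_li[OF li(2)]) (rule set_take_subset)
  qed
  \<comment> \<open>The first \<open>p\<close> columns of \<open>P\<close> span the image of
    \<open>A\<close>, because the entries of \<open>E *\<^sub>v x\<close> from \<open>p\<close> on
    vanish. As they are independent, \<open>p\<close> is the rank.\<close>
  have "col_space A = col_space B"
  proof
    show "col_space A \<subseteq> col_space B"
      unfolding col_space_eq[OF A] col_space_eq[OF B]
    proof safe
      fix x :: "'a vec" assume x: "x \<in> carrier_vec (dim_col A)"
      define u where "u = vec p (\<lambda>k. (E *\<^sub>v x) $ k)"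
      have "A *\<^sub>v x = P *\<^sub>v (E *\<^sub>v x)"
        unfolding PE[symmetric] using c g(2) x A by (intro assoc_mult_mat_vec) auto
      also have "\<dots> = B *\<^sub>v u"
      proof (rule eq_vecI)
        fix i assume "i < dim_vec (B *\<^sub>v u)"
        then have i: "i < n" using B by simp
        have E0: "(E *\<^sub>v x) $ k = 0" if "k \<in> {..<n} - {..<p}" for k
          using that Erow[of k] g(2) x A by (auto simp: scalar_prod_def intro!: sum.neutral)
        have "(P *\<^sub>v (E *\<^sub>v x)) $ i = (\<Sum>k<n. P $$ (i, k) * (E *\<^sub>v x) $ k)"
          using c g(2) i by (auto simp: scalar_prod_def lessThan_atLeast0)
        also have "\<dots> = (\<Sum>k<p. P $$ (i, k) * (E *\<^sub>v x) $ k)"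
          using pn E0 by (intro sum.mono_neutral_right) auto
        also have "\<dots> = (B *\<^sub>v u) $ i"
          using B i Bij by (auto simp: scalar_prod_def lessThan_atLeast0 u_def)
        finally show "(P *\<^sub>v (E *\<^sub>v x)) $ i = (B *\<^sub>v u) $ i" .
      qed (use B c in auto)
      finally show "\<exists>y\<in>carrier_vec (dim_col B). B *\<^sub>v y = A *\<^sub>v x"
        using B by (intro bexI[of _ u]) (auto simp: u_def)
      show "A *\<^sub>v x \<in> carrier_vec (dim_row B)" using A B x by auto
    qed
    have "set ws \<subseteq> set (cols A)"
    proof
      fix w assume "w \<in> set ws"
      then obtain j where j: "j < p" "w = col P j" by (auto simp: ws_def)
      then have "w = col A (f j)"
        using Pcol[OF j(1)] c A lt[OF j(1)] pn by (intro eq_vecI) auto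
      then show "w \<in> set (cols A)" using lt[OF j(1)] A by (auto simp: cols_def)
    qed
    then show "col_space B \<subseteq> col_space A"
      unfolding col_space_def colsB by (rule span_is_monotone)
  qed
  from rank_eq_if_col_space_eq[OF this] have r: "rank A = p" using rB by simp
  show ?thesis
  proof (rule that[OF QP])
    show "(Q * A) $$ (i, j) = 0" if "rank A \<le> i" "i < n" "j < n" for i j
      using Erow[of i j] that r unfolding E by simp
  qed (use r inj lt Pcol in auto)
qed

text \<open>The basis columns supplied by the decomposition come from distinct columns of
  \<open>A\<close>, and none is zero as \<open>P\<close> is invertible; so their indices inject into
  those below \<open>q\<close>.\<close>

lemma rank_le_nonzero_cols:
  assumes A: "A \<in> carrier_mat n n" and z: "\<And>i j. i < n \<Longrightarrow> q \<le> j \<Longrightarrow> j < n \<Longrightarrow> A $$ (i, j) = 0"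
  shows "rank A \<le> q"
proof -
  obtain P Q f where *: "inverse_mats n P Q" "inj_on f {..<rank A}"
    "\<And>j. j < rank A \<Longrightarrow> f j < n"
    "\<And>i j. j < rank A \<Longrightarrow> i < n \<Longrightarrow> P $$ (i, j) = A $$ (i, f j)"
    using rank_decomposition[OF A] by metis
  have "f j < q" if j: "j < rank A" for j
  proof (rule ccontr)
    assume "\<not> f j < q"
    then have 0: "P $$ (i, j) = 0" if "i < n" for i
      using *(3,4)[OF j] z[of i "f j"] that by auto
    have jn: "j < n" using j rank_le_nc[OF A] by simp
    have "(Q * P) $$ (j, j) = (\<Sum>k<n. Q $$ (j, k) * P $$ (k, j))"
      using inverse_mats_carrier[OF *(1)] jn by (intro index_mult_mat_sum) auto
    then show False using inverse_mats_carrier[OF *(1)] jn 0 by simp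
  qed
  then have "f ` {..<rank A} \<subseteq> {..<q}" by auto
  from card_inj_on_le[OF *(2) this] show ?thesis by simp
qed

lemma rank_pos:
  assumes A: "A \<in> carrier_mat n n" and nz: "A \<noteq> 0\<^sub>m n n"
  shows "rank A > 0"
proof (rule ccontr)
  assume "\<not> rank A > 0"
  then have r: "rank A = 0" by simp
  obtain P Q f where *: "inverse_mats n P Q"
    "\<And>i j. rank A \<le> i \<Longrightarrow> i < n \<Longrightarrow> j < n \<Longrightarrow> (Q * A) $$ (i, j) = 0"
    using rank_decomposition[OF A] by metis
  note c = inverse_mats_carrier[OF *(1)]
  have "Q * A = 0\<^sub>m n n" using *(2) r c A by (intro eq_matI) auto
  then have "A = P * 0\<^sub>m n n" using inverse_mats_cancel(1)[OF *(1) A] by simp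
  then show False using nz c by simp
qed

end

text \<open>The characteristic matrix times its adjugate \<open>B\<close>, read as a polynomial with
  matrix coefficients, is the characteristic polynomial times the identity. Comparing coefficients
  and weighting them by powers of \<open>A\<close> gives a telescoping sum.\<close>

lemma cayley_hamilton:
  fixes A :: "'a::comm_ring_1 mat"
  assumes A: "A \<in> carrier_mat n n" and ab: "a < n" "b < n"
  shows "(\<Sum>i\<le>n. coeff (char_poly A) i * (A ^\<^sub>m i) $$ (a, b)) = 0"
proof -
  define B where "B = adj_mat (char_poly_matrix A)"
  define chi where "chi = char_poly A"
  note adj = adj_mat[OF char_poly_matrix_closed[OF A]]
  have B: "B \<in> carrier_mat n n" unfolding B_def using adj by simp
  define Bc where "Bc j = map_mat (\<lambda>p. coeff p j) B" for j
  have Bc: "Bc j \<in> carrier_mat n n" for j unfolding Bc_def using B by simp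
  have CB: "char_poly_matrix A * B = chi \<cdot>\<^sub>m 1\<^sub>m n"
    unfolding B_def chi_def char_poly_def using adj(2) .
  have prod: "[:0, 1:] * B $$ (i, k) - (\<Sum>l<n. [:A $$ (i, l):] * B $$ (l, k)) = (if i = k then chi else 0)"
    if "i < n" "k < n" for i k
  proof -
    have "(if i = k then chi else 0) = (\<Sum>l<n. char_poly_matrix A $$ (i, l) * B $$ (l, k))"
      using arg_cong[OF CB, of "\<lambda>M. M $$ (i, k)"] that
        index_mult_mat_sum[OF char_poly_matrix_closed[OF A] B that] by simp
    also have "\<dots> = (\<Sum>l<n. (if l = i then [:0, 1:] * B $$ (l, k) else 0) - [:A $$ (i, l):] * B $$ (l, k))"
      using that A by (intro sum.cong) (auto simp: char_poly_matrix_def algebra_simps)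
    also have "\<dots> = [:0, 1:] * B $$ (i, k) - (\<Sum>l<n. [:A $$ (i, l):] * B $$ (l, k))"
      using that by (simp add: sum_subtractf)
    finally show ?thesis ..
  qed
  have chi_Suc: "coeff chi (Suc j) \<cdot>\<^sub>m 1\<^sub>m n = Bc j - A * Bc (Suc j)" for j
  proof (rule eq_matI)
    fix i k assume "i < dim_row (Bc j - A * Bc (Suc j))" "k < dim_col (Bc j - A * Bc (Suc j))"
    then have ik: "i < n" "k < n" using A Bc[of "Suc j"] by auto
    have AB: "(A * Bc (Suc j)) $$ (i, k) = (\<Sum>l<n. A $$ (i, l) * coeff (B $$ (l, k)) (Suc j))"
      by (subst index_mult_mat_sum[OF A Bc ik]) (use ik B in \<open>auto simp: Bc_def\<close>)
    show "(coeff chi (Suc j) \<cdot>\<^sub>m 1\<^sub>m n) $$ (i, k) = (Bc j - A * Bc (Suc j)) $$ (i, k)"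
      using arg_cong[OF prod[OF ik], of "\<lambda>p. coeff p (Suc j)"] ik A Bc[of j] Bc[of "Suc j"] B
      by (auto simp: AB coeff_sum simp del: index_mult_mat(1)) (auto simp: Bc_def)
  qed (use A Bc[of "Suc j"] in auto)
  have chi_0: "coeff chi 0 \<cdot>\<^sub>m 1\<^sub>m n = - (A * Bc 0)"
  proof (rule eq_matI)
    fix i k assume "i < dim_row (- (A * Bc 0))" "k < dim_col (- (A * Bc 0))"
    then have ik: "i < n" "k < n" using A Bc[of 0] by auto
    have AB: "(A * Bc 0) $$ (i, k) = (\<Sum>l<n. A $$ (i, l) * coeff (B $$ (l, k)) 0)"
      by (subst index_mult_mat_sum[OF A Bc ik]) (use ik B in \<open>auto simp: Bc_def\<close>)
    show "(coeff chi 0 \<cdot>\<^sub>m 1\<^sub>m n) $$ (i, k) = (- (A * Bc 0)) $$ (i, k)"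
      using arg_cong[OF prod[OF ik], of "\<lambda>p. coeff p 0"] ik A Bc[of 0] B
      by (auto simp: AB coeff_sum simp del: index_mult_mat(1))
  qed (use A Bc[of 0] in auto)
  have Ap: "A ^\<^sub>m k \<in> carrier_mat n n" for k using A by simp
  \<comment> \<open>Telescoping leaves one boundary term, which vanishes once \<open>m\<close>
    exceeds the degrees of all entries of \<open>B\<close>.\<close>
  have partial: "(\<Sum>i\<le>m. coeff chi i * (A ^\<^sub>m i) $$ (a, b)) = - (A ^\<^sub>m Suc m * Bc m) $$ (a, b)" for m
  proof (induction m)
    case 0
    show ?case
      using arg_cong[OF chi_0, of "\<lambda>M. M $$ (a, b)"] ab A Bc[of 0] by simp
  next
    case (Suc m)
    have "coeff chi (Suc m) \<cdot>\<^sub>m (A ^\<^sub>m Suc m) = A ^\<^sub>m Suc m * (coeff chi (Suc m) \<cdot>\<^sub>m 1\<^sub>m n)"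
      using right_mult_one_mat[OF Ap[of "Suc m"]] Ap[of "Suc m"]
      by (subst mult_smult_distrib[of _ n n _ n]) (simp_all del: pow_mat.simps)
    also have "\<dots> = A ^\<^sub>m Suc m * Bc m - A ^\<^sub>m Suc m * (A * Bc (Suc m))"
      unfolding chi_Suc using Ap[of "Suc m"] Bc A
      by (intro mult_minus_distrib_mat[of _ n n _ n]) (auto simp del: pow_mat.simps)
    also have "A ^\<^sub>m Suc m * (A * Bc (Suc m)) = A ^\<^sub>m Suc (Suc m) * Bc (Suc m)"
      using Ap[of "Suc m"] Bc[of "Suc m"] A
      by (subst assoc_mult_mat[symmetric, of _ n n _ n _ n]) auto
    finally have "(coeff chi (Suc m) \<cdot>\<^sub>m (A ^\<^sub>m Suc m)) $$ (a, b) =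
      (A ^\<^sub>m Suc m * Bc m - A ^\<^sub>m Suc (Suc m) * Bc (Suc m)) $$ (a, b)" by simp
    then have "coeff chi (Suc m) * (A ^\<^sub>m Suc m) $$ (a, b) =
      (A ^\<^sub>m Suc m * Bc m) $$ (a, b) - (A ^\<^sub>m Suc (Suc m) * Bc (Suc m)) $$ (a, b)"
      using ab carrier_matD[OF Ap[of "Suc m"]] carrier_matD[OF Ap[of "Suc (Suc m)"]]
        carrier_matD[OF Bc[of m]] carrier_matD[OF Bc[of "Suc m"]]
      by (simp del: pow_mat.simps index_mult_mat(1))
    then show ?case using Suc.IH by simp
  qed
  define m where "m = Suc (Max ((\<lambda>(i, j). degree (B $$ (i, j))) ` ({..<n} \<times> {..<n}))) + n"
  have "Bc m = 0\<^sub>m n n"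
  proof (rule eq_matI)
    fix i k assume ik: "i < dim_row (0\<^sub>m n n :: 'a mat)" "k < dim_col (0\<^sub>m n n :: 'a mat)"
    then have "degree (B $$ (i, k)) \<le> Max ((\<lambda>(i, j). degree (B $$ (i, j))) ` ({..<n} \<times> {..<n}))"
      by (intro Max_ge) (auto intro!: image_eqI[of _ _ "(i, k)"])
    then have "degree (B $$ (i, k)) < m" unfolding m_def by simp
    then show "Bc m $$ (i, k) = 0\<^sub>m n n $$ (i, k)"
      using ik B by (simp add: Bc_def coeff_eq_0)
  qed (use Bc[of m] in auto)
  then have "A ^\<^sub>m Suc m * Bc m = 0\<^sub>m n n" using right_mult_zero_mat[OF Ap[of "Suc m"]] by simp
  then have "(\<Sum>i\<le>m. coeff chi i * (A ^\<^sub>m i) $$ (a, b)) = 0" using partial[of m] ab by simp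
  moreover have "(\<Sum>i\<le>m. coeff chi i * (A ^\<^sub>m i) $$ (a, b)) = (\<Sum>i\<le>n. coeff chi i * (A ^\<^sub>m i) $$ (a, b))"
    using degree_monic_char_poly[OF A]
    by (intro sum.mono_neutral_right) (auto simp: m_def chi_def coeff_eq_0)
  ultimately show ?thesis by (simp add: chi_def)
qed

text \<open>Substitute c lambda for lambda: det(c lambda I - c A) = c^n det(lambda I - A). There is
  no division in the identity because \<open>c\<close> may fail to be invertible.\<close>

lemma coeff_char_poly_smult:
  fixes A :: "'a::comm_ring_1 mat"
  assumes A: "A \<in> carrier_mat n n"
  shows "c ^ i * coeff (char_poly (c \<cdot>\<^sub>m A)) i = c ^ n * coeff (char_poly A) i"
proof -
  define s where "s p = pcompose p [:0, c:]" for p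
  interpret s: comm_ring_hom s
    by unfold_locales (auto simp: s_def pcompose_add pcompose_mult pcompose_1)
  have "map_mat s (char_poly_matrix (c \<cdot>\<^sub>m A)) = [:c:] \<cdot>\<^sub>m char_poly_matrix A"
    using A by (intro eq_matI) (auto simp: char_poly_matrix_def s_def pcompose_pCons)
  then have "s (char_poly (c \<cdot>\<^sub>m A)) = [:c:] ^ n * char_poly A"
    unfolding char_poly_def using s.hom_det[of "char_poly_matrix (c \<cdot>\<^sub>m A)"]
      char_poly_matrix_closed[OF A] by simp
  then have "coeff (s (char_poly (c \<cdot>\<^sub>m A))) i = coeff ([:c ^ n:] * char_poly A) i"
    by (simp add: poly_const_pow)
  moreover have "coeff (s p) i = c ^ i * coeff p i" for p :: "'a poly"
    unfolding s_def by (simp add: coeff_pcompose_linear)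
  ultimately show ?thesis by simp
qed

subsection \<open>Leading terms of characteristic polynomials\<close>

lemma regpart_comm_ring_hom: "comm_ring_hom (fps_to_fls :: 'a::comm_ring_1 fps \<Rightarrow> 'a fls)"
  by unfold_locales (auto simp: fls_times_fps_to_fls)

lemma fps_nth_0_comm_ring_hom: "comm_ring_hom (\<lambda>f. fps_nth f 0 :: 'a::comm_ring_1)"
  by unfold_locales auto

lemma fps_to_fls_regpart: "ord_ge 0 f \<Longrightarrow> fps_to_fls (fls_regpart f) = f"
  by (rule fls_eqI) (auto simp: ord_ge_def)

text \<open>Characteristic polynomials commute with ring homomorphisms, here with the inclusion of
  the power series and with reduction modulo the variable.\<close>

lemma char_poly_lead_integral:
  fixes Y :: "'a::field fls mat"
  assumes Y: "Y \<in> carrier_mat n n" and 0: "mat_ord_ge 0 Y"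
  shows "ord_ge 0 (coeff (char_poly Y) i)"
    and "fls_nth (coeff (char_poly Y) i) 0 = coeff (char_poly (map_mat (\<lambda>f. fls_nth f 0) Y)) i"
proof -
  define Y' where "Y' = map_mat fls_regpart Y"
  have Y': "Y' \<in> carrier_mat n n" using Y by (simp add: Y'_def)
  interpret r: comm_ring_hom "fps_to_fls :: 'a fps \<Rightarrow> 'a fls" by (rule regpart_comm_ring_hom)
  interpret z: comm_ring_hom "\<lambda>f. fps_nth f 0 :: 'a" by (rule fps_nth_0_comm_ring_hom)
  have eq: "Y = map_mat fps_to_fls Y'"
    using Y mat_ord_geD[OF 0 Y] by (intro eq_matI) (auto simp: Y'_def fps_to_fls_regpart)
  have c: "coeff (char_poly Y) i = fps_to_fls (coeff (char_poly Y') i)"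
    unfolding eq r.char_poly_hom[OF Y'] by simp
  show "ord_ge 0 (coeff (char_poly Y) i)" unfolding c by (simp add: ord_ge_def)
  have "map_mat (\<lambda>f. fls_nth f 0) Y = map_mat (\<lambda>f. fps_nth f 0) Y'"
    using Y by (intro eq_matI) (auto simp: Y'_def)
  then show "fls_nth (coeff (char_poly Y) i) 0 = coeff (char_poly (map_mat (\<lambda>f. fls_nth f 0) Y)) i"
    unfolding c using z.char_poly_hom[OF Y'] by simp
qed

text \<open>Coefficient \<open>i\<close> is homogeneous of degree \<open>n - i\<close> in the
  matrix, so scaling by the \<open>w\<close>-th power of the variable reduces to the integral
  case.\<close>

lemma char_poly_lead:
  fixes X :: "'a::field fls mat"
  assumes X: "X \<in> carrier_mat n n" and w: "mat_ord_ge (- w) X" and i: "i \<le> n"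
  shows "ord_ge (- w * int (n - i)) (coeff (char_poly X) i)"
    and "fls_nth (coeff (char_poly X) i) (- w * int (n - i)) =
      coeff (char_poly (map_mat (\<lambda>f. fls_nth f (- w)) X)) i"
proof -
  define Y where "Y = X_pow w \<cdot>\<^sub>m X"
  have Y: "Y \<in> carrier_mat n n" using X by (simp add: Y_def)
  have 0: "mat_ord_ge 0 Y" unfolding Y_def
    by (rule mat_ord_ge_smult[OF w ord_ge_X_pow[OF order_refl]]) simp
  note c = char_poly_lead_integral[OF Y 0, of i]
  have "X_pow (w * int i) * coeff (char_poly Y) i = X_pow (w * int n) * coeff (char_poly X) i"
    using coeff_char_poly_smult[OF X, of "X_pow w" i]
    unfolding Y_def by (simp add: X_pow_power mult.commute)
  then have "X_pow (- (w * int n)) * (X_pow (w * int i) * coeff (char_poly Y) i) = coeff (char_poly X) i"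
    by (simp flip: mult.assoc)
  then have eq: "coeff (char_poly X) i = X_pow (- w * int (n - i)) * coeff (char_poly Y) i"
    using i by (simp add: of_nat_diff algebra_simps flip: X_pow_add)
  show "ord_ge (- w * int (n - i)) (coeff (char_poly X) i)"
    unfolding eq using c(1) by (simp add: ord_ge_X_pow_mult)
  have "map_mat (\<lambda>f. fls_nth f (- w)) X = map_mat (\<lambda>f. fls_nth f 0) Y"
    using X by (intro eq_matI) (auto simp: Y_def nth_X_pow_mult)
  then show "fls_nth (coeff (char_poly X) i) (- w * int (n - i)) =
      coeff (char_poly (map_mat (\<lambda>f. fls_nth f (- w)) X)) i"
    unfolding eq using c(2) by (simp add: nth_X_pow_mult)
qed

text \<open>The bound \<open>1 - w\<close> hides the logarithmic derivative from the coefficient of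
  order \<open>- w\<close>; what remains there comes from a conjugate of \<open>X\<close>, with the
  same characteristic polynomial. Bounding the conjugate instead of \<open>X\<close> allows
  \<open>X\<close> to have a larger pole.\<close>

lemma gauge_char_poly_lead:
  assumes T: "inverse_mats n T S" and X: "X \<in> carrier_mat n n"
    and 1: "mat_ord_ge (1 - w) (S * map_mat ddx T)" and 2: "mat_ord_ge (- w) (S * X * T)" and i: "i \<le> n"
  shows "mat_ord_ge (- w) (gauge T X)"
    and "fls_nth (coeff (char_poly (gauge T X)) i) (- w * int (n - i)) =
      fls_nth (coeff (char_poly X) i) (- w * int (n - i))"
proof -
  note t = inverse_mats_carrier[OF T]
  have c: "S * X * T \<in> carrier_mat n n" "S * map_mat ddx T \<in> carrier_mat n n" using t X by auto
  show g: "mat_ord_ge (- w) (gauge T X)"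
    unfolding gauge_eq[OF T] by (rule mat_ord_ge_diff[OF c 2 mat_ord_ge_mono[OF 1]]) simp
  have "map_mat (\<lambda>f. fls_nth f (- w)) (gauge T X) = map_mat (\<lambda>f. fls_nth f (- w)) (S * X * T)"
    unfolding gauge_eq[OF T]
  proof (rule eq_matI, goal_cases)
    case (1 i j)
    then have ij: "i < n" "j < n" using c by auto
    have "fls_nth ((S * map_mat ddx T) $$ (i, j)) (- w) = 0"
      using mat_ord_geD[OF \<open>mat_ord_ge (1 - w) (S * map_mat ddx T)\<close> c(2) ij] by (simp add: ord_ge_def)
    moreover have "(S * X * T - S * map_mat ddx T) $$ (i, j)
        = (S * X * T) $$ (i, j) - (S * map_mat ddx T) $$ (i, j)"
      by (rule index_minus_mat(1)) (use ij c in auto)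
    ultimately show ?case using ij carrier_matD[OF c(1)] carrier_matD[OF c(2)]
      by (simp del: index_mult_mat(1) index_minus_mat(1))
  qed (use c in auto)
  moreover have "char_poly (S * X * T) = char_poly X"
    by (rule char_poly_similar, unfold similar_mat_def, intro exI[of _ S] exI[of _ T])
      (use t X in \<open>auto simp: similar_mat_wit_def Let_def\<close>)
  ultimately show "fls_nth (coeff (char_poly (gauge T X)) i) (- w * int (n - i)) =
      fls_nth (coeff (char_poly X) i) (- w * int (n - i))"
    using char_poly_lead(2)[OF gauge_carrier[OF T X] g i] char_poly_lead(2)[OF c(1) 2 i] by simp
qed

section \<open>Matrices invertible over the power series\<close>

definition unimodular :: "nat \<Rightarrow> 'a::comm_ring_1 fls mat \<Rightarrow> 'a fls mat \<Rightarrow> bool" where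
  "unimodular n P Q \<longleftrightarrow> inverse_mats n P Q \<and> mat_ord_ge 0 P \<and> mat_ord_ge 0 Q"

lemma unimodular_sym: "unimodular n P Q \<Longrightarrow> unimodular n Q P"
  by (auto simp: unimodular_def inverse_mats_sym)

lemma unimodular_mult:
  assumes "unimodular n P Q" "unimodular n P' Q'"
  shows "unimodular n (P * P') (Q' * Q)"
  using assms inverse_mats_mult[of n P Q P' Q'] unfolding unimodular_def
  by (auto intro!: mat_ord_ge_mult[of _ n n _ n 0 0] dest: inverse_mats_carrier)

lemma unimodular_one: "unimodular n (1\<^sub>m n) (1\<^sub>m n)"
  by (simp add: unimodular_def inverse_mats_one)

lemma gauge_unimodular:
  assumes P: "unimodular n P Q" and X: "X \<in> carrier_mat n n" "mat_ord_ge (- w) X" and w: "w \<ge> 1" and i: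
      "i \<le> n"
  shows "mat_ord_ge (- w) (gauge P X)"
    and "fls_nth (coeff (char_poly (gauge P X)) i) (- w * int (n - i)) =
      fls_nth (coeff (char_poly X) i) (- w * int (n - i))"
proof -
  have I: "inverse_mats n P Q" and 0: "mat_ord_ge 0 P" "mat_ord_ge 0 Q" using P by
      (auto simp: unimodular_def)
  note c = inverse_mats_carrier[OF I]
  have 1: "mat_ord_ge (1 - w) (Q * map_mat ddx P)"
    by (rule mat_ord_ge_mult[OF c(2) _ 0(2) mat_ord_ge_ddx[OF 0(1)]]) (use c w in auto)
  have "mat_ord_ge (- w) (Q * X)" by (rule mat_ord_ge_mult[OF c(2) X(1) 0(2) X(2)]) simp
  then have 2: "mat_ord_ge (- w) (Q * X * P)"
    by (rule mat_ord_ge_mult[OF mult_carrier_mat[OF c(2) X(1)] c(1) _ 0(1)]) simp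
  show "mat_ord_ge (- w) (gauge P X)"
    "fls_nth (coeff (char_poly (gauge P X)) i) (- w * int (n - i)) =
      fls_nth (coeff (char_poly X) i) (- w * int (n - i))"
    using gauge_char_poly_lead[OF I X(1) 1 2 i] .
qed

subsection \<open>Smith form\<close>

definition perm_mat :: "nat \<Rightarrow> (nat \<Rightarrow> nat) \<Rightarrow> 'a::semiring_1 mat" where
  "perm_mat n \<pi> = mat n n (\<lambda>(i, j). if j = \<pi> i then 1 else 0)"

lemma perm_mat_mult:
  assumes "A \<in> carrier_mat n m" "\<And>i. i < n \<Longrightarrow> \<pi> i < n" "i < n" "j < m"
  shows "(perm_mat n \<pi> * A) $$ (i, j) = A $$ (\<pi> i, j)"
proof -
  have "(perm_mat n \<pi> * A) $$ (i, j) = (\<Sum>k<n. perm_mat n \<pi> $$ (i, k) * A $$ (k, j))"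
    by (rule index_mult_mat_sum) (use assms in \<open>auto simp: perm_mat_def\<close>)
  also have "\<dots> = (\<Sum>k<n. if k = \<pi> i then A $$ (k, j) else 0)"
    by (rule sum.cong) (use assms in \<open>auto simp: perm_mat_def\<close>)
  also have "\<dots> = A $$ (\<pi> i, j)" using assms by simp
  finally show ?thesis .
qed

text \<open>Right multiplication permutes the columns by the inverse of the permutation; for an
  involution, such as a transposition, this is the permutation itself.\<close>

lemma mult_perm_mat:
  assumes "A \<in> carrier_mat m n" "\<And>i. i < n \<Longrightarrow> \<pi> i < n" "\<And>i. i < n \<Longrightarrow> \<pi> (\<pi> i) = i" "i < m" "j < n"
  shows "(A * perm_mat n \<pi>) $$ (i, j) = A $$ (i, \<pi> j)"
proof -
  have "(A * perm_mat n \<pi>) $$ (i, j) = (\<Sum>k<n. A $$ (i, k) * perm_mat n \<pi> $$ (k, j))"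
    by (rule index_mult_mat_sum) (use assms in \<open>auto simp: perm_mat_def\<close>)
  also have "\<dots> = (\<Sum>k<n. if k = \<pi> j then A $$ (i, k) else 0)"
    by (rule sum.cong) (use assms in \<open>auto simp: perm_mat_def\<close>)
  also have "\<dots> = A $$ (i, \<pi> j)" using assms by simp
  finally show ?thesis .
qed

lemma unimodular_perm_mat:
  assumes "\<And>i. i < n \<Longrightarrow> \<pi> i < n" "\<And>i. i < n \<Longrightarrow> \<pi> (\<pi> i) = i"
  shows "unimodular n (perm_mat n \<pi>) (perm_mat n \<pi> :: 'a::comm_ring_1 fls mat)"
proof -
  have c: "(perm_mat n \<pi> :: 'a fls mat) \<in> carrier_mat n n" by (simp add: perm_mat_def)
  have "perm_mat n \<pi> * perm_mat n \<pi> = (1\<^sub>m n :: 'a fls mat)"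
  proof (rule eq_matI)
    fix i j assume "i < dim_row (1\<^sub>m n :: 'a fls mat)" "j < dim_col (1\<^sub>m n :: 'a fls mat)"
    then have ij: "i < n" "j < n" by auto
    then show "(perm_mat n \<pi> * perm_mat n \<pi> :: 'a fls mat) $$ (i, j) = 1\<^sub>m n $$ (i, j)"
      by (subst perm_mat_mult[OF c assms(1) ij]) (use assms ij in \<open>auto simp: perm_mat_def\<close>)
  qed (auto simp: perm_mat_def)
  moreover have "mat_ord_ge 0 (perm_mat n \<pi> :: 'a fls mat)"
    by (rule mat_ord_geI[OF c]) (auto simp: perm_mat_def)
  ultimately show ?thesis using c by (auto simp: unimodular_def inverse_mats_def)
qed

text \<open>As a left factor it adds \<open>v i\<close> times row \<open>k\<close> to every row
  \<open>i\<close>, so one factor clears a whole column; with \<open>v k = 0\<close> the inverse is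
  obtained by negating \<open>v\<close>.\<close>

definition transvection :: "nat \<Rightarrow> nat \<Rightarrow> (nat \<Rightarrow> 'a::comm_ring_1) \<Rightarrow> 'a mat" where
  "transvection n k v = mat n n (\<lambda>(i, j). (if i = j then 1 else 0) + (if j = k then v i else 0))"

lemma transvection_mult:
  assumes "A \<in> carrier_mat n m" "k < n" "i < n" "j < m"
  shows "(transvection n k v * A) $$ (i, j) = A $$ (i, j) + v i * A $$ (k, j)"
proof -
  have "(transvection n k v * A) $$ (i, j) = (\<Sum>l<n. transvection n k v $$ (i, l) * A $$ (l, j))"
    by (rule index_mult_mat_sum) (use assms in \<open>auto simp: transvection_def\<close>)
  also have "\<dots> = (\<Sum>l<n. (if l = i then A $$ (l, j) else 0) + (if l = k then v i * A $$ (l, j) else 0))"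
    by (rule sum.cong) (use assms in \<open>auto simp: transvection_def distrib_right\<close>)
  also have "\<dots> = A $$ (i, j) + v i * A $$ (k, j)" using assms by (simp add: sum.distrib)
  finally show ?thesis .
qed

lemma unimodular_transvection:
  fixes v :: "nat \<Rightarrow> 'a::comm_ring_1 fls"
  assumes k: "k < n" "v k = 0" and 0: "\<And>i. i < n \<Longrightarrow> ord_ge 0 (v i)"
  shows "unimodular n (transvection n k v) (transvection n k (\<lambda>i. - v i))"
proof -
  have c: "(transvection n k v) \<in> carrier_mat n n" for v :: "nat \<Rightarrow> 'a fls" by (simp add: transvection_def)
  have inv: "transvection n k v * transvection n k (\<lambda>i. - v i) = 1\<^sub>m n" if v: "v k = 0"
      for v :: "nat \<Rightarrow> 'a fls"
  proof (rule eq_matI)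
    fix i j assume "i < dim_row (1\<^sub>m n :: 'a fls mat)" "j < dim_col (1\<^sub>m n :: 'a fls mat)"
    then have ij: "i < n" "j < n" by auto
    show "(transvection n k v * transvection n k (\<lambda>i. - v i)) $$ (i, j) = 1\<^sub>m n $$ (i, j)"
      unfolding transvection_mult[OF c k(1) ij] using ij k v by (auto simp: transvection_def)
  qed (auto simp: transvection_def)
  have "mat_ord_ge 0 (transvection n k v)" "mat_ord_ge 0 (transvection n k (\<lambda>i. - v i))"
    by (rule mat_ord_geI[OF c]; use 0 in \<open>auto simp: transvection_def intro: ord_ge_add ord_ge_uminus ord_ge_diff\<close>)+
  then show ?thesis using inv[of v] inv[of "\<lambda>i. - v i"] k c by (auto simp: unimodular_def inverse_mats_def)
qed

lemma unimodular_transpose: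
  assumes "unimodular n P Q" shows "unimodular n (transpose_mat P) (transpose_mat Q)"
proof -
  have c: "P \<in> carrier_mat n n" "Q \<in> carrier_mat n n" "P * Q = 1\<^sub>m n" "Q * P = 1\<^sub>m n"
    using assms by (auto simp: unimodular_def inverse_mats_def)
  then have "transpose_mat P * transpose_mat Q = 1\<^sub>m n" "transpose_mat Q * transpose_mat P = 1\<^sub>m n"
    by (subst transpose_mult[OF c(2,1), symmetric], simp add: c(4), subst transpose_mult[OF c(1,2), symmetric], simp add: c(3))
  then show ?thesis using assms unfolding unimodular_def inverse_mats_def by (simp add: mat_ord_ge_def)
qed

lemma ord_ge_divide:
  fixes f g :: "'a::field fls"
  assumes "g \<noteq> 0" "f = 0 \<or> fls_subdegree g \<le> fls_subdegree f"
  shows "ord_ge 0 (f / g)"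
  using assms by (cases "f = 0") (auto simp: ord_ge_iff fls_divide_subdegree)

text \<open>Over a discrete valuation ring an entry of least order divides all others. Moved to
  position \<open>(k, k)\<close> by transpositions, it clears its row and column with integral
  multipliers.\<close>

lemma smith_step:
  fixes D :: "'a::field fls mat"
  assumes D: "D \<in> carrier_mat n n" and d: "det D \<noteq> 0" and k: "k < n"
    and z: "\<And>i j. i < n \<Longrightarrow> j < n \<Longrightarrow> i < k \<or> j < k \<Longrightarrow> i \<noteq> j \<Longrightarrow> D $$ (i, j) = 0"
  obtains P P' Q Q' where "unimodular n P P'" "unimodular n Q Q'"
    "\<And>i j. i < n \<Longrightarrow> j < n \<Longrightarrow> i < Suc k \<or> j < Suc k \<Longrightarrow> i \<noteq> j \<Longrightarrow> (P * D * Q) $$ (i, j) = 0"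
proof -
  define S where "S = {(i, j). k \<le> i \<and> i < n \<and> k \<le> j \<and> j < n \<and> D $$ (i, j) \<noteq> 0}"
  have fin: "finite S" by (rule finite_subset[of _ "{..<n} \<times> {..<n}"]) (auto simp: S_def)
  \<comment> \<open>Otherwise row \<open>k\<close> would be zero: left of column \<open>k\<close> by
    the block form, from there on because \<open>S\<close> is empty.\<close>
  have "S \<noteq> {}"
  proof
    assume "S = {}"
    then have "D $$ (k, j) = 0" if "j < n" for j
      using z[OF k that] that k by (cases "j < k") (auto simp: S_def)
    then have "det D = 0" unfolding laplace_expansion_row[OF D k] by (intro sum.neutral) auto
    then show False using d by simp
  qed
  define q where "q = arg_min_on (\<lambda>(i, j). fls_subdegree (D $$ (i, j))) S"
  obtain i0 j0 where q: "q = (i0, j0)" by (cases q)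
  have ij0: "(i0, j0) \<in> S"
    using arg_min_if_finite(1)[OF fin \<open>S \<noteq> {}\<close>, of "\<lambda>(i, j). fls_subdegree (D $$ (i, j))"]
        unfolding q_def[symmetric] q .
  have min: "fls_subdegree (D $$ (i0, j0)) \<le> fls_subdegree (D $$ (i, j))" if "(i, j) \<in> S" for i j
    using arg_min_least[OF fin \<open>S \<noteq> {}\<close> that, of "\<lambda>(i, j). fls_subdegree (D $$ (i, j))"]
    unfolding q_def[symmetric] q by simp
  define \<pi> where "\<pi> i = (if i = k then i0 else if i = i0 then k else i)" for i
  define \<rho> where "\<rho> j = (if j = k then j0 else if j = j0 then k else j)" for j
  have b: "k \<le> i0" "i0 < n" "k \<le> j0" "j0 < n" "D $$ (i0, j0) \<noteq> 0" using ij0 by (auto simp: S_def)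
  have \<pi>: "\<pi> i < n" "\<pi> (\<pi> i) = i" if "i < n" for i using that b k by (auto simp: \<pi>_def)
  have \<rho>: "\<rho> i < n" "\<rho> (\<rho> i) = i" if "i < n" for i using that b k by (auto simp: \<rho>_def)
  have \<pi>k: "\<pi> i = i" if "i < k" for i using that b by (auto simp: \<pi>_def)
  have \<rho>k: "\<rho> i = i" if "i < k" for i using that b by (auto simp: \<rho>_def)
  have \<pi>k': "k \<le> \<pi> i" if "k \<le> i" for i using that b by (auto simp: \<pi>_def)
  have \<rho>k': "k \<le> \<rho> i" if "k \<le> i" for i using that b by (auto simp: \<rho>_def)
  define D1 where "D1 = perm_mat n \<pi> * D * perm_mat n \<rho>"
  have pc: "perm_mat n \<pi> \<in> carrier_mat n n" for \<pi> by (simp add: perm_mat_def)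
  have D1c: "D1 \<in> carrier_mat n n" unfolding D1_def using pc D by (meson mult_carrier_mat)
  have D1: "D1 $$ (i, j) = D $$ (\<pi> i, \<rho> j)" if "i < n" "j < n" for i j
  proof -
    have "D1 $$ (i, j) = (perm_mat n \<pi> * D) $$ (i, \<rho> j)"
      unfolding D1_def by (rule mult_perm_mat[of _ n]) (use mult_carrier_mat[OF pc[of \<pi>] D] \<rho> that in auto)
    also have "\<dots> = D $$ (\<pi> i, \<rho> j)"
      by (rule perm_mat_mult[of _ _ n]) (use D \<pi> \<rho> that in auto)
    finally show ?thesis .
  qed
  have D1z: "D1 $$ (i, j) = 0" if "i < n" "j < n" "i < k \<or> j < k" "i \<noteq> j" for i j
    unfolding D1[OF that(1,2)]
    by (rule z) (use that \<pi> \<rho> \<pi>k \<rho>k \<pi>k'[of i] \<rho>k'[of j] in \<open>force simp: not_less\<close>)+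
  define pv where "pv = D1 $$ (k, k)"
  have pv: "pv = D $$ (i0, j0)" unfolding pv_def D1[OF k k] by (simp add: \<pi>_def \<rho>_def)
  have pv0: "pv \<noteq> 0" using b pv by simp
  \<comment> \<open>Minimality of the pivot makes the multipliers integral, so that the two
    transvections are unimodular.\<close>
  have D1min: "ord_ge 0 (D1 $$ (i, j) / pv)" if "i < n" "j < n" "k \<le> i" "k \<le> j" for i j
    unfolding D1[OF that(1,2)] using min[of "\<pi> i" "\<rho> j"] \<pi>k'[of i] \<rho>k'[of j] that \<pi>(1)[of i] \<rho>(1)[of j]
    by (intro ord_ge_divide pv0) (auto simp: pv S_def)
  define v where "v i = (if k < i then - (D1 $$ (i, k) / pv) else 0)" for i
  define u where "u j = (if k < j then - (D1 $$ (k, j) / pv) else 0)" for j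
  define E where "E = transvection n k v"
  define F where "F = transpose_mat (transvection n k u)"
  have Ec: "E \<in> carrier_mat n n" "F \<in> carrier_mat n n" by (auto simp: E_def F_def transvection_def)
  have uE: "unimodular n E (transvection n k (\<lambda>i. - v i))"
    unfolding E_def by (rule unimodular_transvection[OF k]) (auto simp: v_def k intro!: ord_ge_uminus D1min)
  have uF: "unimodular n F (transpose_mat (transvection n k (\<lambda>i. - u i)))"
    unfolding F_def by (intro unimodular_transpose unimodular_transvection[OF k])
      (auto simp: u_def k intro!: ord_ge_uminus D1min)
  define D2 where "D2 = E * D1"
  have D2c: "D2 \<in> carrier_mat n n" unfolding D2_def using Ec D1c by simp
  have D2: "D2 $$ (i, j) = D1 $$ (i, j) + v i * D1 $$ (k, j)" if "i < n" "j < n" for i j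
    unfolding D2_def E_def by (rule transvection_mult[OF D1c k that])
  have D3: "(D2 * F) $$ (i, j) = D2 $$ (i, j) + u j * D2 $$ (i, k)" if "i < n" "j < n" for i j
  proof -
    have "D2 * F = transpose_mat (transvection n k u * transpose_mat D2)"
      unfolding F_def using D2c by (subst transpose_mult[of _ n n _ n]) (auto simp: transvection_def)
    then have "(D2 * F) $$ (i, j) = (transvection n k u * transpose_mat D2) $$ (j, i)"
      using that D2c by (simp add: transvection_def del: index_mult_mat(1))
    also have "\<dots> = transpose_mat D2 $$ (j, i) + u j * transpose_mat D2 $$ (k, i)"
      by (rule transvection_mult[OF _ k that(2,1)]) (use D2c in auto)
    finally show ?thesis using that k D2c by simp
  qed
  have fin0: "(D2 * F) $$ (i, j) = 0" if ij: "i < n" "j < n" "i < Suc k \<or> j < Suc k" "i \<noteq> j" for i j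
  proof -
    consider "i < k" | "i = k" "j < k" | "i = k" "k < j" | "k < i" "j < k" | "k < i" "j = k"
      using ij by linarith
    then show ?thesis
    proof cases
      case 1 then show ?thesis using ij k by (simp add: D3 D2 D1z v_def)
    next
      case 2 then show ?thesis using ij k by (simp add: D3 D2 D1z v_def u_def)
    next
      case 3 then show ?thesis using ij k pv0 by (simp add: D3 D2 v_def u_def pv_def[symmetric])
    next
      case 4 then show ?thesis using ij k by (simp add: D3 D2 D1z u_def)
    next
      case 5 then show ?thesis using ij k pv0 by (simp add: D3 D2 v_def u_def pv_def[symmetric])
    qed
  qed
  have eq: "(E * perm_mat n \<pi>) * D * (perm_mat n \<rho> * F) = D2 * F"
  proof -
    have "(E * perm_mat n \<pi>) * D * (perm_mat n \<rho> * F) = E * perm_mat n \<pi> * D * perm_mat n \<rho> * F"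
      by (rule assoc_mult_mat[symmetric, of _ n n _ n _ n])
        (use Ec pc[of \<pi>] pc[of \<rho>] D in \<open>auto intro: mult_carrier_mat\<close>)
    also have "E * perm_mat n \<pi> * D * perm_mat n \<rho> = E * (perm_mat n \<pi> * D) * perm_mat n \<rho>"
      by (subst assoc_mult_mat[of _ n n _ n _ n]) (use Ec pc[of \<pi>] D in auto)
    also have "\<dots> = D2" unfolding D2_def D1_def
      by (rule assoc_mult_mat[of _ n n _ n _ n])
          (use Ec pc[of \<pi>] pc[of \<rho>] D in \<open>auto intro: mult_carrier_mat\<close>)
    finally show ?thesis .
  qed
  show ?thesis
  proof (rule that)
    show "unimodular n (E * perm_mat n \<pi>) (perm_mat n \<pi> * transvection n k (\<lambda>i. - v i))"
      by (rule unimodular_mult[OF uE unimodular_perm_mat]) (use \<pi> in auto)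
    show "unimodular n (perm_mat n \<rho> * F) (transpose_mat (transvection n k (\<lambda>i. - u i)) * perm_mat n \<rho>)"
      by (rule unimodular_mult[OF unimodular_perm_mat uF]) (use \<rho> in auto)
  qed (use fin0 in \<open>simp add: eq del: index_mult_mat(1)\<close>)
qed

lemma unimodular_det_nonzero: "unimodular n P Q \<Longrightarrow> det P \<noteq> 0"
  for P :: "'a::field fls mat"
  using inverse_mats_det by (fastforce simp: unimodular_def)

lemma smith_form:
  fixes T :: "'a::field fls mat"
  assumes T: "T \<in> carrier_mat n n" and d: "det T \<noteq> 0"
  obtains P P' Q Q' where "unimodular n P P'" "unimodular n Q Q'"
    "\<And>i j. i < n \<Longrightarrow> j < n \<Longrightarrow> i \<noteq> j \<Longrightarrow> (P * T * Q) $$ (i, j) = 0"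
proof -
  have "\<exists>P P' Q Q'. unimodular n P P' \<and> unimodular n Q Q' \<and>
    (\<forall>i<n. \<forall>j<n. (i < k \<or> j < k) \<and> i \<noteq> j \<longrightarrow> (P * T * Q) $$ (i, j) = 0)" if "k \<le> n" for k
    using that
  proof (induction k)
    case 0
    show ?case using unimodular_one by auto
  next
    case (Suc k)
    then obtain P P' Q Q' where u: "unimodular n P P'" "unimodular n Q Q'"
      and z: "\<forall>i<n. \<forall>j<n. (i < k \<or> j < k) \<and> i \<noteq> j \<longrightarrow> (P * T * Q) $$ (i, j) = 0" by auto
    have c: "P \<in> carrier_mat n n" "Q \<in> carrier_mat n n"
      using u by (auto simp: unimodular_def inverse_mats_def)
    have D: "P * T * Q \<in> carrier_mat n n" using c T by simp
    have dD: "det (P * T * Q) \<noteq> 0"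
      using c T d unimodular_det_nonzero[OF u(1)] unimodular_det_nonzero[OF u(2)]
      by (simp add: det_mult[of _ n])
    obtain R R' S S' where v: "unimodular n R R'" "unimodular n S S'"
      and z': "\<And>i j. i < n \<Longrightarrow> j < n \<Longrightarrow> i < Suc k \<or> j < Suc k \<Longrightarrow> i \<noteq> j \<Longrightarrow> (R * (P * T * Q) * S) $$ (i, j) = 0"
      using smith_step[OF D dD, of k] z Suc.prems by (metis Suc_le_eq)
    have c': "R \<in> carrier_mat n n" "S \<in> carrier_mat n n"
      using v by (auto simp: unimodular_def inverse_mats_def)
    have "R * (P * T * Q) * S = (R * P) * T * (Q * S)"
      using c c' T by (simp add: assoc_mult_mat[of _ n n _ n _ n])
    then show ?case using z' unimodular_mult[OF v(1) u(1)] unimodular_mult[OF u(2) v(2)]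
      by (metis (no_types, lifting))
  qed
  from this[of n] show ?thesis using that by auto
qed

lemma diagonal_mult_mat:
  fixes D :: "'a::semiring_0 mat"
  assumes D: "D \<in> carrier_mat n n" and d: "\<And>i j. i < n \<Longrightarrow> j < n \<Longrightarrow> i \<noteq> j \<Longrightarrow> D $$ (i, j) = 0"
    and A: "A \<in> carrier_mat n m" and ij: "i < n" "j < m"
  shows "(D * A) $$ (i, j) = D $$ (i, i) * A $$ (i, j)"
proof -
  have "(D * A) $$ (i, j) = (\<Sum>k<n. D $$ (i, k) * A $$ (k, j))"
    by (rule index_mult_mat_sum[OF D A ij])
  also have "\<dots> = (\<Sum>k\<in>{i}. D $$ (i, k) * A $$ (k, j))"
    by (rule sum.mono_neutral_right) (use d ij in auto)
  finally show ?thesis by simp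
qed

lemma mult_diagonal_mat:
  fixes D :: "'a::semiring_0 mat"
  assumes D: "D \<in> carrier_mat n n" and d: "\<And>i j. i < n \<Longrightarrow> j < n \<Longrightarrow> i \<noteq> j \<Longrightarrow> D $$ (i, j) = 0"
    and A: "A \<in> carrier_mat m n" and ij: "i < m" "j < n"
  shows "(A * D) $$ (i, j) = A $$ (i, j) * D $$ (j, j)"
proof -
  have "(A * D) $$ (i, j) = (\<Sum>k<n. A $$ (i, k) * D $$ (k, j))"
    by (rule index_mult_mat_sum[OF A D ij])
  also have "\<dots> = (\<Sum>k\<in>{j}. A $$ (i, k) * D $$ (k, j))"
    by (rule sum.mono_neutral_right) (use d ij in auto)
  finally show ?thesis by simp
qed

lemma inverse_diagonal:
  fixes D :: "'a::field mat"
  assumes D: "D \<in> carrier_mat n n" and d: "\<And>i j. i < n \<Longrightarrow> j < n \<Longrightarrow> i \<noteq> j \<Longrightarrow> D $$ (i, j) = 0"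
    and nz: "\<And>i. i < n \<Longrightarrow> D $$ (i, i) \<noteq> 0"
  defines "E \<equiv> mat n n (\<lambda>(i, j). if i = j then inverse (D $$ (i, i)) else 0)"
  shows "inverse_mats n D E"
proof -
  have E: "E \<in> carrier_mat n n" by (simp add: E_def)
  have e: "E $$ (i, j) = 0" if "i < n" "j < n" "i \<noteq> j" for i j using that by (simp add: E_def)
  have "D * E = 1\<^sub>m n"
  proof (rule eq_matI)
    fix i j assume "i < dim_row (1\<^sub>m n :: 'a mat)" "j < dim_col (1\<^sub>m n :: 'a mat)"
    then have ij: "i < n" "j < n" by auto
    have "(D * E) $$ (i, j) = D $$ (i, i) * E $$ (i, j)"
      by (rule diagonal_mult_mat[OF D _ E ij]) (rule d)
    also have "\<dots> = 1\<^sub>m n $$ (i, j)" using ij nz by (simp add: E_def)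
    finally show "(D * E) $$ (i, j) = 1\<^sub>m n $$ (i, j)" .
  qed (use D E in auto)
  moreover have "E * D = 1\<^sub>m n"
  proof (rule eq_matI)
    fix i j assume "i < dim_row (1\<^sub>m n :: 'a mat)" "j < dim_col (1\<^sub>m n :: 'a mat)"
    then have ij: "i < n" "j < n" by auto
    have "(E * D) $$ (i, j) = E $$ (i, i) * D $$ (i, j)"
      by (rule diagonal_mult_mat[OF E _ D ij]) (rule e)
    also have "\<dots> = 1\<^sub>m n $$ (i, j)" using ij nz d[of i j] by (simp add: E_def)
    finally show "(E * D) $$ (i, j) = 1\<^sub>m n $$ (i, j)" .
  qed (use D E in auto)
  ultimately show ?thesis using D E by (simp add: inverse_mats_def)
qed

lemma ddx_divide_ord_ge: "ord_ge 0 (inverse f * ddx f)"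
proof (cases "f = 0")
  case False
  have "ord_ge (- fls_subdegree f) (inverse f)" using False by (simp add: ord_ge_iff fls_inverse_subdegree)
  moreover have "ord_ge (fls_subdegree f) (ddx f)" by (rule ord_ge_ddx) simp
  ultimately show ?thesis by (rule ord_ge_mult) simp
qed simp

lemma diagonal_log_derivative:
  assumes D: "D \<in> carrier_mat n n" and d: "\<And>i j. i < n \<Longrightarrow> j < n \<Longrightarrow> i \<noteq> j \<Longrightarrow> D $$ (i, j) = 0"
    and nz: "\<And>i. i < n \<Longrightarrow> D $$ (i, i) \<noteq> 0" and I: "inverse_mats n D E"
  shows "mat_ord_ge 0 (E * map_mat ddx D)"
proof -
  have E: "E = mat n n (\<lambda>(i, j). if i = j then inverse (D $$ (i, i)) else 0)"
    by (rule inverse_mats_unique[OF I inverse_diagonal[OF D d nz]])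
  have Ec: "E \<in> carrier_mat n n" and e: "\<And>i j. i < n \<Longrightarrow> j < n \<Longrightarrow> i \<noteq> j \<Longrightarrow> E $$ (i, j) = 0"
    by (simp_all add: E)
  show ?thesis
  proof (rule mat_ord_geI[of _ n n])
    show "E * map_mat ddx D \<in> carrier_mat n n" using Ec D by simp
    fix i j assume ij: "i < n" "j < n"
    have "(E * map_mat ddx D) $$ (i, j) = E $$ (i, i) * map_mat ddx D $$ (i, j)"
      by (rule diagonal_mult_mat[OF Ec e _ ij]) (use D in auto)
    then show "ord_ge 0 ((E * map_mat ddx D) $$ (i, j))"
      using ij D d[of i j] ddx_divide_ord_ge[of "D $$ (i, i)"] by (cases "i = j") (auto simp: E)
  qed
qed

text \<open>The unimodular factors of the Smith form are shifted onto \<open>X\<close> and onto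
  \<open>gauge T X\<close>, where they are harmless for \<open>w >= 1\<close>; what is left is a
  diagonal transformation \<open>D\<close> from \<open>X1\<close> to \<open>Y1\<close>.\<close>

lemma gauge_invariant_lead:
  assumes X: "X \<in> carrier_mat n n" "mat_ord_ge (- w) X" and T: "inverse_mats n T S"
    and Y: "mat_ord_ge (- w) (gauge T X)" and w: "w \<ge> 1" and i: "i \<le> n"
  shows "fls_nth (coeff (char_poly (gauge T X)) i) (- w * int (n - i)) =
    fls_nth (coeff (char_poly X) i) (- w * int (n - i))"
proof -
  note t = inverse_mats_carrier[OF T]
  have dT: "det T \<noteq> 0" using inverse_mats_det[OF T] by auto
  obtain P P' Q Q' where u: "unimodular n P P'" "unimodular n Q Q'"
    and dg: "\<And>i j. i < n \<Longrightarrow> j < n \<Longrightarrow> i \<noteq> j \<Longrightarrow> (P * T * Q) $$ (i, j) = 0"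
    using smith_form[OF t(1) dT] by metis
  define D where "D = P * T * Q"
  have iP: "inverse_mats n P P'" and iQ: "inverse_mats n Q Q'" using u by (auto simp: unimodular_def)
  note p = inverse_mats_carrier[OF iP] note q = inverse_mats_carrier[OF iQ]
  define E where "E = Q' * (S * P')"
  have DE: "inverse_mats n D E" unfolding D_def E_def
    by (intro inverse_mats_mult iP iQ T)
  note de = inverse_mats_carrier[OF DE]
  have dD: "D $$ (i, j) = 0" if "i < n" "j < n" "i \<noteq> j" for i j using dg that by (simp add: D_def)
  have nz: "D $$ (i, i) \<noteq> 0" if "i < n" for i
  proof
    assume 0: "D $$ (i, i) = 0"
    have "(D * E) $$ (i, i) = D $$ (i, i) * E $$ (i, i)"
      by (rule diagonal_mult_mat[OF de(1) dD de(2) that that])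
    then show False using de(3) that 0 by simp
  qed
  define X1 where "X1 = gauge P' X"
  define Y1 where "Y1 = gauge Q (gauge T X)"
  have X1: "X1 \<in> carrier_mat n n" unfolding X1_def by (rule gauge_carrier[OF inverse_mats_sym[OF iP] X(1)])
  have gT: "gauge T X \<in> carrier_mat n n" by (rule gauge_carrier[OF T X(1)])
  have X1o: "mat_ord_ge (- w) X1"
    and X1c: "fls_nth (coeff (char_poly X1) i) (- w * int (n - i))
        = fls_nth (coeff (char_poly X) i) (- w * int (n - i))"
    unfolding X1_def using gauge_unimodular[OF unimodular_sym[OF u(1)] X w i] .
  have Y1o: "mat_ord_ge (- w) Y1"
    and Y1c: "fls_nth (coeff (char_poly Y1) i) (- w * int (n - i))
        = fls_nth (coeff (char_poly (gauge T X)) i) (- w * int (n - i))"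
    unfolding Y1_def using gauge_unimodular[OF u(2) gT Y w i] .
  have "P' * D = T * Q" unfolding D_def
    using inverse_mats_cancel(2)[OF iP, of "T * Q" n] p q t by (simp add: assoc_mult_mat[of _ n n _ n _ n])
  then have "gauge D X1 = Y1"
    unfolding X1_def Y1_def
    using gauge_mult[OF inverse_mats_sym[OF iP] DE X(1)] gauge_mult[OF T iQ X(1)] by simp
  then have Y1: "Y1 = E * X1 * D - E * map_mat ddx D" using gauge_eq[OF DE] by simp
  have c: "E * X1 * D \<in> carrier_mat n n" "E * map_mat ddx D \<in> carrier_mat n n" using de X1 by auto
  have 0: "mat_ord_ge 0 (E * map_mat ddx D)"
    by (rule diagonal_log_derivative[OF de(1) dD nz DE])
  have 1: "mat_ord_ge (1 - w) (E * map_mat ddx D)" by (rule mat_ord_ge_mono[OF 0]) (use w in simp)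
  \<comment> \<open>The pole bound of the conjugate does not follow from that of \<open>X1\<close>,
    since \<open>D\<close> need not be unimodular; it is recovered from the bound on
    \<open>Y1\<close>.\<close>
  have "E * X1 * D = Y1 + E * map_mat ddx D"
    unfolding Y1 by (rule eq_matI) (use c in auto)
  moreover have "mat_ord_ge (- w) (Y1 + E * map_mat ddx D)"
    by (rule mat_ord_ge_add[OF _ c(2) Y1o mat_ord_ge_mono[OF 0]])
      (use c w Y1 in \<open>auto intro: minus_carrier_mat\<close>)
  ultimately have 2: "mat_ord_ge (- w) (E * X1 * D)" by simp
  from gauge_char_poly_lead(2)[OF DE X1 1 2 i] \<open>gauge D X1 = Y1\<close> X1c Y1c show ?thesis by simp
qed

subsection \<open>Lattices adapted to the characteristic polynomial\<close>

lemma pow_mat_commute: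
  fixes A :: "'a::semiring_1 mat"
  assumes A: "A \<in> carrier_mat n n"
  shows "A * A ^\<^sub>m k = A ^\<^sub>m Suc k"
proof (induction k)
  case (Suc k)
  have "A * A ^\<^sub>m Suc k = A * A ^\<^sub>m k * A"
    using A by (simp add: assoc_mult_mat[of _ n n _ n _ n])
  then show ?case using Suc by simp
qed (use A in simp)

text \<open>The columns of \<open>U\<close> are \<open>n\<close> of the vectors \<open>eps^(jw) X^j e_i\<close>, chosen so that the determinant has
  minimal order; by Cramer's rule they generate all the others over the power series.\<close>

lemma spectral_lattice:
  fixes X :: "'a::field fls mat"
  assumes X: "X \<in> carrier_mat n n" "mat_ord_ge (- H) X" and w: "w \<le> H"
    and chi: "\<And>i. i < n \<Longrightarrow> ord_ge (- w * int (n - i)) (coeff (char_poly X) i)"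
  obtains U V where "inverse_mats n U V" "mat_ord_ge 0 V"
    "mat_ord_ge (- (int n - 1) * (H - w)) U" "mat_ord_ge (- w) (V * X * U)"
proof (cases "n = 0")
  case True
  then show ?thesis using X by (intro that[of "1\<^sub>m 0" "1\<^sub>m 0"]) (auto simp: inverse_mats_def mat_ord_ge_def)
next
  case n: False
  have Xp: "X ^\<^sub>m j \<in> carrier_mat n n" for j using X by simp
  have Xpo: "mat_ord_ge (- H * int j) (X ^\<^sub>m j)" for j
  proof (induction j)
    case (Suc j)
    show ?case using mat_ord_ge_mult[OF Xp X(1) Suc X(2)] by (simp add: algebra_simps)
  qed (use X in simp)
  define G where "G = (\<lambda>(j, i) a. X_pow (w * int j) * (X ^\<^sub>m j) $$ (a, i))"
  define idx where "idx = {..<n} \<times> {..<n}"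
  \<comment> \<open>The pole order of \<open>eps^(jw) X^j\<close> is at most
    \<open>j (H - w)\<close>, and \<open>j < n\<close>.\<close>
  have Go: "ord_ge (- (int n - 1) * (H - w)) (G q a)" if q: "q \<in> idx" and a: "a < n" for q a
  proof -
    obtain j i where ji: "q = (j, i)" "j < n" "i < n" using q by (auto simp: idx_def)
    have "int j * (H - w) \<le> (int n - 1) * (H - w)" using ji w by (intro mult_right_mono) auto
    then have "- (int n - 1) * (H - w) - w * int j \<le> - H * int j" by (simp add: algebra_simps)
    then have "ord_ge (- (int n - 1) * (H - w) - w * int j) ((X ^\<^sub>m j) $$ (a, i))"
      by (rule ord_ge_mono[OF mat_ord_geD[OF Xpo Xp a ji(3)]])
    then show ?thesis unfolding G_def ji by (simp add: ord_ge_X_pow_mult)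
  qed
  define U where "U c = mat n n (\<lambda>(a, b). G (c b) a)" for c
  have Uc: "U c \<in> carrier_mat n n" for c by (simp add: U_def)
  define C where "C = {c \<in> {..<n} \<rightarrow>\<^sub>E idx. det (U c) \<noteq> 0}"
  have fin: "finite C" unfolding C_def by (intro finite_subset[OF _ finite_PiE[of "{..<n}" "\<lambda>_. idx"]])
      (auto simp: idx_def)
  \<comment> \<open>The standard basis, \<open>j = 0\<close>, shows that an admissible choice
    exists. That the unit vectors are among the generators also makes \<open>V\<close> integral
    later.\<close>
  define c0 where "c0 = (\<lambda>b\<in>{..<n}. (0::nat, b))"
  have "U c0 = 1\<^sub>m n" using X by (intro eq_matI) (auto simp: U_def c0_def G_def)
  then have "c0 \<in> C" using n by (auto simp: C_def c0_def idx_def)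
  then have ne: "C \<noteq> {}" by auto
  define c where "c = arg_min_on (\<lambda>c. fls_subdegree (det (U c))) C"
  have cC: "c \<in> C" unfolding c_def by (rule arg_min_if_finite(1)[OF fin ne])
  have min: "fls_subdegree (det (U c)) \<le> fls_subdegree (det (U c'))" if "c' \<in> C" for c'
    unfolding c_def by (rule arg_min_least[OF fin ne that])
  have cidx: "c b \<in> idx" if "b < n" for b using cC that by (auto simp: C_def)
  have dU: "det (U c) \<noteq> 0" using cC by (simp add: C_def)
  obtain V where UV: "inverse_mats n (U c) V" using inverse_mats_exists[OF Uc dU] .
  note v = inverse_mats_carrier[OF UV]
  \<comment> \<open>Coordinate \<open>k\<close> of generator \<open>q\<close> in the chosen basis is
    the quotient of two determinants, with column \<open>k\<close> replaced by \<open>q\<close> and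
    without; minimality makes it integral.\<close>
  have key: "ord_ge 0 (\<Sum>l<n. V $$ (k, l) * G q l)" if q: "q \<in> idx" and k: "k < n" for q k
  proof -
    define g where "g = vec n (G q)"
    define x where "x = V *\<^sub>v g"
    have g: "g \<in> carrier_vec n" and x: "x \<in> carrier_vec n" using v by (auto simp: g_def x_def)
    have "U c *\<^sub>v x = (U c * V) *\<^sub>v g" unfolding x_def by (rule assoc_mult_mat_vec[symmetric, OF Uc v(2) g])
    then have Ux: "U c *\<^sub>v x = g" using v(3) g by simp
    have "replace_col (U c) g k = U (c(k := q))"
      using k by (intro eq_matI) (auto simp: replace_col_def U_def g_def)
    then have eq: "vec_index x k * det (U c) = det (U (c(k := q)))"
      using cramer_lemma_mat[OF Uc[of c] x k] unfolding Ux by simp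
    have "ord_ge 0 (det (U (c(k := q))) / det (U c))"
    proof (rule ord_ge_divide[OF dU])
      have "c(k := q) \<in> {..<n} \<rightarrow>\<^sub>E idx" using cC k q by (auto simp: C_def PiE_iff extensional_def)
      then show "det (U (c(k := q))) = 0 \<or> fls_subdegree (det (U c)) \<le> fls_subdegree (det (U (c(k := q))))"
        using min[of "c(k := q)"] by (auto simp: C_def)
    qed
    then have "ord_ge 0 (vec_index x k)" using dU unfolding eq[symmetric] by simp
    then show ?thesis using v k unfolding x_def g_def by (simp add: scalar_prod_def lessThan_atLeast0)
  qed
  have V0: "mat_ord_ge 0 V"
  proof (rule mat_ord_geI[OF v(2)])
    fix k i assume ki: "k < n" "i < n"
    have "(\<Sum>l<n. V $$ (k, l) * G (0, i) l) = (\<Sum>l<n. if l = i then V $$ (k, l) else 0)"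
      using ki X by (intro sum.cong) (auto simp: G_def)
    then show "ord_ge 0 (V $$ (k, i))" using key[of "(0, i)" k] ki n by (simp add: idx_def)
  qed
  have Uo: "mat_ord_ge (- (int n - 1) * (H - w)) (U c)"
    by (rule mat_ord_geI[OF Uc]) (use Go cidx in \<open>simp add: U_def\<close>)
  \<comment> \<open>The exponent \<open>j = n\<close> lies outside \<open>idx\<close>;
    Cayley-Hamilton reduces it to smaller exponents with factors \<open>eps^(w(n-e))\<close> times
    coefficient \<open>e\<close>, integral by \<open>chi\<close>.\<close>
  have keyn: "ord_ge 0 (\<Sum>l<n. V $$ (k, l) * G (n, i) l)" if "i < n" "k < n" for i k
  proof -
    have Gn: "G (n, i) l = (\<Sum>e<n. - (X_pow (w * int (n - e)) * coeff (char_poly X) e) * G (e, i) l)"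
        if l: "l < n" for l
    proof -
      have "coeff (char_poly X) n = 1" using degree_monic_char_poly[OF X(1)] by simp
      then have "(X ^\<^sub>m n) $$ (l, i) = - (\<Sum>e<n. coeff (char_poly X) e * (X ^\<^sub>m e) $$ (l, i))"
        using cayley_hamilton[OF X(1) l \<open>i < n\<close>]
        by (simp add: lessThan_Suc_atMost[symmetric] add_eq_0_iff)
      then have "G (n, i) l = (\<Sum>e<n. - (X_pow (w * int n) * coeff (char_poly X) e * (X ^\<^sub>m e) $$ (l, i)))"
        by (simp add: G_def sum_distrib_left sum_negf mult.assoc)
      also have "\<dots> = (\<Sum>e<n. - (X_pow (w * int (n - e)) * coeff (char_poly X) e) * G (e, i) l)"
      proof (rule sum.cong[OF refl])
        fix e assume "e \<in> {..<n}"
        then have "w * int n = w * int (n - e) + w * int e" by (simp add: of_nat_diff algebra_simps)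
        then show "- (X_pow (w * int n) * coeff (char_poly X) e * (X ^\<^sub>m e) $$ (l, i)) =
          - (X_pow (w * int (n - e)) * coeff (char_poly X) e) * G (e, i) l"
          by (simp add: G_def X_pow_add ac_simps)
      qed
      finally show ?thesis .
    qed
    have "(\<Sum>l<n. V $$ (k, l) * G (n, i) l) =
      (\<Sum>l<n. \<Sum>e<n. - (X_pow (w * int (n - e)) * coeff (char_poly X) e) * (V $$ (k, l) * G (e, i) l))"
      by (simp add: Gn sum_distrib_left ac_simps)
    also have "\<dots>
        = (\<Sum>e<n. - (X_pow (w * int (n - e)) * coeff (char_poly X) e) * (\<Sum>l<n. V $$ (k, l) * G (e, i) l))"
      by (subst sum.swap) (simp add: sum_distrib_left)
    also have "ord_ge 0 \<dots>"
    proof (rule ord_ge_sum)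
      fix e assume e: "e \<in> {..<n}"
      then have "ord_ge 0 (- (X_pow (w * int (n - e)) * coeff (char_poly X) e))"
        using chi[of e] by (intro ord_ge_uminus) (simp add: ord_ge_X_pow_mult)
      moreover have "ord_ge 0 (\<Sum>l<n. V $$ (k, l) * G (e, i) l)"
        using key[of "(e, i)" k] e that by (simp add: idx_def)
      ultimately show
          "ord_ge 0 (- (X_pow (w * int (n - e)) * coeff (char_poly X) e) * (\<Sum>l<n. V $$ (k, l) * G (e, i) l))"
        by (rule ord_ge_mult) simp
    qed
    finally show ?thesis .
  qed
  have "mat_ord_ge (- w) (V * X * U c)"
  proof (rule mat_ord_geI[of _ n n])
    show "V * X * U c \<in> carrier_mat n n" using v X Uc by (meson mult_carrier_mat)
    fix k b assume kb: "k < n" "b < n"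
    obtain j i where ji: "c b = (j, i)" "j < n" "i < n" using cidx[OF kb(2)] by (auto simp: idx_def)
    \<comment> \<open>Multiplying by \<open>X\<close> raises \<open>j\<close> by one and costs a
      factor \<open>eps^(-w)\<close>.\<close>
    have XU: "(X * U c) $$ (l, b) = X_pow (- w) * G (Suc j, i) l" if l: "l < n" for l
    proof -
      have "(X * U c) $$ (l, b) = (\<Sum>m<n. X $$ (l, m) * (X_pow (w * int j) * (X ^\<^sub>m j) $$ (m, i)))"
        unfolding index_mult_mat_sum[OF X(1) Uc l kb(2)]
        by (rule sum.cong) (use kb ji in \<open>auto simp: U_def G_def\<close>)
      also have "\<dots> = X_pow (w * int j) * (X * X ^\<^sub>m j) $$ (l, i)"
        unfolding index_mult_mat_sum[OF X(1) Xp l ji(3)] by (simp add: sum_distrib_left ac_simps)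
      also have "\<dots> = X_pow (w * int j) * (X ^\<^sub>m Suc j) $$ (l, i)"
        by (simp only: pow_mat_commute[OF X(1)])
      also have "X_pow (w * int j) = X_pow (- w) * (X_pow (w * int (Suc j)) :: 'a fls)"
        by (simp add: algebra_simps flip: X_pow_add)
      finally show ?thesis by (simp only: G_def prod.case mult.assoc)
    qed
    have "V * X * U c = V * (X * U c)" using v X Uc by (simp add: assoc_mult_mat[of _ n n _ n _ n])
    then have "(V * X * U c) $$ (k, b) = (\<Sum>l<n. V $$ (k, l) * (X * U c) $$ (l, b))"
      using index_mult_mat_sum[OF v(2) mult_carrier_mat[OF X(1) Uc] kb] by simp
    also have "\<dots> = X_pow (- w) * (\<Sum>l<n. V $$ (k, l) * G (Suc j, i) l)"
      by (simp add: XU sum_distrib_left ac_simps)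
    finally have eq: "(V * X * U c) $$ (k, b) = X_pow (- w) * (\<Sum>l<n. V $$ (k, l) * G (Suc j, i) l)" .
    have "ord_ge 0 (\<Sum>l<n. V $$ (k, l) * G (Suc j, i) l)"
    proof (cases "Suc j = n")
      case True then show ?thesis using keyn[OF ji(3) kb(1)] by simp
    next
      case False then show ?thesis using key[of "(Suc j, i)" k] ji kb by (simp add: idx_def)
    qed
    then show "ord_ge (- w) ((V * X * U c) $$ (k, b))" unfolding eq by (simp add: ord_ge_X_pow_mult)
  qed
  then show ?thesis using that[OF UV V0 Uo] by simp
qed

text \<open>Cayley-Hamilton applied to the first unit row, whose images under the powers of the companion
  matrix are the other unit rows.\<close>

lemma coeff_char_poly_companion:
  assumes i: "i < n"
  shows "coeff (char_poly (companion n a)) i = a i"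
proof -
  define C where "C = companion n a"
  have C: "C \<in> carrier_mat n n" by (simp add: C_def companion_def)
  have row: "(C ^\<^sub>m k) $$ (0, j) = (if j = k then 1 else 0)" if "k < n" "j < n" for k j
    using that
  proof (induction k arbitrary: j)
    case 0
    then show ?case using C by simp
  next
    case (Suc k)
    have "(C ^\<^sub>m Suc k) $$ (0, j) = (\<Sum>l<n. (C ^\<^sub>m k) $$ (0, l) * C $$ (l, j))"
      using C Suc.prems by (simp only: pow_mat.simps, intro index_mult_mat_sum) auto
    also have "\<dots> = (\<Sum>l<n. if l = k then C $$ (k, j) else 0)"
      using Suc by (intro sum.cong) auto
    also have "\<dots> = C $$ (k, j)" using Suc.prems by simp
    finally show ?case using Suc.prems by (simp add: C_def companion_def)
  qed
  have last: "(C ^\<^sub>m n) $$ (0, i) = - a i"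
  proof -
    obtain m where m: "n = Suc m" using i by (cases n) auto
    have "(C ^\<^sub>m n) $$ (0, i) = (\<Sum>l<n. (C ^\<^sub>m m) $$ (0, l) * C $$ (l, i))"
      using C i unfolding m by (simp only: pow_mat.simps, intro index_mult_mat_sum) auto
    also have "\<dots> = (\<Sum>l<n. if l = m then C $$ (m, i) else 0)"
      using row m by (intro sum.cong) auto
    also have "\<dots> = C $$ (m, i)" using m by simp
    finally show ?thesis using m i by (simp add: C_def companion_def)
  qed
  have "coeff (char_poly C) n = 1" using degree_monic_char_poly[OF C] by simp
  then have "(\<Sum>e<n. coeff (char_poly C) e * (C ^\<^sub>m e) $$ (0, i)) + (C ^\<^sub>m n) $$ (0, i) = 0"
    using cayley_hamilton[OF C _ i, of 0] i by (simp add: lessThan_Suc_atMost[symmetric])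
  moreover have "(\<Sum>e<n. coeff (char_poly C) e * (C ^\<^sub>m e) $$ (0, i)) =
      (\<Sum>e<n. if e = i then coeff (char_poly C) e else 0)"
    using row i by (intro sum.cong) auto
  ultimately show ?thesis using i last by (simp add: C_def)
qed

subsection \<open>Cyclic vectors\<close>

text \<open>The connection on row vectors: if F' = M F, then the derivative of s F is the row
  \<open>row_op n M s\<close> times F.\<close>

definition row_op :: "nat \<Rightarrow> complex fls fls mat \<Rightarrow> (nat \<Rightarrow> complex fls fls) \<Rightarrow> nat \<Rightarrow> complex fls fls" where
  "row_op n M s c = ddx (s c) + (\<Sum>b<n. s b * M $$ (b, c))"

text \<open>Formal version of \<open>row_op\<close> on the coefficients of \<open>\<Sum>j. w j * y ^ j\<close>, where \<open>y' = 1\<close>.\<close>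

definition taylor_op ::
  "nat \<Rightarrow> complex fls fls mat \<Rightarrow> (nat \<Rightarrow> nat \<Rightarrow> complex fls fls) \<Rightarrow> nat \<Rightarrow> nat \<Rightarrow> complex fls fls" where
  "taylor_op n M w j c = row_op n M (w j) c + of_nat (Suc j) * w (Suc j) c"

text \<open>The lift of \<open>row_op\<close> to polynomials in an indeterminate whose derivative is
  1; \<open>pderiv\<close> is the contribution of that derivative.\<close>

definition poly_row_op ::
  "nat \<Rightarrow> complex fls fls mat \<Rightarrow> (nat \<Rightarrow> complex fls fls poly) \<Rightarrow> nat \<Rightarrow> complex fls fls poly" where
  "poly_row_op n M p c = map_poly ddx (p c) + pderiv (p c) + (\<Sum>b<n. p b * [:M $$ (b, c):])"

lemma ddx_poly:
  assumes y: "ddx y = 1"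
  shows "ddx (poly p y) = poly (map_poly ddx p) y + poly (pderiv p) y"
  by (induction p) (auto simp: map_poly_pCons pderiv_pCons ddx_mult y algebra_simps)

lemma poly_poly_row_op:
  assumes y: "ddx y = 1"
  shows "(\<lambda>c. poly (poly_row_op n M p c) y) = row_op n M (\<lambda>c. poly (p c) y)"
  by (rule ext) (simp add: poly_row_op_def row_op_def ddx_poly[OF y] poly_sum mult.commute)

lemma poly_poly_row_op_funpow:
  assumes y: "ddx y = 1"
  shows "(\<lambda>c. poly ((poly_row_op n M ^^ i) p c) y) = (row_op n M ^^ i) (\<lambda>c. poly (p c) y)"
  by (induction i) (simp_all add: poly_poly_row_op[OF y])

lemma coeff_poly_row_op:
  "(\<lambda>j c. coeff (poly_row_op n M p c) j) = taylor_op n M (\<lambda>j c. coeff (p c) j)"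
  by (intro ext)
      (simp add: poly_row_op_def taylor_op_def row_op_def coeff_map_poly coeff_pderiv coeff_sum mult.commute)

lemma coeff_poly_row_op_funpow:
  "(\<lambda>j c. coeff ((poly_row_op n M ^^ i) p c) j) = (taylor_op n M ^^ i) (\<lambda>j c. coeff (p c) j)"
  by (induction i) (simp_all add: coeff_poly_row_op)

lemma KK_of_nat: "of_nat k \<in> KK"
  by (induction k) (auto intro: KK_add)

lemma KK_row_op:
  assumes "M \<in> KK_mat n" "\<And>c. c < n \<Longrightarrow> s c \<in> KK" "c < n"
  shows "row_op n M s c \<in> KK"
  using assms by (auto simp: row_op_def KK_mat_iff intro!: KK_add KK_ddx KK_sum KK_mult)

text \<open>\<open>taylor_op n M w = w'\<close> with prescribed \<open>w 0\<close> is a recursion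
  for \<open>w\<close>, solvable by division by \<open>Suc j\<close> in characteristic 0.
  Prescribing the iterates at index 0 thus peels off one value at a time.\<close>

lemma taylor_op_surj:
  assumes M: "M \<in> KK_mat n" and "\<And>i c. i < m \<Longrightarrow> c < n \<Longrightarrow> e i c \<in> KK"
  obtains w where "\<And>i c. i < m \<Longrightarrow> (taylor_op n M ^^ i) w 0 c = e i c" "\<And>j c. c < n \<Longrightarrow> w j c \<in> KK"
  using assms(2)
proof (induction m arbitrary: e thesis)
  case 0
  show ?case by (rule 0(1)[of "\<lambda>_ _. 0"]) auto
next
  case (Suc m)
  obtain w' where w': "\<And>i c. i < m \<Longrightarrow> (taylor_op n M ^^ i) w' 0 c = e (Suc i) c" "\<And>j c. c < n \<Longrightarrow> w' j c \<in> KK"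
    using Suc.IH[of "\<lambda>i. e (Suc i)"] Suc.prems(2) by auto
  define w where "w = rec_nat (e 0) (\<lambda>j s c. (w' j c - row_op n M s c) * inverse (of_nat (Suc j)))"
  have w0: "w 0 = e 0" and wS: "\<And>j c. w (Suc j) c
      = (w' j c - row_op n M (w j) c) * inverse (of_nat (Suc j))"
    by (simp_all add: w_def)
  have "taylor_op n M w = w'"
  proof (intro ext)
    fix j c
    have "(of_nat (Suc j) :: complex fls fls) \<noteq> 0" by (simp only: of_nat_eq_0_iff)
    then show "taylor_op n M w j c = w' j c" unfolding taylor_op_def wS
      by (simp add: mult.left_commute[of "of_nat (Suc j)"] del: of_nat_Suc)
  qed
  then have "(taylor_op n M ^^ i) w 0 c = e i c" if "i < Suc m" for i c
    using that w' w0 by (cases i) (auto simp: funpow_Suc_right simp del: funpow.simps)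
  moreover have "w j c \<in> KK" if "c < n" for j c
    using that
  proof (induction j arbitrary: c)
    case 0 then show ?case using w0 Suc.prems(2) by simp
  next
    case (Suc j)
    then show ?case unfolding wS
      by (intro KK_mult KK_diff KK_inverse KK_of_nat KK_row_op[OF M] w'(2)) auto
  qed
  ultimately show ?case by (rule Suc.prems(1))
qed

text \<open>Each application looks one Taylor coefficient further. Hence cutting off at degree
  \<open>n\<close> leaves the iterates with \<open>i < n\<close> unchanged at index 0.\<close>

lemma taylor_op_funpow_cong:
  assumes "\<And>j c. j \<le> m + i \<Longrightarrow> w j c = u j c" "j \<le> m"
  shows "(taylor_op n M ^^ i) w j c = (taylor_op n M ^^ i) u j c"
  using assms
proof (induction i arbitrary: w u)
  case (Suc i)
  have "taylor_op n M w j c = taylor_op n M u j c" if "j \<le> m + i" for j c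
    using Suc.prems(1) that by (simp add: taylor_op_def row_op_def)
  then show ?case using Suc.IH[of "taylor_op n M w" "taylor_op n M u"] Suc.prems(2)
    by (simp add: funpow_Suc_right del: funpow.simps)
qed simp

text \<open>Katz's argument: the candidate is a polynomial in \<open>y\<close> whose Taylor coefficients make the
  determinant equal to 1 at \<open>y = 0\<close>, so that it is nonzero for almost all \<open>y = x + a\<close>.\<close>

lemma cyclic_vector:
  assumes M: "M \<in> KK_mat n" and n: "n > 0"
  obtains s where "\<And>c. c < n \<Longrightarrow> s c \<in> KK" "det (mat n n (\<lambda>(i, c). (row_op n M ^^ i) s c)) \<noteq> 0"
proof -
  obtain w where w: "\<And>i c. i < n \<Longrightarrow> (taylor_op n M ^^ i) w 0 c = (if i = c then 1 else 0)"
    and wK: "\<And>j c. c < n \<Longrightarrow> w j c \<in> KK"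
  proof -
    have e: "(if i = c then 1 else 0) \<in> KK" for i c :: nat by simp
    show ?thesis by (rule taylor_op_surj[OF M e]) (rule that)
  qed
  define p where "p c = (\<Sum>j<n. monom (w j c) j)" for c
  have cp: "coeff (p c) j = (if j < n then w j c else 0)" for c j
    unfolding p_def coeff_sum coeff_monom by simp
  have at0: "coeff ((poly_row_op n M ^^ i) p c) 0 = (if i = c then 1 else 0)" if "i < n" for i c
  proof -
    have "coeff ((poly_row_op n M ^^ i) p c) 0 = (taylor_op n M ^^ i) (\<lambda>j c. coeff (p c) j) 0 c"
      using fun_cong[OF fun_cong[OF coeff_poly_row_op_funpow]] by fast
    also have "\<dots> = (taylor_op n M ^^ i) w 0 c"
      by (rule taylor_op_funpow_cong[of 0]) (use that in \<open>auto simp: cp\<close>)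
    finally show ?thesis using w[OF that] by simp
  qed
  define W where "W = mat n n (\<lambda>(i, c). (poly_row_op n M ^^ i) p c)"
  have hom: "comm_ring_hom (\<lambda>q. poly q y)" for y :: "complex fls fls"
    by unfold_locales auto
  have det_W: "poly (det W) y = det (mat n n (\<lambda>(i, c). poly ((poly_row_op n M ^^ i) p c) y))" for y
  proof -
    have "map_mat (\<lambda>q. poly q y) W = mat n n (\<lambda>(i, c). poly ((poly_row_op n M ^^ i) p c) y)"
      by (rule eq_matI) (auto simp: W_def)
    then show ?thesis using comm_ring_hom.hom_det[OF hom, of y W] by simp
  qed
  \<comment> \<open>Evaluation at 0 is formal here, as 0 does not have derivative 1; it only shows
    that \<open>det W\<close> is a nonzero polynomial.\<close>
  have "mat n n (\<lambda>(i, c). poly ((poly_row_op n M ^^ i) p c) 0) = 1\<^sub>m n"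
    by (rule eq_matI) (auto simp: poly_0_coeff_0 at0)
  then have "poly (det W) 0 = 1" unfolding det_W by simp
  then have "det W \<noteq> 0" by auto
  then have fin: "finite {y. poly (det W) y = 0}" by (rule poly_roots_finite)
  define y where "y a = fls_const (fls_X + fls_const a)" for a :: complex
  have "inj y"
  proof (rule injI)
    fix a b assume "y a = y b"
    then have "fls_nth (fls_nth (y a) 0) 0 = fls_nth (fls_nth (y b) 0) 0" by simp
    then show "a = b" by (simp add: y_def)
  qed
  have "infinite (range y)"
    using \<open>inj y\<close> infinite_UNIV_char_0[where 'a = complex] by (simp add: finite_image_iff)
  then have "\<not> range y \<subseteq> {y. poly (det W) y = 0}" using finite_subset[OF _ fin] by metis
  then obtain a where a: "poly (det W) (y a) \<noteq> 0" by auto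
  have dy: "ddx (y a) = 1" unfolding y_def ddx_const by simp
  show ?thesis
  proof (rule that)
    show "poly (p c) (y a) \<in> KK" if "c < n" for c
      unfolding p_def poly_sum poly_monom using wK that
      by (intro KK_sum KK_mult) (auto simp: y_def fls_const_power[symmetric])
    show "det (mat n n (\<lambda>(i, c). (row_op n M ^^ i) (\<lambda>c. poly (p c) (y a)) c)) \<noteq> 0"
      using a unfolding det_W poly_poly_row_op_funpow[OF dy, symmetric] .
  qed
qed

text \<open>For a cyclic row \<open>s\<close> the function f = s F has its derivatives given by the
  rows of \<open>S\<close>, so \<open>S\<close> carries the system to a companion system; the
  transformation in the sense of \<open>gauge\<close> is the inverse \<open>T\<close>.\<close>

lemma scalar_equation_exists:
  assumes M: "M \<in> KK_mat n" and n: "n > 0"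
  obtains a where "scalar_equation_of n M a"
proof -
  note Mc = KK_mat_carrier[OF M]
  obtain s where s: "\<And>c. c < n \<Longrightarrow> s c \<in> KK" and d: "det (mat n n (\<lambda>(i, c). (row_op n M ^^ i) s c)) \<noteq> 0"
    by (rule cyclic_vector[OF M n]) (rule that)
  define S where "S = mat n n (\<lambda>(i, c). (row_op n M ^^ i) s c)"
  have rK: "(row_op n M ^^ i) s c \<in> KK" if "c < n" for i c
    using that by (induction i arbitrary: c) (auto intro: s KK_row_op[OF M])
  have "S \<in> GL_KK n" using d rK by (auto simp: GL_KK_iff KK_mat_iff S_def)
  then obtain T where ST: "inverse_mats n S T" and T: "T \<in> GL_KK n" by (rule GL_KK_inverse)
  note c = inverse_mats_carrier[OF ST]
  define r where "r = mat 1 n (\<lambda>(_, c). (row_op n M ^^ n) s c)"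
  \<comment> \<open>For \<open>j < n\<close> these are minus the coordinates of the
    \<open>n\<close>-th iterate in the basis of the earlier iterates.\<close>
  define a where "a j = (if j = n then 1 else - (\<Sum>c<n. (row_op n M ^^ n) s c * T $$ (c, j)))" for j
  have CS: "companion n a * S = S * M + map_mat ddx S"
  proof (rule eq_matI)
    fix i b assume "i < dim_row (S * M + map_mat ddx S)" "b < dim_col (S * M + map_mat ddx S)"
    then have ib: "i < n" "b < n" using c by auto
    have "(S * M + map_mat ddx S) $$ (i, b) = (\<Sum>k<n. S $$ (i, k) * M $$ (k, b)) + ddx (S $$ (i, b))"
      using index_mult_mat_sum[OF c(1) Mc ib] c Mc ib by simp
    also have "\<dots> = (row_op n M ^^ Suc i) s b"
      using ib by (simp add: S_def row_op_def add.commute)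
    finally have R: "(S * M + map_mat ddx S) $$ (i, b) = (row_op n M ^^ Suc i) s b" .
    have L: "(companion n a * S) $$ (i, b) = (\<Sum>k<n. companion n a $$ (i, k) * S $$ (k, b))"
      by (rule index_mult_mat_sum[OF _ c(1) ib]) (simp add: companion_def)
    show "(companion n a * S) $$ (i, b) = (S * M + map_mat ddx S) $$ (i, b)"
    proof (cases "Suc i < n")
      case True
      then have "(\<Sum>k<n. companion n a $$ (i, k) * S $$ (k, b)) = (\<Sum>k<n. if k
          = Suc i then S $$ (k, b) else 0)"
        using ib by (intro sum.cong) (auto simp: companion_def)
      then show ?thesis unfolding L R using True ib by (simp add: S_def)
    next
      case False
      then have i: "Suc i = n" using ib by simp
      have "(\<Sum>k<n. companion n a $$ (i, k) * S $$ (k, b)) = (\<Sum>k<n. - a k * S $$ (k, b))"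
        using ib i by (intro sum.cong) (auto simp: companion_def)
      also have "\<dots> = (\<Sum>k<n. (r * T) $$ (0, k) * S $$ (k, b))"
        by (rule sum.cong)
            (use c in \<open>auto simp: a_def r_def index_mult_mat_sum[of _ 1 n _ n] simp del: index_mult_mat(1)\<close>)
      also have "\<dots> = (r * T * S) $$ (0, b)"
        by (rule index_mult_mat_sum[symmetric, of _ 1 n]) (use c ib in \<open>auto simp: r_def\<close>)
      also have "r * T * S = r" by (rule inverse_mats_cancel_right(2)[OF ST, of _ 1]) (simp add: r_def)
      also have "r $$ (0, b) = (row_op n M ^^ Suc i) s b" using ib i by (simp add: r_def)
      finally show ?thesis unfolding L R .
    qed
  qed (use c Mc in \<open>auto simp: companion_def\<close>)
  have I: "inverse_mats n T S" by (rule inverse_mats_sym[OF ST])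
  have "companion n a = companion n a * S * T"
    by (rule inverse_mats_cancel_right(1)[OF ST, of _ n, symmetric]) (simp add: companion_def)
  also have "\<dots> = S * M * T + map_mat ddx S * T"
    unfolding CS using c Mc by (intro add_mult_distrib_mat[of _ n n]) auto
  \<comment> \<open>Differentiating \<open>S * T = 1\<close> turns S' T into - S T'.\<close>
  also have "\<dots> = gauge T M"
  proof -
    have "map_mat ddx S * T + S * map_mat ddx T = map_mat ddx (1\<^sub>m n)"
      using map_mat_ddx_mult[OF c(1,2)] c(3) by simp
    also have "\<dots> = 0\<^sub>m n n" by (rule eq_matI) auto
    finally have z: "map_mat ddx S * T + S * map_mat ddx T = 0\<^sub>m n n" .
    have "map_mat ddx S * T = - (S * map_mat ddx T)"
    proof (rule eq_matI)
      fix i j assume "i < dim_row (- (S * map_mat ddx T))" "j < dim_col (- (S * map_mat ddx T))"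
      then have "i < n" "j < n" using c by auto
      then show "(map_mat ddx S * T) $$ (i, j) = (- (S * map_mat ddx T)) $$ (i, j)"
        using arg_cong[OF z, of "\<lambda>A. A $$ (i, j)"] c
        by (simp add: eq_neg_iff_add_eq_0 del: index_mult_mat(1))
    qed (use c in auto)
    then show ?thesis unfolding gauge_eq[OF I]
      by (simp only:) (rule minus_add_uminus_mat[symmetric, of _ n n], use c Mc in auto)
  qed
  finally have "companion n a = gauge T M" .
  moreover have "a j \<in> KK" if "j < n" for j
    using that rK T by (auto simp: a_def GL_KK_iff KK_mat_iff intro!: KK_uminus KK_sum KK_mult)
  ultimately have "scalar_equation_of n M a"
    using T by (auto simp: scalar_equation_of_def a_def)
  then show ?thesis by (rule that)
qed

subsection \<open>Leading coefficient matrices of systems\<close>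

text \<open>The coefficient of \<open>eps^(-h)\<close> over C((x)), before powers of x are
  normalised; for a system it is the leading coefficient matrix up to a power of x.\<close>

definition lead_mat :: "int \<Rightarrow> 'a::zero fls mat \<Rightarrow> 'a mat" where
  "lead_mat h M = map_mat (\<lambda>f. fls_nth f (- h)) M"

lemma lead_mat_carrier: "M \<in> carrier_mat m n \<Longrightarrow> lead_mat h M \<in> carrier_mat m n"
  by (simp add: lead_mat_def)

lemma xpow_eq: "xpow s r = X_pow \<lfloor>of_nat s * r\<rfloor>"
  unfolding xpow_def X_pow_powi ..

lemma fls_const_powi: "fls_const c powi k = fls_const (c powi k)"
  for c :: "'a::field"
  by (rule fls_const_power_int[symmetric])

lemma nth_xi_mult:
  "fls_nth (xi s \<sigma> powi h * fls_const (xpow s p) * g) k =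
    X_pow (\<lfloor>of_nat s * \<sigma>\<rfloor> * h + \<lfloor>of_nat s * p\<rfloor>) * fls_nth g (k - h)"
proof -
  have eq: "xi s \<sigma> powi h * fls_const (xpow s p) * g =
    fls_const (X_pow (\<lfloor>of_nat s * \<sigma>\<rfloor> * h)) * (fls_const (X_pow \<lfloor>of_nat s * p\<rfloor>) * (X_pow h * g))"
    unfolding xi_def xpow_eq by
        (simp only: power_int_mult_distrib fls_const_powi X_pow_power_int X_pow_powi ac_simps)
  show ?thesis unfolding eq by (simp add: nth_X_pow_mult X_pow_add mult.assoc)
qed

lemma ram_x_0 [simp]: "ram_x s 0 = 0"
  by (simp add: ram_x_def)

lemma ram_x_add: "s > 0 \<Longrightarrow> ram_x s (f + g) = ram_x s f + ram_x s g"
  and ram_x_diff: "s > 0 \<Longrightarrow> ram_x s (f - g) = ram_x s f - ram_x s g"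
  and ram_x_mult: "s > 0 \<Longrightarrow> ram_x s (f * g) = ram_x s f * ram_x s g"
  by (simp_all add: ram_x_def fls_compose_fps_add fls_compose_fps_diff fls_compose_fps_mult)

lemma ram_x_eq_0_iff: "s > 0 \<Longrightarrow> ram_x s f = 0 \<longleftrightarrow> f = 0"
  unfolding ram_x_def by (rule fls_compose_fps_eq_0_iff) auto

lemma ram_x_inj: "s > 0 \<Longrightarrow> ram_x s f = ram_x s g \<Longrightarrow> f = g"
  using ram_x_eq_0_iff[of s "f - g"] by (simp add: ram_x_diff)

lemma subdegree_ram_x: "s > 0 \<Longrightarrow> fls_subdegree (ram_x s f) = fls_subdegree f * int s"
  unfolding ram_x_def by simp

lemma ram_x_X_pow:
  assumes s: "s > 0"
  shows "ram_x s (X_pow k) = X_pow (int s * k)"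
proof -
  have "fls_X ^ s = (X_pow (int s) :: complex fls)"
    using X_pow_power[of 1 s] by (simp add: X_pow_1)
  then have "ram_x s (fls_X powi k) = X_pow (int s) powi k"
    unfolding ram_x_def by (subst fls_compose_fps_powi) (use s in \<open>auto simp: fps_to_fls_power\<close>)
  then show ?thesis unfolding X_pow_powi X_pow_power_int .
qed

lemma ram_x_1: "ram_x 1 f = f"
  by (rule fls_eqI) (use fls_nth_fls_compose_fps_linear[of 1 f] in \<open>simp add: ram_x_def\<close>)

text \<open>The coefficient of \<open>eps^0\<close> in the defining identity says that the ramified
  \<open>lead_mat h M\<close> times a power of the root of x is the ramified \<open>A 0\<close>. An
  entry of \<open>A 0\<close> with nonzero constant term forces that exponent to be divisible by
  \<open>s\<close>, so the two matrices differ by an integral power of x and have the same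
  rank.\<close>

lemma eps_system_lead:
  assumes sys: "eps_system n M s \<sigma> p h A"
  shows "mat_ord_ge (- h) M" "lead_mat h M \<noteq> 0\<^sub>m n n"
    "vec_space.rank n (lead_mat h M) = lead_rank n (A 0)"
proof -
  define E where "E = \<lfloor>of_nat s * \<sigma>\<rfloor> * h + \<lfloor>of_nat s * p\<rfloor>"
  define B where "B i j k = (if k < 0 then 0 else ram_x s (fps_to_fls (A (nat k) $$ (i, j))))" for i j
      and k :: int
  have M: "M \<in> carrier_mat n n" and s: "s > 0" and A: "\<And>k. A k \<in> carrier_mat n n"
    and A0: "map_mat (\<lambda>f. fps_nth f 0) (A 0) \<noteq> 0\<^sub>m n n"
    and eq: "\<And>i j. i < n \<Longrightarrow> j < n \<Longrightarrow> xi s \<sigma> powi h * fls_const (xpow s p) * ram s (M $$ (i, j))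
        = xi_series s \<sigma> (B i j)"
    using sys unfolding eps_system_def B_def by (auto simp: KK_mat_iff)
  have nth: "X_pow E * ram_x s (fls_nth (M $$ (i, j)) (k - h)) = B i j k * xpow s \<sigma> powi k"
    if "i < n" "j < n" for i j k
    using arg_cong[OF eq[OF that], of "\<lambda>f. fls_nth f k"]
    unfolding nth_xi_mult E_def[symmetric] nth_ram
    by (subst (asm) nth_xi_series[of 0]) (auto simp: B_def)
  show "mat_ord_ge (- h) M"
  proof (rule mat_ord_geI[OF M], rule ord_geI)
    fix i j k assume "i < n" "j < n" "k < - h"
    then show "fls_nth (M $$ (i, j)) k = 0"
      using nth[of i j "k + h"] ram_x_eq_0_iff[OF s] by (simp add: B_def)
  qed
  have lead: "X_pow E * ram_x s (fls_nth (M $$ (i, j)) (- h)) = ram_x s (fps_to_fls (A 0 $$ (i, j)))"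
    if "i < n" "j < n" for i j
    using nth[OF that, of 0] by (simp add: B_def)
  obtain i0 j0 where ij0: "i0 < n" "j0 < n" "fps_nth (A 0 $$ (i0, j0)) 0 \<noteq> 0"
  proof (rule ccontr)
    assume "\<not> thesis"
    with that have "map_mat (\<lambda>f. fps_nth f 0) (A 0) = 0\<^sub>m n n" using A[of 0] by (intro eq_matI) auto
    then show False using A0 by simp
  qed
  define l where "l = fls_subdegree (fls_nth (M $$ (i0, j0)) (- h))"
  have sub0: "fls_subdegree (fps_to_fls (A 0 $$ (i0, j0))) = 0"
    using ij0(3) by (simp add: fls_subdegree_fls_to_fps subdegree_eq_0)
  have nz: "fls_nth (M $$ (i0, j0)) (- h) \<noteq> 0"
  proof
    assume "fls_nth (M $$ (i0, j0)) (- h) = 0"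
    then have "ram_x s (fps_to_fls (A 0 $$ (i0, j0))) = 0" using lead[OF ij0(1,2)] by simp
    then show False using ram_x_eq_0_iff[OF s] ij0(3) by auto
  qed
  have "E + l * int s = 0"
    using arg_cong[OF lead[OF ij0(1,2)], of fls_subdegree] sub0 nz ram_x_eq_0_iff[OF s] s
    by (simp add: subdegree_ram_x l_def)
  then have E: "X_pow E = ram_x s (X_pow (- l))" unfolding ram_x_X_pow[OF s]
    by (simp add: add_eq_0_iff mult.commute)
  have A0ij: "fps_to_fls (A 0 $$ (i, j)) = X_pow (- l) * fls_nth (M $$ (i, j)) (- h)"
    if "i < n" "j < n" for i j
    using lead[OF that] unfolding E ram_x_mult[OF s, symmetric] using ram_x_inj[OF s] by metis
  have eqA: "map_mat fps_to_fls (A 0) = X_pow (- l) \<cdot>\<^sub>m lead_mat h M"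
    using A[of 0] M by (intro eq_matI) (auto simp: A0ij lead_mat_def)
  show "vec_space.rank n (lead_mat h M) = lead_rank n (A 0)"
    unfolding lead_rank_def eqA by (rule vec_space.rank_smult[symmetric, OF lead_mat_carrier[OF M]]) simp
  show "lead_mat h M \<noteq> 0\<^sub>m n n"
  proof
    assume "lead_mat h M = 0\<^sub>m n n"
    then have "lead_mat h M $$ (i0, j0) = 0" using ij0 by simp
    then show False using nz ij0 M by (simp add: lead_mat_def)
  qed
qed

text \<open>A steep integral slope serves with \<open>s = 1\<close>: membership in \<open>KK\<close>
  bounds the x-orders linearly in the eps-exponent, and the factor \<open>x^(-v)\<close> normalises
  the leading coefficient so that \<open>A 0\<close> does not vanish at x = 0.\<close>

lemma eps_system_exists:
  assumes M: "M \<in> KK_mat n" and o: "mat_ord_ge (- h) M" and nz: "lead_mat h M \<noteq> 0\<^sub>m n n"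
  obtains \<sigma> p A where "eps_system n M 1 \<sigma> p h A" "lead_rank n (A 0) = vec_space.rank n (lead_mat h M)"
proof -
  have Mc: "M \<in> carrier_mat n n" by (rule KK_mat_carrier[OF M])
  define I where "I = {(i, j). i < n \<and> j < n \<and> fls_nth (M $$ (i, j)) (- h) \<noteq> 0}"
  define sd where "sd = (\<lambda>(i, j). fls_subdegree (fls_nth (M $$ (i, j)) (- h)))"
  have fin: "finite I" by (rule finite_subset[of _ "{..<n} \<times> {..<n}"]) (auto simp: I_def)
  have ne: "I \<noteq> {}"
  proof
    assume "I = {}"
    then have "lead_mat h M = 0\<^sub>m n n" using Mc by (intro eq_matI) (auto simp: lead_mat_def I_def)
    then show False using nz by simp
  qed
  define q where "q = arg_min_on sd I"
  obtain i0 j0 where q: "q = (i0, j0)" by (cases q)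
  have ij0: "(i0, j0) \<in> I" using arg_min_if_finite(1)[OF fin ne, of sd] unfolding q_def[symmetric] q .
  define v where "v = sd (i0, j0)"
  have v: "ord_ge v (fls_nth (M $$ (i, j)) (- h))" if "i < n" "j < n" for i j
    using arg_min_least[OF fin ne, of "(i, j)" sd] that unfolding q_def[symmetric] q v_def
    by (auto simp: I_def sd_def ord_ge_iff)
  have "\<forall>i j. \<exists>c::nat. i < n \<and> j < n \<longrightarrow> (\<forall>k. ord_ge (- int c * (1 + \<bar>k\<bar>)) (fls_nth (M $$ (i, j)) k))"
    using M unfolding KK_mat_iff KK_iff by blast
  then obtain c0 :: "nat \<Rightarrow> nat \<Rightarrow> nat" where
    c0: "\<And>i j k. i < n \<Longrightarrow> j < n \<Longrightarrow> ord_ge (- int (c0 i j) * (1 + \<bar>k\<bar>)) (fls_nth (M $$ (i, j)) k)"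
    by metis
  define c where "c = (\<Sum>(i, j)\<in>{..<n} \<times> {..<n}. c0 i j)"
  have c: "ord_ge (- int c * (1 + \<bar>k\<bar>)) (fls_nth (M $$ (i, j)) k)" if "i < n" "j < n" for i j k
  proof (rule ord_ge_mono[OF c0[OF that]])
    have "c0 i j \<le> c" unfolding c_def
      using member_le_sum[of "(i, j)" "{..<n} \<times> {..<n}" "\<lambda>(i, j). c0 i j"] that by simp
    then have "int (c0 i j) * (1 + \<bar>k\<bar>) \<le> int c * (1 + \<bar>k\<bar>)" by (intro mult_right_mono) auto
    then show "- int c * (1 + \<bar>k\<bar>) \<le> - int (c0 i j) * (1 + \<bar>k\<bar>)" by simp
  qed
  \<comment> \<open>For \<open>k >= 1\<close> the term \<open>e k\<close> must outweigh
    \<open>v + c (1 + |k - h|)\<close>; here |v| <= |v| k and 1 + |k - h| <= k (2 + |h|).\<close>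
  define e where "e = \<bar>v\<bar> + int c * (2 + \<bar>h\<bar>)"
  have e0: "e \<ge> 0" by (simp add: e_def)
  have bound: "ord_ge (v - e * int k) (fls_nth (M $$ (i, j)) (int k - h))" if ij: "i < n" "j < n" for i j k
  proof (cases "k = 0")
    case True then show ?thesis using v[OF ij] by simp
  next
    case False
    then have k: "int k \<ge> 1" by simp
    show ?thesis
    proof (rule ord_ge_mono[OF c[OF ij]])
      have "\<bar>v\<bar> * 1 \<le> \<bar>v\<bar> * int k" using k by (intro mult_left_mono) auto
      moreover have "1 + \<bar>int k - h\<bar> \<le> int k * (2 + \<bar>h\<bar>)"
      proof -
        have "\<bar>h\<bar> * 1 \<le> \<bar>h\<bar> * int k" using k by (intro mult_left_mono) auto
        then show ?thesis using k by (simp add: algebra_simps)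
      qed
      then have "int c * (1 + \<bar>int k - h\<bar>) \<le> int c * (int k * (2 + \<bar>h\<bar>))" by (rule mult_left_mono) simp
      ultimately show "v - e * int k \<le> - int c * (1 + \<bar>int k - h\<bar>)"
        unfolding e_def by (simp add: algebra_simps)
    qed
  qed
  define B where "B i j k = X_pow (e * int k - v) * fls_nth (M $$ (i, j)) (int k - h)" for i j k
  have B0: "ord_ge 0 (B i j k)" if "i < n" "j < n" for i j k
    using bound[OF that, of k] by (simp add: B_def ord_ge_X_pow_mult)
  define A where "A k = mat n n (\<lambda>(i, j). fls_regpart (B i j k))" for k
  have Aij: "fps_to_fls (A k $$ (i, j)) = B i j k" if "i < n" "j < n" for i j k
    using that B0[OF that] by (simp add: A_def fps_to_fls_regpart)
  have sys: "eps_system n M 1 (of_int (- e)) (of_int (e * h - v)) h A"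
    unfolding eps_system_def
  proof (intro conjI allI impI)
    show "map_mat (\<lambda>f. fps_nth f 0) (A 0) \<noteq> 0\<^sub>m n n"
    proof
      assume "map_mat (\<lambda>f. fps_nth f 0) (A 0) = 0\<^sub>m n n"
      then have "map_mat (\<lambda>f. fps_nth f 0) (A 0) $$ (i0, j0) = 0" using ij0 by (simp add: I_def)
      then have "fls_nth (B i0 j0 0) 0 = 0" using ij0 by (simp add: A_def I_def)
      then have "fls_nth (fls_nth (M $$ (i0, j0)) (- h)) v = 0" by (simp add: B_def nth_X_pow_mult)
      then show False using ij0 by (simp add: v_def sd_def I_def)
    qed
    fix i j assume ij: "i < n" "j < n"
    let ?c = "\<lambda>k. if k < 0 then 0 else ram_x 1 (fps_to_fls (A (nat k) $$ (i, j)))"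
    show "xi 1 (of_int (- e)) powi h * fls_const (xpow 1 (of_int (e * h - v))) * ram 1 (M $$ (i, j)) =
        xi_series 1 (of_int (- e)) ?c"
    proof (rule fls_eqI)
      fix k
      have fl: "\<lfloor>of_nat 1 * rat_of_int m\<rfloor> = m" for m by simp
      have "fls_nth (xi 1 (of_int (- e)) powi h * fls_const (xpow 1 (of_int (e * h - v))) * ram 1 (M $$ (i, j))) k
        = X_pow (- v) * fls_nth (M $$ (i, j)) (k - h)"
        unfolding nth_xi_mult fl nth_ram ram_x_1 by (simp add: algebra_simps)
      moreover have "fls_nth (xi_series 1 (of_int (- e)) ?c) k = ?c k * X_pow (- e * k)"
        by (subst nth_xi_series[of 0]) (simp_all only: xpow_eq fl X_pow_power_int if_True)
      moreover have "X_pow (- v) * fls_nth (M $$ (i, j)) (k - h) = ?c k * X_pow (- e * k)"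
      proof (cases "k < 0")
        case True
        then show ?thesis using ord_geD[OF mat_ord_geD[OF o Mc ij], of "k - h"] by simp
      next
        case False
        then have "?c k * X_pow (- e * k) = X_pow (e * k - v + - e * k) * fls_nth (M $$ (i, j)) (k - h)"
          unfolding ram_x_1 X_pow_add by (simp add: Aij[OF ij] B_def)
        then show ?thesis by simp
      qed
      ultimately show
          "fls_nth (xi 1 (of_int (- e)) powi h * fls_const (xpow 1 (of_int (e * h - v))) * ram 1 (M $$ (i, j))) k =
        fls_nth (xi_series 1 (of_int (- e)) ?c) k" by simp
    qed
  qed (use M e0 in \<open>auto simp: A_def\<close>)
  have "map_mat fps_to_fls (A 0) = X_pow (- v) \<cdot>\<^sub>m lead_mat h M"
  proof (rule eq_matI)
    fix i j assume "i < dim_row (X_pow (- v) \<cdot>\<^sub>m lead_mat h M)" "j < dim_col (X_pow (- v) \<cdot>\<^sub>m lead_mat h M)"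
    then have ij: "i < n" "j < n" using Mc by (auto simp: lead_mat_def)
    have "A 0 \<in> carrier_mat n n" by (simp add: A_def)
    then show "map_mat fps_to_fls (A 0) $$ (i, j) = (X_pow (- v) \<cdot>\<^sub>m lead_mat h M) $$ (i, j)"
      using ij Mc Aij[OF ij] by (simp add: B_def lead_mat_def)
  qed (use Mc in \<open>auto simp: lead_mat_def A_def\<close>)
  then have "lead_rank n (A 0) = vec_space.rank n (lead_mat h M)"
    unfolding lead_rank_def using vec_space.rank_smult[OF lead_mat_carrier[OF Mc], of "X_pow (- v)" h]
        by simp
  then show ?thesis using that[OF sys] by simp
qed

lemma mu_eps_le:
  assumes "T \<in> GL_KK n" "eps_system n (gauge T M) s \<sigma> p h A"
  shows "mu_eps n M \<le> m_eps n h (A 0)"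
proof -
  have "m_eps n h (A 0) \<in> {m_eps n h (A 0) | T s \<sigma> p h A.
      T \<in> GL_KK n \<and> eps_system n (gauge T M) s \<sigma> p h A}"
    using assms by blast
  then show ?thesis unfolding mu_eps_def
    by (rule cInf_lower) (auto simp: m_eps_def intro!: bdd_belowI[of _ 0])
qed

lemma exact_order_exists:
  assumes M: "M \<in> carrier_mat n n" and o: "mat_ord_ge (- h) M" and nz: "M \<noteq> 0\<^sub>m n n"
  obtains g where "g \<le> h" "mat_ord_ge (- g) M" "lead_mat g M \<noteq> 0\<^sub>m n n"
proof -
  define I where "I = {(i, j). i < n \<and> j < n \<and> M $$ (i, j) \<noteq> 0}"
  define sd where "sd = (\<lambda>(i, j). fls_subdegree (M $$ (i, j)))"
  have fin: "finite I" by (rule finite_subset[of _ "{..<n} \<times> {..<n}"]) (auto simp: I_def)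
  have ne: "I \<noteq> {}"
  proof
    assume "I = {}"
    then have "M = 0\<^sub>m n n" using M by (intro eq_matI) (auto simp: I_def)
    then show False using nz by simp
  qed
  define q where "q = arg_min_on sd I"
  obtain i0 j0 where q: "q = (i0, j0)" by (cases q)
  have ij0: "(i0, j0) \<in> I" using arg_min_if_finite(1)[OF fin ne, of sd] unfolding q_def[symmetric] q .
  show ?thesis
  proof (rule that[of "- sd q"])
    show "- sd q \<le> h"
      using mat_ord_geD[OF o M, of i0 j0] ij0 unfolding q by (auto simp: sd_def I_def ord_ge_iff)
    show "mat_ord_ge (- (- sd q)) M"
      using arg_min_least[OF fin ne, of _ sd] unfolding q_def[symmetric]
      by (intro mat_ord_geI[OF M]) (auto simp: I_def sd_def ord_ge_iff)
    show "lead_mat (- sd q) M \<noteq> 0\<^sub>m n n"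
    proof
      assume "lead_mat (- sd q) M = 0\<^sub>m n n"
      then have "lead_mat (- sd q) M $$ (i0, j0) = 0" using ij0 by (simp add: I_def)
      then show False using ij0 M unfolding q by (simp add: lead_mat_def I_def sd_def)
    qed
  qed
qed

text \<open>Minimality of \<open>h + r / n\<close> is contradicted by a smaller rank at the same
  pole order, and also by a smaller pole order, since then the value is at most
  \<open>h\<close>.\<close>

lemma eps_irreducible_lead_rank:
  assumes sys: "eps_system n M s \<sigma> p h A" and irr: "eps_irreducible n M h A" and h: "h > 0"
    and T: "T \<in> GL_KK n" and o: "mat_ord_ge (- h) (gauge T M)"
  shows "lead_rank n (A 0) \<le> vec_space.rank n (lead_mat h (gauge T M))"
proof -
  have M: "M \<in> KK_mat n" using sys by (simp add: eps_system_def)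
  note Mc = KK_mat_carrier[OF M]
  have r: "lead_rank n (A 0) > 0"
    using vec_space.rank_pos[OF lead_mat_carrier[OF Mc] eps_system_lead(2)[OF sys]]
      eps_system_lead(3)[OF sys] by simp
  have n: "n > 0"
  proof (rule ccontr)
    assume "\<not> n > 0"
    then have "lead_mat h M = 0\<^sub>m n n" using Mc by (intro eq_matI) (auto simp: lead_mat_def)
    then show False using eps_system_lead(2)[OF sys] by simp
  qed
  have m: "m_eps n h (A 0) = of_int h + lead_rank n (A 0) / n" using h by (simp add: m_eps_def)
  have min: "m_eps n h (A 0) \<le> m_eps n g (B 0)"
    if "U \<in> GL_KK n" "eps_system n (gauge U M) s' \<sigma>' p' g B" for U s' \<sigma>' p' g B
    using mu_eps_le[OF that] irr by (simp add: eps_irreducible_def)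
  have no_lower: False if U: "U \<in> GL_KK n" and o': "mat_ord_ge (- (h - 1)) (gauge U M)" and nz:
      "gauge U M \<noteq> 0\<^sub>m n n" for U
  proof -
    have K: "gauge U M \<in> KK_mat n" by (rule KK_mat_gauge[OF U M])
    obtain g where g: "g \<le> h - 1" "mat_ord_ge (- g) (gauge U M)" "lead_mat g (gauge U M) \<noteq> 0\<^sub>m n n"
      using exact_order_exists[OF KK_mat_carrier[OF K] o' nz] .
    obtain \<sigma>' p' B where B: "eps_system n (gauge U M) 1 \<sigma>' p' g B"
      "lead_rank n (B 0) = vec_space.rank n (lead_mat g (gauge U M))"
      using eps_system_exists[OF K g(2,3)] .
    have "lead_rank n (B 0) \<le> n" unfolding B(2)
      by (rule vec_space.rank_le_nc[OF lead_mat_carrier[OF KK_mat_carrier[OF K]]])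
    then have "real (lead_rank n (B 0)) / real n \<le> 1" using n by simp
    moreover have "real_of_int g \<le> real_of_int h - 1" using g(1) by linarith
    ultimately have "m_eps n g (B 0) \<le> of_int h" using h by (simp add: m_eps_def)
    moreover have "real (lead_rank n (A 0)) / real n > 0" using r n by simp
    ultimately show False using min[OF U B(1)] unfolding m by linarith
  qed
  have K: "gauge T M \<in> KK_mat n" by (rule KK_mat_gauge[OF T M])
  note Kc = KK_mat_carrier[OF K]
  have lead: "lead_mat h (gauge T M) \<noteq> 0\<^sub>m n n"
  proof
    assume L: "lead_mat h (gauge T M) = 0\<^sub>m n n"
    have o': "mat_ord_ge (- (h - 1)) (gauge T M)"
    proof (rule mat_ord_geI[OF Kc], rule ord_geI)
      fix i j k assume ij: "i < n" "j < n" and k: "k < - (h - 1)"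
      show "fls_nth (gauge T M $$ (i, j)) k = 0"
      proof (cases "k = - h")
        case True
        then show ?thesis using arg_cong[OF L, of "\<lambda>A. A $$ (i, j)"] ij Kc by (simp add: lead_mat_def)
      next
        case False then show ?thesis using ord_geD[OF mat_ord_geD[OF o Kc ij], of k] k by simp
      qed
    qed
    show False
    proof (cases "gauge T M = 0\<^sub>m n n")
      case False then show False using no_lower[OF T o'] by simp
    next
      case True
      \<comment> \<open>The zero matrix has no leading coefficient and gives no value of
        \<open>m_eps\<close>. Scaling by x replaces it by the equivalent - (1/x) I, of order 0 in
        eps, to which \<open>no_lower\<close> applies.\<close>
      define x :: "complex fls fls" where "x = fls_const fls_X"
      have x: "x \<noteq> 0" "x \<in> KK" "ddx x = 1" unfolding x_def ddx_const by (simp_all add: fls_const_nonzero)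
      have I: "inverse_mats n (x \<cdot>\<^sub>m 1\<^sub>m n) (inverse x \<cdot>\<^sub>m 1\<^sub>m n)"
        using x by (auto simp: inverse_mats_def mult_smult_distrib[of _ n n _ n] mult_smult_assoc_mat[of _ n n _ n] intro!: eq_matI)
      have xG: "x \<cdot>\<^sub>m 1\<^sub>m n \<in> GL_KK n" unfolding GL_KK_iff
        using x by (auto intro!: KK_mat_smult KK_mat_one)
      obtain S where S: "inverse_mats n T S" using GL_KK_inverse[OF T] by metis
      have d: "map_mat ddx (x \<cdot>\<^sub>m 1\<^sub>m n) = 1\<^sub>m n" using x by (intro eq_matI) (auto simp: ddx_mult)
      have "gauge (T * (x \<cdot>\<^sub>m 1\<^sub>m n)) M = gauge (x \<cdot>\<^sub>m 1\<^sub>m n) (0\<^sub>m n n)"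
        using gauge_mult[OF S I Mc] True by simp
      also have "\<dots> = - (inverse x \<cdot>\<^sub>m 1\<^sub>m n)"
        unfolding gauge_eq[OF I] d by (rule eq_matI) (auto simp: mult_smult_assoc_mat[of _ n n _ n])
      finally have g: "gauge (T * (x \<cdot>\<^sub>m 1\<^sub>m n)) M = - (inverse x \<cdot>\<^sub>m 1\<^sub>m n)" .
      have ix: "inverse x = fls_const (inverse fls_X)"
        by (rule inverse_unique) (simp add: x_def)
      have "mat_ord_ge (- (h - 1)) (- (inverse x \<cdot>\<^sub>m 1\<^sub>m n))"
        using h by (auto simp: mat_ord_ge_def ix intro!: ord_ge_uminus)
      moreover have "- (inverse x \<cdot>\<^sub>m 1\<^sub>m n) \<noteq> 0\<^sub>m n n"
      proof
        assume "- (inverse x \<cdot>\<^sub>m 1\<^sub>m n) = 0\<^sub>m n n"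
        then have "(- (inverse x \<cdot>\<^sub>m 1\<^sub>m n)) $$ (0, 0) = 0" using n by simp
        then show False using n x by simp
      qed
      ultimately show False using no_lower[OF GL_KK_mult[OF T xG]] unfolding g by simp
    qed
  qed
  obtain \<sigma>' p' B where B: "eps_system n (gauge T M) 1 \<sigma>' p' h B"
      "lead_rank n (B 0) = vec_space.rank n (lead_mat h (gauge T M))"
    using eps_system_exists[OF K o lead] .
  have "real (lead_rank n (A 0)) / n \<le> real (lead_rank n (B 0)) / n"
    using min[OF T B(1)] unfolding m using h by (simp add: m_eps_def)
  then show ?thesis using n unfolding B(2) by (simp add: divide_le_cancel)
qed

subsection \<open>The Gerard-Levelt sequence\<close>

lemma inverse_mats_const:
  assumes "inverse_mats n P Q"
  shows "inverse_mats n (map_mat fls_const P) (map_mat fls_const (Q :: 'a::field mat))"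
proof -
  note c = inverse_mats_carrier[OF assms]
  interpret h: comm_ring_hom "fls_const :: 'a \<Rightarrow> 'a fls"
    by unfold_locales (auto simp: fls_plus_const fls_const_mult_const)
  have "map_mat fls_const P * map_mat fls_const Q = map_mat fls_const (P * Q)"
    "map_mat fls_const Q * map_mat fls_const P = map_mat fls_const (Q * P)"
    using h.mat_hom_mult[OF c(1,2)] h.mat_hom_mult[OF c(2,1)] by simp_all
  then show ?thesis using c by (simp add: inverse_mats_def h.mat_hom_one)
qed

lemma det_map_const: "det (map_mat fls_const P) = fls_const (det P)"
  for P :: "'a::field mat"
proof -
  interpret h: comm_ring_hom "fls_const :: 'a \<Rightarrow> 'a fls"
    by unfold_locales (auto simp: fls_plus_const fls_const_mult_const)
  show ?thesis by simp
qed

lemma mat_ord_ge_const: "mat_ord_ge 0 (map_mat fls_const P)"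
  by (auto simp: mat_ord_ge_def)

text \<open>The derivative term has order at least 0, hence at least \<open>1 - h\<close>. So a
  vanishing row of \<open>Q * lead_mat h M\<close> yields a row of the transformed matrix in which
  one order is gained.\<close>

lemma gauge_const_ord_ge:
  assumes P: "inverse_mats n P Q" and M: "M \<in> carrier_mat n n" "mat_ord_ge (- h) M" and h: "h \<ge> 1"
  shows "mat_ord_ge (- h) (gauge (map_mat fls_const P) M)"
    and "\<And>i j. i < n \<Longrightarrow> j < n \<Longrightarrow> (\<And>l. l < n \<Longrightarrow> (Q * lead_mat h M) $$ (i, l) = 0) \<Longrightarrow>
      ord_ge (1 - h) (gauge (map_mat fls_const P) M $$ (i, j))"
proof -
  let ?P = "map_mat fls_const P" and ?Q = "map_mat fls_const Q"
  have I: "inverse_mats n ?P ?Q" by (rule inverse_mats_const[OF P])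
  note c = inverse_mats_carrier[OF I] note pq = inverse_mats_carrier[OF P]
  have QM: "?Q * M \<in> carrier_mat n n" "?Q * M * ?P \<in> carrier_mat n n"
      "?Q * map_mat ddx ?P \<in> carrier_mat n n"
    using c M by simp_all
  have d0: "mat_ord_ge 0 (?Q * map_mat ddx ?P)"
    by (rule mat_ord_ge_mult[OF c(2) _ mat_ord_ge_const mat_ord_ge_ddx[OF mat_ord_ge_const]])
        (use c in auto)
  have oQM: "mat_ord_ge (- h) (?Q * M)" by (rule mat_ord_ge_mult[OF c(2) M(1) mat_ord_ge_const M(2)]) simp
  have "mat_ord_ge (- h) (?Q * M * ?P)" by (rule mat_ord_ge_mult[OF QM(1) c(1) oQM mat_ord_ge_const]) simp
  then show "mat_ord_ge (- h) (gauge ?P M)" unfolding gauge_eq[OF I]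
    by (intro mat_ord_ge_diff[OF QM(2,3)] mat_ord_ge_mono[OF d0]) (use h in simp_all)
  fix i j assume ij: "i < n" "j < n" and z: "\<And>l. l < n \<Longrightarrow> (Q * lead_mat h M) $$ (i, l) = 0"
  have o1: "ord_ge (1 - h) ((?Q * M) $$ (i, l))" if l: "l < n" for l
  proof (rule ord_geI)
    fix k assume k: "k < 1 - h"
    show "fls_nth ((?Q * M) $$ (i, l)) k = 0"
    proof (cases "k = - h")
      case False then show ?thesis using ord_geD[OF mat_ord_geD[OF oQM QM(1) ij(1) l], of k] k by simp
    next
      case True
      have "fls_nth ((?Q * M) $$ (i, l)) (- h) = (\<Sum>b<n. Q $$ (i, b) * lead_mat h M $$ (b, l))"
        unfolding index_mult_mat_sum[OF c(2) M(1) ij(1) l] fls_nth_sum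
        using pq M(1) ij l by (intro sum.cong) (auto simp: lead_mat_def)
      also have "\<dots> = (Q * lead_mat h M) $$ (i, l)"
        by (rule index_mult_mat_sum[symmetric, of _ n]) (use pq M ij l lead_mat_carrier in auto)
      finally show ?thesis using z[OF l] True by simp
    qed
  qed
  have "ord_ge (1 - h) ((?Q * M * ?P) $$ (i, j))"
    unfolding index_mult_mat_sum[OF QM(1) c(1) ij]
  proof (rule ord_ge_sum)
    fix l assume l: "l \<in> {..<n}"
    have p: "ord_ge 0 (?P $$ (l, j))" using pq ij l by simp
    show "ord_ge (1 - h) ((?Q * M) $$ (i, l) * ?P $$ (l, j))"
      by (rule ord_ge_mult[OF o1[of l] p]) (use l in simp_all)
  qed
  moreover have "ord_ge (1 - h) ((?Q * map_mat ddx ?P) $$ (i, j))"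
    by (rule ord_ge_mono[OF mat_ord_geD[OF d0 QM(3) ij]]) (use h in simp)
  ultimately have "ord_ge (1 - h) ((?Q * M * ?P) $$ (i, j) - (?Q * map_mat ddx ?P) $$ (i, j))"
    by (rule ord_ge_diff)
  moreover have "gauge ?P M $$ (i, j) = (?Q * M * ?P) $$ (i, j) - (?Q * map_mat ddx ?P) $$ (i, j)"
    unfolding gauge_eq[OF I] by (rule index_minus_mat(1)) (use QM ij in auto)
  ultimately show "ord_ge (1 - h) (gauge ?P M $$ (i, j))" by simp
qed

text \<open>\<open>S\<close> is a basis of the lattice generated by the standard lattice and its
  image under \<open>eps^(h - 1) M\<close>: a basis of the image of the leading matrix, of size
  \<open>r\<close>, is divided by eps, and the other vectors complete it. This accounts for the
  order of the determinant.\<close>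

lemma gerard_levelt_step:
  assumes M: "M \<in> KK_mat n" and o: "mat_ord_ge (- h) M" and h: "h \<ge> 1"
  defines "r \<equiv> vec_space.rank n (lead_mat h M)"
  obtains S V R where "S \<in> GL_KK n" "V \<in> carrier_mat n n" "R \<in> carrier_mat n n"
    "mat_ord_ge 0 V" "mat_ord_ge 0 R" "S = X_pow (h - 1) \<cdot>\<^sub>m (M * V) + R"
    "fls_subdegree (det S) = - int r"
    "mat_ord_ge (- h) (gauge S M)" "vec_space.rank n (lead_mat h (gauge S M)) \<le> r"
proof -
  note Mc = KK_mat_carrier[OF M]
  note L = lead_mat_carrier[OF Mc, of h]
  obtain P Q f where PQ: "inverse_mats n P Q" and f: "\<And>j. j < r \<Longrightarrow> f j < n"
    and Pf: "\<And>i j. j < r \<Longrightarrow> i < n \<Longrightarrow> P $$ (i, j) = lead_mat h M $$ (i, f j)"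
    and z: "\<And>i j. r \<le> i \<Longrightarrow> i < n \<Longrightarrow> j < n \<Longrightarrow> (Q * lead_mat h M) $$ (i, j) = 0"
    using vec_space.rank_decomposition[OF L] unfolding r_def by metis
  have rn: "r \<le> n" unfolding r_def by (rule vec_space.rank_le_nc[OF L])
  define Pc where "Pc = map_mat fls_const P"
  define Qc where "Qc = map_mat fls_const Q"
  have I: "inverse_mats n Pc Qc" unfolding Pc_def Qc_def by (rule inverse_mats_const[OF PQ])
  note c = inverse_mats_carrier[OF I] note pq = inverse_mats_carrier[OF PQ]
  define d :: "nat \<Rightarrow> complex fls fls" where "d i = (if i < r then X_pow (- 1) else 1)" for i
  have dnz: "d i \<noteq> 0" for i by (simp add: d_def)
  define D where "D = mat n n (\<lambda>(i, j). if i = j then d i else 0)"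
  define D' where "D' = mat n n (\<lambda>(i, j). if i = j then inverse (d i) else 0)"
  have Dc: "D \<in> carrier_mat n n" and Dd: "\<And>i j. i < n \<Longrightarrow> j < n \<Longrightarrow> i \<noteq> j \<Longrightarrow> D $$ (i, j) = 0"
    and Dii: "\<And>i. i < n \<Longrightarrow> D $$ (i, i) = d i"
    by (simp_all add: D_def)
  have ID: "inverse_mats n D D'"
  proof -
    have "D' = mat n n (\<lambda>(i, j). if i = j then inverse (D $$ (i, i)) else 0)"
      by (rule eq_matI) (auto simp: D'_def Dii)
    then show ?thesis using inverse_diagonal[OF Dc Dd] Dii dnz by simp
  qed
  have D'c: "D' \<in> carrier_mat n n" and D'd: "\<And>i j. i < n \<Longrightarrow> j < n \<Longrightarrow> i \<noteq> j \<Longrightarrow> D' $$ (i, j) = 0"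
    and D'ii: "\<And>i. i < n \<Longrightarrow> D' $$ (i, i) = inverse (d i)"
    by (simp_all add: D'_def)
  define S where "S = Pc * D"
  have Sc: "S \<in> carrier_mat n n" unfolding S_def using c Dc by simp
  have Sij: "S $$ (i, j) = fls_const (P $$ (i, j)) * d j" if "i < n" "j < n" for i j
    unfolding S_def using mult_diagonal_mat[OF Dc Dd c(1) that] Dii that pq by (simp add: Pc_def)
  have detD: "det D = X_pow (- int r)"
  proof -
    have "upper_triangular D" by (auto simp: D_def upper_triangular_def)
    then have "det D = prod_list (diag_mat D)" using det_upper_triangular Dc by blast
    also have "diag_mat D = map d [0..<n]" unfolding diag_mat_def using Dc Dii by (auto cong: map_cong)
    also have "prod_list (map d [0..<n]) = prod d {0..<n}" using prod.distinct_set_conv_list[of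
        "[0..<n]" d] by simp
    also have "\<dots> = prod d {0..<r}"
      by (rule prod.mono_neutral_right) (use rn in \<open>auto simp: d_def\<close>)
    also have "\<dots> = X_pow (- 1) ^ r" by (simp add: d_def)
    finally show ?thesis by (simp add: X_pow_power)
  qed
  have dP: "det P \<noteq> 0" using inverse_mats_det[OF PQ] by auto
  have detS: "det S = fls_const (det P) * X_pow (- int r)"
    unfolding S_def det_mult[OF c(1) Dc] detD by (simp only: Pc_def det_map_const)
  have subS: "fls_subdegree (det S) = - int r"
    unfolding detS using dP by (subst fls_subdegree_mult) (auto simp: fls_const_nonzero)
  have SG: "S \<in> GL_KK n"
    using dP Sc by (auto simp: GL_KK_iff detS fls_const_nonzero KK_mat_iff Sij d_def intro!: KK_mult)
  \<comment> \<open>\<open>M * V\<close> consists of the columns of \<open>M\<close> whose leading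
    terms form the basis of the image, followed by zero columns.\<close>
  define V :: "complex fls fls mat" where "V = mat n n (\<lambda>(b, j). if j < r \<and> b = f j then 1 else 0)"
  have V: "V \<in> carrier_mat n n" by (simp add: V_def)
  have MV: "(M * V) $$ (i, j) = (if j < r then M $$ (i, f j) else 0)" if "i < n" "j < n" for i j
  proof -
    have "(M * V) $$ (i, j) = (\<Sum>b<n. if b = f j then (if j < r then M $$ (i, b) else 0) else 0)"
      unfolding index_mult_mat_sum[OF Mc V that] by (rule sum.cong) (use that in \<open>auto simp: V_def\<close>)
    also have "\<dots> = (if j < r then M $$ (i, f j) else 0)" using f[of j] by simp
    finally show ?thesis .
  qed
  define R where "R = S - X_pow (h - 1) \<cdot>\<^sub>m (M * V)"
  have MVc: "X_pow (h - 1) \<cdot>\<^sub>m (M * V) \<in> carrier_mat n n" using Mc V by simp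
  have R: "R \<in> carrier_mat n n" unfolding R_def using MVc by (rule minus_carrier_mat)
  have Rij: "R $$ (i, j) = fls_const (P $$ (i, j)) * d j - X_pow (h - 1) * (M * V) $$ (i, j)" if "i < n"
      "j < n" for i j
    unfolding R_def using that Sc Mc V Sij[OF that] by (simp del: index_mult_mat(1))
  \<comment> \<open>For \<open>j < r\<close> the pole parts cancel: column \<open>j\<close> of
    \<open>P\<close> is column \<open>f j\<close> of the leading matrix.\<close>
  have R0: "mat_ord_ge 0 R"
  proof (rule mat_ord_geI[OF R])
    fix i j assume ij: "i < n" "j < n"
    show "ord_ge 0 (R $$ (i, j))"
    proof (cases "j < r")
      case False then show ?thesis unfolding Rij[OF ij] MV[OF ij] by (simp add: d_def)
    next
      case True
      show ?thesis unfolding Rij[OF ij] MV[OF ij]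
      proof (rule ord_geI)
        fix k :: int assume k: "k < 0"
        show "fls_nth (fls_const (P $$ (i, j)) * d j - X_pow (h - 1) * (if j < r then M $$ (i, f j) else 0)) k = 0"
        proof (cases "k = - 1")
          case neg: True
          then show ?thesis using True Pf[OF True ij(1)] f[OF True] Mc ij
            by (simp add: d_def nth_X_pow nth_X_pow_mult lead_mat_def)
        next
          case False
          then have "k - (h - 1) < - h" using k by simp
          then have "fls_nth (M $$ (i, f j)) (k - (h - 1)) = 0"
            using ord_geD[OF mat_ord_geD[OF o Mc ij(1) f[OF True]]] by simp
          then show ?thesis using False True by (simp add: d_def nth_X_pow nth_X_pow_mult)
        qed
      qed
    qed
  qed
  have Seq: "S = X_pow (h - 1) \<cdot>\<^sub>m (M * V) + R"
    unfolding R_def using Sc MVc by (intro eq_matI) auto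
  have V0: "mat_ord_ge 0 V" by (rule mat_ord_geI[OF V]) (auto simp: V_def)
  define M' where "M' = gauge Pc M"
  have M'c: "M' \<in> carrier_mat n n" unfolding M'_def by (rule gauge_carrier[OF I Mc])
  have M'o: "mat_ord_ge (- h) M'" unfolding M'_def Pc_def by (rule gauge_const_ord_ge(1)[OF PQ Mc o h])
  have M'z: "ord_ge (1 - h) (M' $$ (i, j))" if "r \<le> i" "i < n" "j < n" for i j
    unfolding M'_def Pc_def by (rule gauge_const_ord_ge(2)[OF PQ Mc o h that(2,3) z[OF that(1,2)]])
  have dD: "map_mat ddx D = 0\<^sub>m n n" by (rule eq_matI) (auto simp: D_def d_def)
  have gS: "gauge S M = D' * M' * D"
  proof -
    have "gauge S M = gauge D M'" unfolding S_def M'_def by (rule gauge_mult[OF I ID Mc])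
    also have "\<dots> = D' * M' * D"
      unfolding gauge_eq[OF ID] dD using D'c M'c Dc by (intro eq_matI) auto
    finally show ?thesis .
  qed
  have gSc: "gauge S M \<in> carrier_mat n n" unfolding gS using D'c M'c Dc by simp
  have gij: "gauge S M $$ (i, j) = inverse (d i) * M' $$ (i, j) * d j" if ij: "i < n" "j < n" for i j
    unfolding gS using mult_diagonal_mat[OF Dc Dd mult_carrier_mat[OF D'c M'c] ij]
      diagonal_mult_mat[OF D'c D'd M'c ij] Dii D'ii ij by simp
  have inv1: "inverse (X_pow (- 1) :: complex fls fls) = X_pow 1"
    using X_pow_minus[of "- 1 :: int", where 'a = "complex fls"] by simp
  \<comment> \<open>Columns from \<open>r\<close> on lose their leading term: rows with index below
    \<open>r\<close> gain a factor eps from \<open>D'\<close>, the others gained an order through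
    \<open>P\<close>. This yields the rank bound.\<close>
  have gz: "ord_ge (1 - h) (gauge S M $$ (i, j))" if ij: "i < n" "j < n" "r \<le> j" for i j
    using mat_ord_geD[OF M'o M'c ij(1,2)] M'z[OF _ ij(1,2)] ij unfolding gij[OF ij(1,2)]
    by (cases "i < r") (simp_all add: d_def inv1 ord_ge_X_pow_mult)
  have go: "mat_ord_ge (- h) (gauge S M)"
  proof (rule mat_ord_geI[OF gSc])
    fix i j assume ij: "i < n" "j < n"
    show "ord_ge (- h) (gauge S M $$ (i, j))"
    proof (cases "r \<le> j")
      case True then show ?thesis using gz[OF ij] ord_ge_mono by fastforce
    next
      case j: False
      show ?thesis
      proof (cases "r \<le> i")
        case True
        have "ord_ge (- h) (X_pow (- 1) * M' $$ (i, j))"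
          using M'z[OF True ij] by (simp add: ord_ge_X_pow_mult add.commute)
        then show ?thesis unfolding gij[OF ij] using True j by (simp add: d_def mult.commute)
      next
        case False
        have e: "inverse (d i) * M' $$ (i, j) * d j = M' $$ (i, j)"
          using False j dnz[of i] by (simp add: d_def)
        show ?thesis unfolding gij[OF ij] e by (rule mat_ord_geD[OF M'o M'c ij])
      qed
    qed
  qed
  have "vec_space.rank n (lead_mat h (gauge S M)) \<le> r"
    by (rule vec_space.rank_le_nonzero_cols[OF lead_mat_carrier[OF gSc]])
      (use gz gSc in \<open>auto simp: lead_mat_def ord_ge_def\<close>)
  then show ?thesis using that[OF SG V R V0 R0 Seq subS go] by simp
qed

text \<open>Each step keeps the rank at most \<open>r\<close>, and irreducibility keeps it at least
  \<open>r\<close>; so every step lowers the order of the determinant by the same \<open>r\<close>.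
  The recursion is stated in the original coordinates, by \<open>mult_gauge\<close>.\<close>

lemma gerard_levelt_sequence:
  assumes sys: "eps_system n M s \<sigma> p h A" and irr: "eps_irreducible n M h A" and h: "h > 0"
  defines "r \<equiv> lead_rank n (A 0)"
  obtains T V R where "T 0 = 1\<^sub>m n" "\<And>k. T k \<in> GL_KK n" "\<And>k. fls_subdegree (det (T k)) = - int (k * r)"
    "\<And>k. V k \<in> carrier_mat n n" "\<And>k. R k \<in> carrier_mat n n" "\<And>k. mat_ord_ge 0 (V k)"
        "\<And>k. mat_ord_ge 0 (R k)"
    "\<And>k. T (Suc k) = X_pow (h - 1) \<cdot>\<^sub>m ((M * T k - map_mat ddx (T k)) * V k) + T k * R k"
proof -
  have M: "M \<in> KK_mat n" using sys by (simp add: eps_system_def)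
  note Mc = KK_mat_carrier[OF M]
  \<comment> \<open>The clause for \<open>k = 0\<close> carries the initial lattice through the
    choice principle, which otherwise returns only some good start.\<close>
  define good where "good k T \<longleftrightarrow> T \<in> GL_KK n \<and> fls_subdegree (det T) = - int (k * r) \<and>
    mat_ord_ge (- h) (gauge T M) \<and> vec_space.rank n (lead_mat h (gauge T M)) = r \<and> (k = 0 \<longrightarrow> T = 1\<^sub>m n)" for k T
  define rel where "rel T T' V R \<longleftrightarrow> V \<in> carrier_mat n n \<and> R \<in> carrier_mat n n \<and> mat_ord_ge 0 V
      \<and> mat_ord_ge 0 R \<and>
    T' = X_pow (h - 1) \<cdot>\<^sub>m ((M * T - map_mat ddx T) * V) + T * R" for T T' V R
  have "\<exists>T. \<forall>k. good k (T k) \<and> (\<exists>V R. rel (T k) (T (Suc k)) V R)"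
  proof (rule dependent_nat_choice)
    have "good 0 (1\<^sub>m n)" unfolding good_def gauge_one[OF Mc]
      using eps_system_lead[OF sys] by (auto simp: GL_KK_iff KK_mat_one r_def)
    then show "\<exists>T. good 0 T" ..
  next
    fix T k assume g: "good k T"
    then have T: "T \<in> GL_KK n" by (simp add: good_def)
    define N where "N = gauge T M"
    have N: "N \<in> KK_mat n" unfolding N_def by (rule KK_mat_gauge[OF T M])
    note Nc = KK_mat_carrier[OF N]
    have No: "mat_ord_ge (- h) N" and Nr: "vec_space.rank n (lead_mat h N) = r"
      using g by (simp_all add: good_def N_def)
    obtain S V R where S: "S \<in> GL_KK n" and V: "V \<in> carrier_mat n n" "mat_ord_ge 0 V"
      and R: "R \<in> carrier_mat n n" "mat_ord_ge 0 R" and Seq: "S = X_pow (h - 1) \<cdot>\<^sub>m (N * V) + R"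
      and subS: "fls_subdegree (det S) = - int r"
      and go: "mat_ord_ge (- h) (gauge S N)" and gr: "vec_space.rank n (lead_mat h (gauge S N)) \<le> r"
      using gerard_levelt_step[OF N No] h unfolding Nr
          by (metis zero_less_imp_eq_int int_one_le_iff_zero_less)
    obtain T' where T': "inverse_mats n T T'" using GL_KK_inverse[OF T] by metis
    obtain S' where S': "inverse_mats n S S'" using GL_KK_inverse[OF S] by metis
    note t = inverse_mats_carrier[OF T'] note s = inverse_mats_carrier[OF S']
    have gTS: "gauge (T * S) M = gauge S N" unfolding N_def by (rule gauge_mult[OF T' S' Mc])
    have TS: "T * S \<in> GL_KK n" by (rule GL_KK_mult[OF T S])
    have "r \<le> vec_space.rank n (lead_mat h (gauge (T * S) M))"
      unfolding r_def by (rule eps_irreducible_lead_rank[OF sys irr h TS]) (simp add: gTS go)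
    moreover have "fls_subdegree (det (T * S)) = - int (Suc k * r)"
      using g T S unfolding det_mult[OF t(1) s(1)] GL_KK_iff good_def
      by (subst fls_subdegree_mult) (auto simp: subS algebra_simps)
    ultimately have "good (Suc k) (T * S)" using TS go gr by (simp add: good_def gTS)
    moreover have "rel T (T * S) V R"
    proof -
      have "T * S = T * (X_pow (h - 1) \<cdot>\<^sub>m (N * V)) + T * R"
        unfolding Seq using t V R Nc by (intro mult_add_distrib_mat[of _ n n _ n]) auto
      also have "T * (X_pow (h - 1) \<cdot>\<^sub>m (N * V)) = X_pow (h - 1) \<cdot>\<^sub>m (T * (N * V))"
        using t V Nc by (intro mult_smult_distrib[of _ n n _ n]) auto
      also have "T * (N * V) = T * N * V" using t V Nc by simp
      also have "T * N = M * T - map_mat ddx T" unfolding N_def by (rule mult_gauge[OF T' Mc])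
      finally show ?thesis using V R by (simp add: rel_def)
    qed
    ultimately show "\<exists>T'. good (Suc k) T' \<and> (\<exists>V R. rel T T' V R)" by blast
  qed
  then obtain T where T: "\<And>k. good k (T k)" and "\<And>k. \<exists>V R. rel (T k) (T (Suc k)) V R" by blast
  then obtain V R where VR: "\<And>k. rel (T k) (T (Suc k)) (V k) (R k)" by metis
  show ?thesis
    by (rule that[of T V R]) (use T VR in \<open>auto simp: good_def rel_def\<close>)
qed

subsection \<open>Ramification in eps\<close>

definition eps_subst :: "nat \<Rightarrow> complex fls fls mat \<Rightarrow> complex fls fls mat" where
  "eps_subst v M = map_mat (\<lambda>f. fls_compose_power f v) M"

lemma eps_subst_carrier: "M \<in> carrier_mat m n \<Longrightarrow> eps_subst v M \<in> carrier_mat m n"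
  by (simp add: eps_subst_def)

context
  fixes v :: nat
  assumes v: "v > 0"
begin

interpretation h: field_hom "\<lambda>f. fls_compose_power f v :: complex fls fls"
  by (rule compose_power_hom[OF v])

lemma eps_subst_mult:
  "A \<in> carrier_mat m l \<Longrightarrow> B \<in> carrier_mat l n \<Longrightarrow> eps_subst v (A * B) = eps_subst v A * eps_subst v B"
  unfolding eps_subst_def by (rule h.mat_hom_mult)

lemma eps_subst_add:
  "A \<in> carrier_mat m n \<Longrightarrow> B \<in> carrier_mat m n \<Longrightarrow> eps_subst v (A + B) = eps_subst v A + eps_subst v B"
  by (rule eq_matI) (auto simp: eps_subst_def)

lemma eps_subst_diff:
  "A \<in> carrier_mat m n \<Longrightarrow> B \<in> carrier_mat m n \<Longrightarrow> eps_subst v (A - B) = eps_subst v A - eps_subst v B"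
  by (rule eq_matI) (auto simp: eps_subst_def)

lemma eps_subst_smult: "eps_subst v (c \<cdot>\<^sub>m A) = fls_compose_power c v \<cdot>\<^sub>m eps_subst v A"
  by (rule eq_matI) (auto simp: eps_subst_def)

lemma eps_subst_one: "eps_subst v (1\<^sub>m n) = 1\<^sub>m n"
  by (rule eq_matI) (use v in \<open>auto simp: eps_subst_def\<close>)

lemma eps_subst_ddx: "eps_subst v (map_mat ddx A) = map_mat ddx (eps_subst v A)"
  by (rule eq_matI) (use v in \<open>auto simp: eps_subst_def ddx_compose_power\<close>)

lemma inverse_mats_eps_subst: "inverse_mats n T S \<Longrightarrow> inverse_mats n (eps_subst v T) (eps_subst v S)"
  unfolding inverse_mats_def
  by (simp add: eps_subst_carrier eps_subst_one flip: eps_subst_mult[of T n n S n] eps_subst_mult[of S n n T n])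

text \<open>eps is a constant for \<open>ddx\<close>, so equivalence of systems survives the
  substitution.\<close>

lemma gauge_eps_subst:
  assumes T: "inverse_mats n T S" and M: "M \<in> carrier_mat n n"
  shows "gauge (eps_subst v T) (eps_subst v M) = eps_subst v (gauge T M)"
proof -
  note t = inverse_mats_carrier[OF T]
  have c: "S * M \<in> carrier_mat n n" "S * M * T \<in> carrier_mat n n" "S * map_mat ddx T \<in> carrier_mat n n"
    "map_mat ddx T \<in> carrier_mat n n"
    using t M by auto
  show ?thesis
    unfolding gauge_eq[OF T] gauge_eq[OF inverse_mats_eps_subst[OF T]] eps_subst_diff[OF c(2,3)]
      eps_subst_mult[OF c(1) t(1)] eps_subst_mult[OF t(2) M] eps_subst_mult[OF t(2) c(4)] eps_subst_ddx ..
qed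

lemma coeff_char_poly_eps_subst:
  assumes M: "M \<in> carrier_mat n n"
  shows "coeff (char_poly (eps_subst v M)) i = fls_compose_power (coeff (char_poly M) i) v"
  unfolding eps_subst_def h.char_poly_hom[OF M] by simp

lemma mat_ord_ge_eps_subst: "mat_ord_ge k M \<Longrightarrow> mat_ord_ge (int v * k) (eps_subst v M)"
  by (auto simp: mat_ord_ge_def eps_subst_def ord_ge_compose_power[OF v])

lemma det_eps_subst: "det (eps_subst v M) = fls_compose_power (det M) v"
  unfolding eps_subst_def by (rule h.hom_det)

lemma fls_subdegree_compose_power: "fls_subdegree (fls_compose_power f v) = int v * fls_subdegree f"
  for f :: "complex fls fls"
proof (cases "f = 0")
  case False
  show ?thesis
  proof (rule fls_subdegree_eqI)
    show "fls_nth (fls_compose_power f v) (int v * fls_subdegree f) \<noteq> 0"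
      using False v by (simp add: fls_nth_compose_power)
    show "fls_nth (fls_compose_power f v) k = 0" if "k < int v * fls_subdegree f" for k
      using ord_ge_compose_power[OF v, of "fls_subdegree f" f] that by (simp add: ord_ge_def)
  qed
qed simp

lemma compose_power_X_pow: "fls_compose_power (X_pow k) v = X_pow (int v * k)"
  by (simp add: X_pow_def v)

end

subsection \<open>Slopes\<close>

text \<open>The bound is -val / (n - i) >= h - (n - r) / n cleared of denominators. If it failed for
  all \<open>i\<close>, an adapted basis would make the determinants of the lattice sequence grow
  more slowly than they do.\<close>

lemma char_poly_slope_bound:
  assumes sys: "eps_system n M s \<sigma> p h A" and irr: "eps_irreducible n M h A" and h: "h > 0"
    and large: "h > int n - int (lead_rank n (A 0))"
  obtains i where "i < n" "coeff (char_poly M) i \<noteq> 0"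
    "int n * (- fls_subdegree (coeff (char_poly M) i)) \<ge>
      int (n - i) * (int n * h - (int n - int (lead_rank n (A 0))))"
proof (rule ccontr)
  assume contra: "\<not> thesis"
  have small': "\<not> (i < n \<and> coeff (char_poly M) i \<noteq> 0 \<and> int n * (- fls_subdegree (coeff (char_poly M) i)) \<ge>
      int (n - i) * (int n * h - (int n - int (lead_rank n (A 0)))))" for i
    using contra that by blast
  define r where "r = lead_rank n (A 0)"
  define d where "d = int n - int r"
  have M: "M \<in> KK_mat n" using sys by (simp add: eps_system_def)
  note Mc = KK_mat_carrier[OF M]
  have r_pos: "r > 0"
    using vec_space.rank_pos[OF lead_mat_carrier[OF Mc] eps_system_lead(2)[OF sys]]
      eps_system_lead(3)[OF sys] by (simp add: r_def)
  have r_le: "r \<le> n"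
    using vec_space.rank_le_nc[OF lead_mat_carrier[OF Mc, of h]] eps_system_lead(3)[OF sys] by
        (simp add: r_def)
  have n: "n > 0" using r_pos r_le by simp
  have hd: "h \<ge> d + 1" "d \<ge> 0" using large r_le by (simp_all add: d_def r_def)
  \<comment> \<open>A strict inequality between integers, sharpened by 1; this unit is the gap
    exploited below.\<close>
  have small: "int n * (- fls_subdegree (coeff (char_poly M) i)) \<le> int (n - i) * (int n * h - d) - 1"
    if "i < n" "coeff (char_poly M) i \<noteq> 0" for i
    using small'[of i] that unfolding d_def r_def by simp
  \<comment> \<open>With the next \<open>w\<close>, the quotient
    \<open>w / v = h - d / n - 1 / n^2\<close> lies strictly below the bound and still dominates all
    slopes, because the gap of 1, multiplied by \<open>n\<close>, is at least
    \<open>n - i\<close>.\<close>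
  define v where "v = n * n"
  have v: "v > 0" using n by (simp add: v_def)
  define w where "w = int n * (int n * h - d) - 1"
  define H where "H = int v * h"
  define X where "X = eps_subst v M"
  have X: "X \<in> carrier_mat n n" unfolding X_def by (rule eps_subst_carrier[OF Mc])
  have Xo: "mat_ord_ge (- H) X"
    using mat_ord_ge_eps_subst[OF v eps_system_lead(1)[OF sys]] by (simp add: X_def H_def)
  have Hw: "H - w = int n * d + 1" by (simp add: H_def w_def v_def algebra_simps)
  have "0 \<le> int n * d" using hd by simp
  then have wH: "w \<le> H" using Hw by linarith
  have nh: "int n * h \<ge> int n * (d + 1)" using hd by (intro mult_left_mono) auto
  have nn: "int n * int n \<ge> int n" using n by (simp add: mult_le_cancel_left)
  have w0: "w \<ge> 0"
  proof -
    have "int n * h - d \<ge> 1"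
      using nh hd n mult_right_mono[of 1 "int n" d] by (simp add: algebra_simps)
    then have "int n * (int n * h - d) \<ge> 1 * 1" using n by (intro mult_mono) auto
    then show ?thesis by (simp add: w_def)
  qed
  have chi: "ord_ge (- w * int (n - i)) (coeff (char_poly X) i)" if i: "i < n" for i
  proof (cases "coeff (char_poly M) i = 0")
    case True then show ?thesis unfolding X_def coeff_char_poly_eps_subst[OF v Mc] by simp
  next
    case False
    define e where "e = fls_subdegree (coeff (char_poly M) i)"
    have "int n * (int n * (- e)) \<le> int n * (int (n - i) * (int n * h - d) - 1)"
      using small[OF i False] unfolding e_def by (rule mult_left_mono) simp
    moreover have "int (n - i) \<le> int n" by simp
    ultimately have "- w * int (n - i) \<le> int v * e"
      unfolding w_def v_def by (simp add: algebra_simps)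
    moreover have "ord_ge (int v * e) (coeff (char_poly X) i)"
      unfolding X_def coeff_char_poly_eps_subst[OF v Mc] ord_ge_compose_power[OF v] e_def by simp
    ultimately show ?thesis using ord_ge_mono by blast
  qed
  obtain U V where UV: "inverse_mats n U V" and V0: "mat_ord_ge 0 V"
    and Uo: "mat_ord_ge (- (int n - 1) * (H - w)) U" and VXU: "mat_ord_ge (- w) (V * X * U)"
    using spectral_lattice[OF X Xo wH chi] .
  note u = inverse_mats_carrier[OF UV]
  define N where "N = gauge U X"
  have N: "N \<in> carrier_mat n n" unfolding N_def by (rule gauge_carrier[OF UV X])
  have "int n * (int n * h) \<ge> int n * (int n * (d + 1))" using nh by (rule mult_left_mono) simp
  then have "(int n - 1) * (H - w) \<le> w"
    unfolding Hw using nn by (simp add: w_def algebra_simps)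
  then have le: "- w \<le> 0 + - (int n - 1) * (H - w)" by (simp add: algebra_simps)
  have "mat_ord_ge (- w) (V * map_mat ddx U)"
    by (rule mat_ord_ge_mult[OF u(2) _ V0 mat_ord_ge_ddx[OF Uo] le]) (use u in auto)
  then have No: "mat_ord_ge (- w) N"
    unfolding N_def gauge_eq[OF UV] by (intro mat_ord_ge_diff[OF _ _ VXU]) (use u X in auto)
  obtain T Vs R where T0: "T 0 = 1\<^sub>m n" and TG: "\<And>k. T k \<in> GL_KK n"
    and sub: "\<And>k. fls_subdegree (det (T k)) = - int (k * r)"
    and Vc: "\<And>k. Vs k \<in> carrier_mat n n" and Rc: "\<And>k. R k \<in> carrier_mat n n"
    and Vso: "\<And>k. mat_ord_ge 0 (Vs k)" and Ro: "\<And>k. mat_ord_ge 0 (R k)"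
    and step: "\<And>k. T (Suc k) = X_pow (h - 1) \<cdot>\<^sub>m ((M * T k - map_mat ddx (T k)) * Vs k) + T k * R k"
    using gerard_levelt_sequence[OF sys irr h] unfolding r_def by metis
  have Tc: "T k \<in> carrier_mat n n" for k using TG[of k] by (auto simp: GL_KK_iff KK_mat_iff)
  define G where "G k = eps_subst v (T k)" for k
  define F where "F k = V * G k" for k
  have G: "G k \<in> carrier_mat n n" for k unfolding G_def by (rule eps_subst_carrier[OF Tc])
  have F: "F k \<in> carrier_mat n n" for k unfolding F_def using u(2) G by simp
  \<comment> \<open>The largest growth of the pole order per step in the adapted basis. As it equals
    \<open>n r - 1\<close>, the pole order of the determinant could grow by at most
    \<open>n (n r - 1)\<close> per step, against the actual \<open>n^2 r\<close>.\<close>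
  define \<delta> where "\<delta> = int n * int r - 1"
  have \<delta>0: "\<delta> \<ge> 0" using n r_pos by (simp add: \<delta>_def int_one_le_iff_zero_less flip: of_nat_mult)
  have \<delta>: "\<delta> = w - int v * (h - 1)" by (simp add: \<delta>_def w_def v_def d_def algebra_simps)
  have Fo: "mat_ord_ge (- (int k * \<delta>)) (F k)" for k
  proof (induction k)
    case 0
    then show ?case using u V0 by (simp add: F_def G_def T0 eps_subst_one[OF v])
  next
    case (Suc k)
    define B where "B = X * G k - map_mat ddx (G k)"
    have B: "B \<in> carrier_mat n n" unfolding B_def using G[of k] by (simp add: minus_carrier_mat)
    have GS: "G (Suc k) = X_pow (int v * (h - 1)) \<cdot>\<^sub>m (B * eps_subst v (Vs k)) + G k * eps_subst v (R k)"
    proof -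
      have b: "M * T k - map_mat ddx (T k) \<in> carrier_mat n n" using Tc by (simp add: minus_carrier_mat)
      have "eps_subst v (M * T k - map_mat ddx (T k)) = B"
        using Mc Tc[of k] unfolding B_def X_def G_def
        by (simp add: eps_subst_diff[OF v, of _ n n] eps_subst_mult[OF v, of _ n n _ n] eps_subst_ddx[OF v])
      then show ?thesis
        unfolding G_def step using b Vc[of k] Rc[of k] Tc[of k]
        by (simp add: eps_subst_add[OF v, of _ n n] eps_subst_mult[OF v, of _ n n _ n]
            eps_subst_smult[OF v] compose_power_X_pow[OF v])
    qed
    have GF: "G k = U * F k" unfolding F_def using inverse_mats_cancel(1)[OF UV G] by simp
    \<comment> \<open>The connection v -> X v - v' written in the basis \<open>U\<close>, where its
      matrix is \<open>N\<close>.\<close>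
    have VB: "V * B = N * F k - map_mat ddx (F k)"
    proof -
      have "B = X * U * F k - (map_mat ddx U * F k + U * map_mat ddx (F k))"
        unfolding B_def GF map_mat_ddx_mult[OF u(1) F] using X u F[of k] by simp
      also have "\<dots> = (X * U - map_mat ddx U) * F k - U * map_mat ddx (F k)"
        using X u F[of k] by (subst minus_mult_distrib_mat[of _ n n _ _ n]) (auto intro!: eq_matI)
      also have "X * U - map_mat ddx U = U * N" unfolding N_def by (rule mult_gauge[OF UV X, symmetric])
      also have "U * N * F k - U * map_mat ddx (F k) = U * (N * F k - map_mat ddx (F k))"
        using u N F[of k] by (subst mult_minus_distrib_mat[of _ n n _ n]) auto
      finally show ?thesis
        using inverse_mats_cancel(2)[OF UV, of "N * F k - map_mat ddx (F k)" n] N F[of k]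
        by (simp add: minus_carrier_mat)
    qed
    have 1: "mat_ord_ge (- w - int k * \<delta>) (V * B)"
      unfolding VB
    proof (rule mat_ord_ge_diff)
      show "mat_ord_ge (- w - int k * \<delta>) (N * F k)" by (rule mat_ord_ge_mult[OF N F No Suc]) simp
      show "mat_ord_ge (- w - int k * \<delta>) (map_mat ddx (F k))"
        by (rule mat_ord_ge_mono[OF mat_ord_ge_ddx[OF Suc]]) (use w0 in simp)
    qed (use N F[of k] in auto)
    have sc: "eps_subst v (Vs k) \<in> carrier_mat n n" "eps_subst v (R k) \<in> carrier_mat n n"
      using Vc Rc by (auto intro: eps_subst_carrier)
    have so: "mat_ord_ge 0 (eps_subst v (Vs k))" "mat_ord_ge 0 (eps_subst v (R k))"
      using mat_ord_ge_eps_subst[OF v Vso[of k]] mat_ord_ge_eps_subst[OF v Ro[of k]] by simp_all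
    have "F (Suc k) = X_pow (int v * (h - 1)) \<cdot>\<^sub>m (V * B * eps_subst v (Vs k)) + F k * eps_subst v (R k)"
      unfolding F_def[of "Suc k"] GS using u B sc G[of k]
      by (subst mult_add_distrib_mat[of _ n n _ n]) (auto simp: F_def mult_smult_distrib[of _ n n _ n])
    moreover have
        "mat_ord_ge (- (int (Suc k) * \<delta>)) (X_pow (int v * (h - 1)) \<cdot>\<^sub>m (V * B * eps_subst v (Vs k)))"
    proof (rule mat_ord_ge_smult[OF _ ord_ge_X_pow[OF order_refl]])
      show "mat_ord_ge (- w - int k * \<delta>) (V * B * eps_subst v (Vs k))"
        by (rule mat_ord_ge_mult[OF _ sc(1) 1 so(1)]) (use u B in auto)
      show "- (int (Suc k) * \<delta>) \<le> int v * (h - 1) + (- w - int k * \<delta>)" by (simp add: \<delta> algebra_simps)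
    qed
    moreover have "mat_ord_ge (- (int (Suc k) * \<delta>)) (F k * eps_subst v (R k))"
      by (rule mat_ord_ge_mult[OF F sc(2) Suc so(2)]) (use \<delta>0 in \<open>simp add: algebra_simps\<close>)
    ultimately show ?case
      using u B sc F[of k] by (auto intro!: mat_ord_ge_add[of _ n n])
  qed
  define sV where "sV = fls_subdegree (det V)"
  have dV: "det V \<noteq> 0" using inverse_mats_det[OF UV] by auto
  \<comment> \<open>The deficit of \<open>n\<close> per step overtakes the fixed order of
    \<open>det V\<close> after this many steps.\<close>
  define k where "k = nat \<bar>sV\<bar> + 1"
  have dT: "det (T k) \<noteq> 0" using TG[of k] by (simp add: GL_KK_iff)
  have "ord_ge (int n * (- (int k * \<delta>))) (det (F k))" by (rule ord_ge_det[OF F Fo])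
  moreover have "det (F k) = det V * fls_compose_power (det (T k)) v"
    unfolding F_def G_def det_mult[OF u(2) eps_subst_carrier[OF Tc]] det_eps_subst[OF v] ..
  moreover have "fls_compose_power (det (T k)) v \<noteq> 0"
  proof
    assume "fls_compose_power (det (T k)) v = 0"
    then have "fls_nth (fls_compose_power (det (T k)) v) (int v * fls_subdegree (det (T k))) = 0" by simp
    then show False using v dT by (simp add: fls_nth_compose_power)
  qed
  ultimately have "int n * (- (int k * \<delta>)) \<le> sV + int v * (- int (k * r))"
    using dV by (auto simp: ord_ge_iff fls_subdegree_mult fls_subdegree_compose_power[OF v] sub sV_def)
  then have "int n * int k \<le> sV" by (simp add: \<delta>_def v_def algebra_simps)
  moreover have "int k \<le> int n * int k" using n mult_right_mono[of 1 "int n" "int k"] by simp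
  ultimately show False by (simp add: k_def)
qed

text \<open>The largest slope of the Newton polygon is \<open>w / v\<close>; substituting \<open>eps^v\<close> for \<open>eps\<close> makes it the
  integer \<open>w\<close>.\<close>

definition max_slope :: "nat \<Rightarrow> nat \<Rightarrow> int \<Rightarrow> (nat \<Rightarrow> complex fls fls) \<Rightarrow> bool" where
  "max_slope n v w b \<longleftrightarrow>
     (\<forall>i<n. ord_ge (- w * int (n - i)) (fls_compose_power (b i) v)) \<and>
     (\<exists>i<n. fls_nth (fls_compose_power (b i) v) (- w * int (n - i)) \<noteq> 0)"

section \<open>Slopes and edges after ramification\<close>

lemma ord_ge_compose_power_iff:
  fixes f :: "complex fls fls"
  assumes v: "v > 0"
  shows "ord_ge k (fls_compose_power f v) \<longleftrightarrow> f = 0 \<or> k \<le> int v * fls_subdegree f"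
proof (cases "f = 0")
  case False
  then have "fls_compose_power f v \<noteq> 0"
    using ord_ge_compose_power[OF v, of "fls_subdegree f + 1" f] by (auto simp: ord_ge_iff)
  then show ?thesis using False by (simp add: ord_ge_iff fls_subdegree_compose_power[OF v])
qed simp

lemma nth_compose_power_nonzero_iff:
  fixes f :: "complex fls fls"
  assumes v: "v > 0" and o: "ord_ge k (fls_compose_power f v)"
  shows "fls_nth (fls_compose_power f v) k \<noteq> 0 \<longleftrightarrow> f \<noteq> 0 \<and> k = int v * fls_subdegree f"
proof
  assume nz: "fls_nth (fls_compose_power f v) k \<noteq> 0"
  then have f: "f \<noteq> 0" by auto
  have "\<not> k < int v * fls_subdegree f"
    using nz ord_ge_compose_power[OF v, of "fls_subdegree f" f] by (auto simp: ord_ge_def)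
  then show "f \<noteq> 0 \<and> k = int v * fls_subdegree f"
    using f o unfolding ord_ge_compose_power_iff[OF v] by simp
qed (use v in \<open>simp add: fls_nth_compose_power\<close>)

text \<open>The slopes have denominators dividing some \<open>n - i\<close> with
  \<open>i < n\<close>, and all of these divide \<open>fact n\<close>.\<close>

lemma max_slope_exists:
  assumes ex: "\<exists>i<n. b i \<noteq> 0"
  obtains w where "max_slope n (fact n) w b"
    "\<And>i. i < n \<Longrightarrow> b i \<noteq> 0 \<Longrightarrow> - int (fact n) * fls_subdegree (b i) \<le> w * int (n - i)"
proof -
  define q where "q i = int (fact n div (n - i)) * (- fls_subdegree (b i))" for i
  have fq: "int (fact n) * (- fls_subdegree (b i)) = q i * int (n - i)" if "i < n" for i
  proof -
    have "n - i dvd fact n" using that by (intro dvd_fact) auto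
    then have "int (fact n div (n - i)) * int (n - i) = int (fact n)"
      by (simp only: dvd_div_mult_self flip: of_nat_mult)
    then show ?thesis unfolding q_def by (metis mult.assoc mult.commute)
  qed
  define I where "I = {i. i < n \<and> b i \<noteq> 0}"
  have I: "finite I" "I \<noteq> {}" using ex by (auto simp: I_def)
  define w where "w = Max (q ` I)"
  have le: "q i \<le> w" if "i \<in> I" for i unfolding w_def using I that by simp
  obtain i where i: "i \<in> I" "q i = w" using Max_in[of "q ` I"] I unfolding w_def by fastforce
  have v: "(fact n :: nat) > 0" by simp
  have bnd: "- int (fact n) * fls_subdegree (b i) \<le> w * int (n - i)" if "i < n" "b i \<noteq> 0" for i
  proof -
    have "q i * int (n - i) \<le> w * int (n - i)" using le[of i] that by (intro mult_right_mono)
        (auto simp: I_def)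
    then show ?thesis using fq[OF that(1)] by simp
  qed
  have o: "ord_ge (- w * int (n - i)) (fls_compose_power (b i) (fact n))" if "i < n" for i
  proof (cases "b i = 0")
    case False
    then have "- w * int (n - i) \<le> int (fact n) * fls_subdegree (b i)" using bnd[OF that] by simp
    then show ?thesis unfolding ord_ge_compose_power_iff[OF v] by simp
  qed simp
  have "i < n" "b i \<noteq> 0" using i by (auto simp: I_def)
  moreover have "- w * int (n - i) = int (fact n) * fls_subdegree (b i)"
    using fq[OF \<open>i < n\<close>] i(2) by simp
  ultimately have "fls_nth (fls_compose_power (b i) (fact n)) (- w * int (n - i)) \<noteq> 0"
    using nth_compose_power_nonzero_iff[OF v o] by blast
  then have "max_slope n (fact n) w b" unfolding max_slope_def using o \<open>i < n\<close> by blast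
  then show ?thesis using that bnd by blast
qed

lemma Max_slopes:
  assumes v: "v > 0" and s: "max_slope n v w b"
  shows "Max ((\<lambda>i. (- val (b i)) / ereal (real (n - i))) ` {..<n}) = ereal (of_int w / real v)"
proof (rule Max_eqI)
  have slope: "(- val (b i)) / ereal (real (n - i)) = ereal (- of_int (fls_subdegree (b i)) / real (n - i))"
    if "b i \<noteq> 0" "i < n" for i
    using that by (simp add: val_def)
  show "y \<le> ereal (of_int w / real v)" if y: "y \<in> (\<lambda>i. (- val (b i)) / ereal (real (n - i))) ` {..<n}" for y
  proof -
    obtain i where i: "i < n" "y = (- val (b i)) / ereal (real (n - i))" using y by auto
    show ?thesis
    proof (cases "b i = 0")
      \<comment> \<open>A vanishing coefficient has slope minus infinity.\<close>
      case True
      then show ?thesis using i by (simp add: val_def)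
    next
      case False
      have "ord_ge (- w * int (n - i)) (fls_compose_power (b i) v)" using s i(1) by
          (simp add: max_slope_def)
      then have "- w * int (n - i) \<le> int v * fls_subdegree (b i)"
        using False unfolding ord_ge_compose_power_iff[OF v] by simp
      then have "real_of_int (- w * int (n - i)) \<le> real_of_int (int v * fls_subdegree (b i))"
        by (simp only: of_int_le_iff)
      then have "- of_int (fls_subdegree (b i)) / real (n - i) \<le> of_int w / real v"
        using i(1) v by (simp add: field_simps)
      then show ?thesis unfolding i(2) slope[OF False i(1)] by simp
    qed
  qed
  obtain i where i: "i < n" "fls_nth (fls_compose_power (b i) v) (- w * int (n - i)) \<noteq> 0"
    using s by (auto simp: max_slope_def)
  have "ord_ge (- w * int (n - i)) (fls_compose_power (b i) v)" using s i(1) by (simp add: max_slope_def)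
  then have bi: "b i \<noteq> 0" "- w * int (n - i) = int v * fls_subdegree (b i)"
    using nth_compose_power_nonzero_iff[OF v] i(2) by blast+
  then have "real_of_int (- w * int (n - i)) = real_of_int (int v * fls_subdegree (b i))"
    by simp
  then have "- of_int (fls_subdegree (b i)) / real (n - i) = of_int w / real v"
    using i(1) v by (simp add: field_simps)
  then show "ereal (of_int w / real v) \<in> (\<lambda>i. (- val (b i)) / ereal (real (n - i))) ` {..<n}"
    using slope[OF bi(1) i(1)] i(1) by (intro image_eqI[of _ _ i]) simp_all
qed simp

text \<open>The edge is read off from the nonvanishing of the coefficients of weight
  \<open>w\<close>; hence two equations that agree in weight \<open>w\<close> have the same
  edge.\<close>

lemma edge_indices_eq:
  assumes v: "v > 0" and s: "max_slope n v w b" and bn: "b n = 1"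
  shows "edge_indices n (ereal (of_int w / real v)) b =
    {i. i \<le> n \<and> fls_nth (fls_compose_power (b i) v) (- w * int (n - i)) \<noteq> 0}"
  unfolding edge_indices_def
proof (intro Collect_cong conj_cong refl)
  fix i assume i: "i \<le> n"
  have o: "ord_ge (- w * int (n - i)) (fls_compose_power (b i) v)"
    using s i bn v by (cases "i = n") (auto simp: max_slope_def)
  have "ereal (of_int w / real v) * ereal (real (n - i)) = - val (b i) \<longleftrightarrow>
      b i \<noteq> 0 \<and> of_int w / real v * real (n - i) = - real_of_int (fls_subdegree (b i))"
    by (simp add: val_def)
  also have "\<dots> \<longleftrightarrow> b i \<noteq> 0 \<and> real_of_int (- w * int (n - i)) = real_of_int (int v * fls_subdegree (b i))"
    using v by (auto simp: field_simps)
  also have "\<dots> \<longleftrightarrow> fls_nth (fls_compose_power (b i) v) (- w * int (n - i)) \<noteq> 0"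
    unfolding nth_compose_power_nonzero_iff[OF v o] of_int_eq_iff ..
  finally show "(ereal (of_int w / real v) * ereal (real (n - i)) = - val (b i)) =
    (fls_nth (fls_compose_power (b i) v) (- w * int (n - i)) \<noteq> 0)" .
qed

lemma nth_subdegree_edge:
  assumes v: "v > 0" and s: "max_slope n v w b" and bn: "b n = 1"
    and i: "i \<le> n" "fls_nth (fls_compose_power (b i) v) (- w * int (n - i)) \<noteq> 0"
  shows "fls_nth (b i) (fls_subdegree (b i)) = fls_nth (fls_compose_power (b i) v) (- w * int (n - i))"
proof -
  have o: "ord_ge (- w * int (n - i)) (fls_compose_power (b i) v)"
    using s i bn v by (cases "i = n") (auto simp: max_slope_def)
  then have "- w * int (n - i) = int v * fls_subdegree (b i)"
    using nth_compose_power_nonzero_iff[OF v o] i(2) by blast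
  then show ?thesis using v by (simp add: fls_nth_compose_power)
qed

text \<open>Conjugation by the diagonal of the \<open>eps^(-w i)\<close> turns the entries 1 into
  \<open>eps^(-w)\<close> and multiplies entry \<open>j\<close> of the last row by
  \<open>eps^(w (n - 1 - j))\<close>, which the hypothesis balances. \<open>D\<close> is constant
  for \<open>ddx\<close>, so no logarithmic derivative arises.\<close>

lemma companion_lattice:
  assumes v: "v > 0" and o: "\<And>i. i < n \<Longrightarrow> ord_ge (- w * int (n - i)) (fls_compose_power (a i) v)"
  obtains D D' where "inverse_mats n D D'" "map_mat ddx D = 0\<^sub>m n n"
    "mat_ord_ge (- w) (D' * eps_subst v (companion n a) * D)"
proof -
  define D :: "complex fls fls mat" where "D = mat n n (\<lambda>(i, j). if i = j then X_pow (- w * int i) else 0)"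
  define D' :: "complex fls fls mat" where "D' = mat n n (\<lambda>(i, j). if i = j then X_pow (w * int i) else 0)"
  define C where "C = eps_subst v (companion n a)"
  have C: "C \<in> carrier_mat n n" unfolding C_def by (rule eps_subst_carrier) (simp add: companion_def)
  have Dc: "D \<in> carrier_mat n n" and Dd: "\<And>i j. i < n \<Longrightarrow> j < n \<Longrightarrow> i \<noteq> j \<Longrightarrow> D $$ (i, j) = 0"
    by (simp_all add: D_def)
  have D'c: "D' \<in> carrier_mat n n" and D'd: "\<And>i j. i < n \<Longrightarrow> j < n \<Longrightarrow> i \<noteq> j \<Longrightarrow> D' $$ (i, j) = 0"
    by (simp_all add: D'_def)
  have "D' = mat n n (\<lambda>(i, j). if i = j then inverse (D $$ (i, i)) else 0)"
    by (rule eq_matI) (auto simp: D_def D'_def X_pow_minus[symmetric])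
  then have I: "inverse_mats n D D'" using inverse_diagonal[OF Dc Dd] by (simp add: D_def)
  have d: "map_mat ddx D = 0\<^sub>m n n" by (rule eq_matI) (auto simp: D_def)
  have "mat_ord_ge (- w) (D' * C * D)"
  proof (rule mat_ord_geI[of _ n n])
    show "D' * C * D \<in> carrier_mat n n" using D'c C Dc by (meson mult_carrier_mat)
    fix i j assume ij: "i < n" "j < n"
    have "(D' * C * D) $$ (i, j) = X_pow (w * int i) * C $$ (i, j) * X_pow (- w * int j)"
      using mult_diagonal_mat[OF Dc Dd mult_carrier_mat[OF D'c C] ij] diagonal_mult_mat[OF D'c D'd C ij] ij
      by (simp add: D_def D'_def del: mult_minus_left)
    also have "\<dots> = X_pow (w * int i - w * int j) * C $$ (i, j)"
      by (simp add: ac_simps flip: X_pow_add)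
    finally have eq: "(D' * C * D) $$ (i, j) = X_pow (w * int i - w * int j) * C $$ (i, j)" .
    have Cij: "C $$ (i, j) = (if Suc i < n then (if j
        = Suc i then 1 else 0) else - fls_compose_power (a j) v)"
      using ij v by (auto simp: C_def eps_subst_def companion_def)
    show "ord_ge (- w) ((D' * C * D) $$ (i, j))"
    proof (cases "Suc i < n")
      case True
      then show ?thesis unfolding eq Cij by (auto simp: ord_ge_X_pow_mult ord_ge_X_pow algebra_simps)
    next
      case False
      then have n: "n = Suc i" using ij by simp
      have nj: "int (n - j) = int i - int j + 1" using n ij by (simp add: of_nat_diff)
      have "- w - (w * int i - w * int j) = - w * int (n - j)" unfolding nj by (simp add: algebra_simps)
      then show ?thesis unfolding eq Cij ord_ge_X_pow_mult using False o[OF ij(2)]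
        by (auto intro!: ord_ge_uminus)
    qed
  qed
  then show ?thesis using that[OF I d] by (simp add: C_def)
qed

text \<open>\<open>M\<close> is replaced by \<open>Z\<close>, its form of pole order
  \<open>w\<close> in the adapted basis, and the companion matrix by its diagonal conjugate. These
  are equivalent, so their coefficients of weight \<open>w\<close> agree; the same comparison in a
  larger weight excludes steeper slopes of \<open>a\<close>.\<close>

lemma scalar_equation_max_slope:
  assumes sys: "eps_system n M s \<sigma> p h A" and irr: "eps_irreducible n M h A" and h: "h > 0"
    and large: "h > int n - int (lead_rank n (A 0))"
  obtains v w where "v > 0" "w > 0" "max_slope n v w (\<lambda>i. coeff (char_poly M) i)"
    "\<And>a. scalar_equation_of n M a \<Longrightarrow> max_slope n v w a \<and>
      (\<forall>i\<le>n. fls_nth (fls_compose_power (a i) v) (- w * int (n - i)) =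
        fls_nth (fls_compose_power (coeff (char_poly M) i) v) (- w * int (n - i)))"
proof -
  define \<alpha> where "\<alpha> i = coeff (char_poly M) i" for i
  define r where "r = lead_rank n (A 0)"
  have M: "M \<in> KK_mat n" using sys by (simp add: eps_system_def)
  note Mc = KK_mat_carrier[OF M]
  have r_pos: "r > 0"
    using vec_space.rank_pos[OF lead_mat_carrier[OF Mc] eps_system_lead(2)[OF sys]]
      eps_system_lead(3)[OF sys] by (simp add: r_def)
  define v where "v = (fact n :: nat)"
  have v: "v > 0" by (simp add: v_def)
  obtain i0 where i0: "i0 < n" "\<alpha> i0 \<noteq> 0"
    "int n * (- fls_subdegree (\<alpha> i0)) \<ge> int (n - i0) * (int n * h - (int n - int r))"
    using char_poly_slope_bound[OF sys irr h large] unfolding \<alpha>_def r_def by metis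
  have n: "n > 0" using i0 by simp
  obtain w where w: "max_slope n v w \<alpha>"
    and wb: "\<And>i. i < n \<Longrightarrow> \<alpha> i \<noteq> 0 \<Longrightarrow> - int v * fls_subdegree (\<alpha> i) \<le> w * int (n - i)"
    using max_slope_exists[of n \<alpha>] i0 unfolding v_def by blast
  have nw: "int n * w \<ge> int v * (int n * h - (int n - int r))"
  proof -
    have "int (n - i0) * (int v * (int n * h - (int n - int r)))
        \<le> int v * (int n * (- fls_subdegree (\<alpha> i0)))"
      using mult_left_mono[OF i0(3), of "int v"] by (simp add: ac_simps)
    also have "\<dots> = int n * (- int v * fls_subdegree (\<alpha> i0))" by simp
    also have "\<dots> \<le> int n * (w * int (n - i0))" using wb[OF i0(1,2)] by (rule mult_left_mono) simp
    finally have "int (n - i0) * (int v * (int n * h - (int n - int r))) \<le> int (n - i0) * (int n * w)"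
      by (simp add: ac_simps)
    then show ?thesis using i0(1) by (simp add: mult_le_cancel_left)
  qed
  define H where "H = int v * h"
  define X where "X = eps_subst v M"
  have X: "X \<in> carrier_mat n n" unfolding X_def by (rule eps_subst_carrier[OF Mc])
  have Xo: "mat_ord_ge (- H) X"
    using mat_ord_ge_eps_subst[OF v eps_system_lead(1)[OF sys]] by (simp add: X_def H_def)
  have coeffX: "coeff (char_poly X) i = fls_compose_power (\<alpha> i) v" for i
    unfolding X_def \<alpha>_def by (rule coeff_char_poly_eps_subst[OF v Mc])
  \<comment> \<open>A slope of the characteristic polynomial cannot exceed the pole order of the
    matrix.\<close>
  have wH: "w \<le> H"
  proof -
    obtain i where i: "i < n" "fls_nth (coeff (char_poly X) i) (- w * int (n - i)) \<noteq> 0"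
      using w unfolding max_slope_def coeffX by blast
    have "ord_ge (- H * int (n - i)) (coeff (char_poly X) i)"
      by (rule char_poly_lead(1)[OF X Xo]) (use i in simp)
    then have "\<not> - w * int (n - i) < - H * int (n - i)" using i(2) ord_geD by blast
    then show ?thesis using i(1) by (simp add: mult_less_cancel_right)
  qed
  \<comment> \<open>Equivalently \<open>n w > (n - 1) H\<close>, from the slope bound and
    \<open>h > n - r\<close>. Strictness gives the derivative term order \<open>1 - w\<close>, so
    that it misses the coefficients of weight \<open>w\<close>.\<close>
  have strict: "(int n - 1) * (H - w) < w"
  proof -
    have "int v * (int n * h - (int n - int r)) > int v * (int n * h - h)"
      using large v by (intro mult_strict_left_mono) (simp_all add: r_def)
    then have "int n * w > int v * (int n * h - h)" using nw by linarith
    then show ?thesis by (simp add: H_def algebra_simps)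
  qed
  have "0 \<le> (int n - 1) * (H - w)" using n wH by (intro mult_nonneg_nonneg) auto
  then have w1: "w \<ge> 1" using strict by linarith
  have chi: "ord_ge (- w * int (n - i)) (coeff (char_poly X) i)" if "i < n" for i
    unfolding coeffX using w that by (simp add: max_slope_def)
  obtain U V where UV: "inverse_mats n U V" and V0: "mat_ord_ge 0 V"
    and Uo: "mat_ord_ge (- (int n - 1) * (H - w)) U" and VXU: "mat_ord_ge (- w) (V * X * U)"
    using spectral_lattice[OF X Xo wH chi] .
  note u = inverse_mats_carrier[OF UV]
  have le: "1 - w \<le> 0 + - (int n - 1) * (H - w)" using strict by (simp add: algebra_simps)
  have dU: "mat_ord_ge (1 - w) (V * map_mat ddx U)"
    by (rule mat_ord_ge_mult[OF u(2) _ V0 mat_ord_ge_ddx[OF Uo] le]) (use u in auto)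
  define Z where "Z = gauge U X"
  have Z: "Z \<in> carrier_mat n n" unfolding Z_def by (rule gauge_carrier[OF UV X])
  have Zo: "mat_ord_ge (- w) Z" and Zc: "\<And>i. i \<le> n \<Longrightarrow> fls_nth (coeff (char_poly Z) i) (- w * int (n - i)) =
      fls_nth (fls_compose_power (\<alpha> i) v) (- w * int (n - i))"
    unfolding Z_def coeffX[symmetric] using gauge_char_poly_lead[OF UV X dU VXU] by blast+
  have main: "max_slope n v w a \<and> (\<forall>i\<le>n. fls_nth (fls_compose_power (a i) v) (- w * int (n - i)) =
      fls_nth (fls_compose_power (\<alpha> i) v) (- w * int (n - i)))"
    if a: "scalar_equation_of n M a" for a
  proof -
    have an: "a n = 1" using a by (simp add: scalar_equation_of_def)
    obtain T where T: "T \<in> GL_KK n" "companion n a = gauge T M" using a by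
        (auto simp: scalar_equation_of_def)
    obtain S where S: "inverse_mats n T S" using GL_KK_inverse[OF T(1)] by metis
    define C where "C = eps_subst v (companion n a)"
    have compc: "companion n a \<in> carrier_mat n n" by (simp add: companion_def)
    have C: "C \<in> carrier_mat n n" unfolding C_def by (rule eps_subst_carrier[OF compc])
    have coeffC: "coeff (char_poly C) i = fls_compose_power (a i) v" if "i \<le> n" for i
    proof (cases "i = n")
      case True
      have "coeff (char_poly (companion n a)) n = 1" using degree_monic_char_poly[OF compc] by simp
      then show ?thesis unfolding C_def coeff_char_poly_eps_subst[OF v compc] using True an by simp
    next
      case False
      then show ?thesis unfolding C_def coeff_char_poly_eps_subst[OF v compc]
        using that coeff_char_poly_companion[of i n a] by simp
    qed
    have CX: "C = gauge (eps_subst v T) X"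
      unfolding C_def X_def T(2) by (rule gauge_eps_subst[OF v S Mc, symmetric])
    have Tv: "inverse_mats n (eps_subst v T) (eps_subst v S)" by (rule inverse_mats_eps_subst[OF v S])
    \<comment> \<open>The weight \<open>w'\<close> is a parameter because the slopes of
      \<open>a\<close> are not yet known to be at most \<open>w\<close>.\<close>
    have compare: "fls_nth (fls_compose_power (a i) v) (- w' * int (n - i))
        = fls_nth (coeff (char_poly Z) i) (- w' * int (n - i))"
      if w': "w \<le> w'" and o: "\<And>i. i < n \<Longrightarrow> ord_ge (- w' * int (n - i)) (fls_compose_power (a i) v)"
          and i: "i \<le> n" for w' i
    proof -
      obtain D D' where D: "inverse_mats n D D'" "map_mat ddx D = 0\<^sub>m n n" "mat_ord_ge (- w') (D' * C * D)"
        using companion_lattice[OF v o] unfolding C_def by metis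
      note d = inverse_mats_carrier[OF D(1)]
      have z: "mat_ord_ge (1 - w') (D' * map_mat ddx D)"
        unfolding D(2) right_mult_zero_mat[OF d(2)] by (simp add: mat_ord_ge_def)
      note Yl = gauge_char_poly_lead[OF D(1) C z D(3) i]
      have TD: "inverse_mats n (eps_subst v T * D) (D' * eps_subst v S)"
        by (rule inverse_mats_mult[OF Tv D(1)])
      have "gauge V Z = X" unfolding Z_def by (rule gauge_inverse[OF UV X])
      then have YZ: "gauge (V * (eps_subst v T * D)) Z = gauge D C"
        using gauge_mult[OF inverse_mats_sym[OF UV] TD Z] gauge_mult[OF Tv D(1) X] CX by simp
      have Zo': "mat_ord_ge (- w') Z" by (rule mat_ord_ge_mono[OF Zo]) (use w' in simp)
      have "fls_nth (coeff (char_poly (gauge D C)) i) (- w' * int (n - i)) =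
          fls_nth (coeff (char_poly Z) i) (- w' * int (n - i))"
        using gauge_invariant_lead[OF Z Zo' inverse_mats_mult[OF inverse_mats_sym[OF UV] TD] _ _ i]
          Yl(1) w1 w' unfolding YZ by simp
      then show ?thesis using Yl(2) coeffC[OF i] by simp
    qed
    \<comment> \<open>At a steepest slope \<open>w' > w\<close> of \<open>a\<close> some coefficient
      of weight \<open>w'\<close> would be nonzero, while those of \<open>Z\<close> vanish since its
      pole order is at most \<open>w\<close>.\<close>
    have o: "ord_ge (- w * int (n - i)) (fls_compose_power (a i) v)" if i: "i < n" for i
    proof (rule ccontr)
      assume neg: "\<not> ord_ge (- w * int (n - i)) (fls_compose_power (a i) v)"
      then have "a i \<noteq> 0" by auto
      then obtain w' where w': "max_slope n v w' a"
        using max_slope_exists[of n a] i unfolding v_def by blast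
      have "w < w'"
      proof (rule ccontr)
        assume "\<not> w < w'"
        then have "- w * int (n - i) \<le> - w' * int (n - i)" by (simp add: mult_right_mono)
        then show False using w' neg i ord_ge_mono unfolding max_slope_def by blast
      qed
      obtain j where j: "j < n" "fls_nth (fls_compose_power (a j) v) (- w' * int (n - j)) \<noteq> 0"
        using w' by (auto simp: max_slope_def)
      have "fls_nth (fls_compose_power (a j) v) (- w' * int (n - j))
          = fls_nth (coeff (char_poly Z) j) (- w' * int (n - j))"
        by (rule compare) (use \<open>w < w'\<close> w' j in \<open>auto simp: max_slope_def\<close>)
      also have "\<dots> = 0"
      proof (rule ord_geD[OF char_poly_lead(1)[OF Z Zo]])
        show "- w' * int (n - j) < - w * int (n - j)" using \<open>w < w'\<close> j by simp
      qed (use j in simp)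
      finally show False using j by simp
    qed
    have eq: "fls_nth (fls_compose_power (a i) v) (- w * int (n - i))
        = fls_nth (fls_compose_power (\<alpha> i) v) (- w * int (n - i))"
      if "i \<le> n" for i
      using compare[OF order_refl o that] Zc[OF that] by simp
    obtain j where "j < n" "fls_nth (fls_compose_power (\<alpha> j) v) (- w * int (n - j)) \<noteq> 0"
      using w by (auto simp: max_slope_def)
    then have "max_slope n v w a" unfolding max_slope_def using o eq[of j] by auto
    then show ?thesis using eq by blast
  qed
  show ?thesis
    by (rule that[OF v _ _ main[unfolded \<alpha>_def]]) (use w1 w in \<open>simp_all add: \<alpha>_def[abs_def]\<close>)
qed

lemma scalar_exp_order_eq:
  assumes v: "v > 0" and w: "w > 0" and s: "max_slope n v w a"
  shows "scalar_exp_order n a = ereal (of_int w / real v)"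
proof -
  let ?S = "(\<lambda>i. (- val (a i)) / ereal (real (n - i))) ` {..<n}"
  have "?S \<noteq> {}" using s by (auto simp: max_slope_def)
  then have "scalar_exp_order n a = max 0 (Max ?S)" unfolding scalar_exp_order_def
      by (intro Max_insert) auto
  then show ?thesis unfolding Max_slopes[OF v s] using v w by (simp add: max_def)
qed

theorem theorem3:
  fixes n s :: nat and M :: "complex fls fls mat" and \<sigma> p :: rat and h :: int
    and A :: "nat \<Rightarrow> complex fps mat"
    and \<alpha> :: "nat \<Rightarrow> complex fls fls"
    and c :: "nat \<Rightarrow> int \<Rightarrow> complex fls"
  assumes sys: "eps_system n M s \<sigma> p h A"
    and irr: "eps_irreducible n M h A"
    and h_pos: "h > 0"
    and char: "\<And>i. \<alpha> i = Polynomial.coeff (char_poly M) i"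
    and expand: "\<And>i. i \<le> n \<Longrightarrow> ram s (\<alpha> i) = xi_series s \<sigma> (c i)"
    and start: "\<And>i j. i \<le> n \<Longrightarrow> ereal (of_int j) < val (\<alpha> i) \<Longrightarrow> c i j = 0"
    and h_large: "h > int n - int (lead_rank n (A 0))"
  shows "exp_order n M = Max ((\<lambda>i. (- val (\<alpha> i)) / ereal (real (n - i))) ` {..<n}) \<and>
    map_poly (ram_x s) (eps_poly n M) =
      (let I = edge_indices n (exp_order n M) \<alpha>
       in \<Sum>i\<in>I. Polynomial.monom
            (xpow s (\<sigma> * of_int (fls_subdegree (\<alpha> i))) * c i (fls_subdegree (\<alpha> i)))
            (i - Min I))"
proof -
  have M: "M \<in> KK_mat n" and s: "s > 0" and s\<sigma>: "of_nat s * \<sigma> \<in> \<int>"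
    using sys by (auto simp: eps_system_def)
  note Mc = KK_mat_carrier[OF M]
  have \<alpha>: "\<alpha> = (\<lambda>i. coeff (char_poly M) i)" using char by auto
  have \<alpha>n: "\<alpha> n = 1" unfolding \<alpha> using degree_monic_char_poly[OF Mc] by simp
  obtain v w where v: "v > 0" and w: "w > 0" and sl: "max_slope n v w \<alpha>"
    and main: "\<And>a. scalar_equation_of n M a \<Longrightarrow> max_slope n v w a \<and>
      (\<forall>i\<le>n. fls_nth (fls_compose_power (a i) v) (- w * int (n - i)) =
        fls_nth (fls_compose_power (\<alpha> i) v) (- w * int (n - i)))"
    using scalar_equation_max_slope[OF sys irr h_pos h_large] unfolding \<alpha> by metis
  define \<omega> where "\<omega> = ereal (of_int w / real v)"
  define I where "I = edge_indices n \<omega> \<alpha>"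
  define E where "E = (\<Sum>i\<in>I. Polynomial.monom (fls_nth (\<alpha> i) (fls_subdegree (\<alpha> i))) (i - Min I))"
  have n: "n > 0" using sl by (auto simp: max_slope_def)
  have I_eq: "I = {i. i \<le> n \<and> fls_nth (fls_compose_power (\<alpha> i) v) (- w * int (n - i)) \<noteq> 0}"
    unfolding I_def \<omega>_def by (rule edge_indices_eq[OF v sl \<alpha>n])
  have eq: "scalar_exp_order n a = \<omega>" "scalar_eps_poly n a = E" if a: "scalar_equation_of n M a" for a
  proof -
    have an: "a n = 1" using a by (simp add: scalar_equation_of_def)
    have sla: "max_slope n v w a"
      and nth: "\<And>i. i \<le> n \<Longrightarrow> fls_nth (fls_compose_power (a i) v) (- w * int (n - i)) =
        fls_nth (fls_compose_power (\<alpha> i) v) (- w * int (n - i))"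
      using main[OF a] by auto
    show o: "scalar_exp_order n a = \<omega>" unfolding \<omega>_def by (rule scalar_exp_order_eq[OF v w sla])
    have "edge_indices n \<omega> a = I"
      unfolding I_eq \<omega>_def edge_indices_eq[OF v sla an] using nth by auto
    moreover have "fls_nth (a i) (fls_subdegree (a i)) = fls_nth (\<alpha> i) (fls_subdegree (\<alpha> i))" if "i \<in> I"
        for i
    proof -
      have i: "i \<le> n" "fls_nth (fls_compose_power (\<alpha> i) v) (- w * int (n - i)) \<noteq> 0"
        using that unfolding I_eq by auto
      then have "fls_nth (fls_compose_power (a i) v) (- w * int (n - i)) \<noteq> 0" using nth by metis
      from nth_subdegree_edge[OF v sla an i(1) this] show ?thesis
        unfolding nth_subdegree_edge[OF v sl \<alpha>n i] nth[OF i(1)] .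
    qed
    ultimately show "scalar_eps_poly n a = E" unfolding scalar_eps_poly_def o E_def by (simp add: Let_def)
  qed
  obtain a where a: "scalar_equation_of n M a" using scalar_equation_exists[OF M n] .
  have order: "exp_order n M = \<omega>" unfolding exp_order_def
    by (rule the_equality) (use a eq in auto)
  have poly: "eps_poly n M = E" unfolding eps_poly_def
    by (rule the_equality) (use a eq in auto)
  have Max: "exp_order n M = Max ((\<lambda>i. (- val (\<alpha> i)) / ereal (real (n - i))) ` {..<n})"
    unfolding order \<omega>_def by (rule Max_slopes[OF v sl, symmetric])
  \<comment> \<open>A coefficient of the eps-expansion is the corresponding one of the xi-expansion
    times a power of x; \<open>start\<close> provides the lower bound for the support of
    \<open>c i\<close> that gives the series its meaning.\<close>
  have coef: "ram_x s (fls_nth (\<alpha> i) (fls_subdegree (\<alpha> i))) =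
    xpow s (\<sigma> * of_int (fls_subdegree (\<alpha> i))) * c i (fls_subdegree (\<alpha> i))" if i: "i \<in> I" for i
  proof -
    have i': "i \<le> n" "\<alpha> i \<noteq> 0" using i unfolding I_eq by auto
    define k where "k = fls_subdegree (\<alpha> i)"
    have "ram_x s (fls_nth (\<alpha> i) k) = fls_nth (xi_series s \<sigma> (c i)) k"
      using expand[OF i'(1)] nth_ram[of s "\<alpha> i" k] by simp
    also have "\<dots> = c i k * xpow s \<sigma> powi k"
    proof (rule nth_xi_series)
      fix j assume "j < k"
      then show "c i j = 0" using start[OF i'(1), of j] i'(2) by (simp add: val_def k_def)
    qed
    \<comment> \<open>\<open>s * \<sigma>\<close> is an integer, so the floor in \<open>xpow\<close>
      commutes with multiplication by \<open>k\<close>.\<close>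
    also have "xpow s \<sigma> powi k = xpow s (\<sigma> * of_int k)"
    proof -
      obtain z where z: "of_nat s * \<sigma> = of_int z" using s\<sigma> by (auto elim: Ints_cases)
      then have "of_nat s * (\<sigma> * of_int k) = of_int (z * k)" by (simp flip: mult.assoc)
      then show ?thesis unfolding xpow_eq z X_pow_power_int by (simp only: floor_of_int)
    qed
    finally show ?thesis by (simp add: k_def mult.commute)
  qed
  have "finite I" unfolding I_eq by simp
  have "map_poly (ram_x s) E = (\<Sum>i\<in>I. Polynomial.monom
      (xpow s (\<sigma> * of_int (fls_subdegree (\<alpha> i))) * c i (fls_subdegree (\<alpha> i))) (i - Min I))"
  proof (rule poly_eqI)
    fix m
    have ram_sum: "ram_x s (sum f J) = (\<Sum>j\<in>J. ram_x s (f j))" for f :: "nat \<Rightarrow> complex fls" and J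
      by (induction J rule: infinite_finite_induct) (simp_all add: ram_x_add[OF s])
    show "poly.coeff (map_poly (ram_x s) E) m = poly.coeff (\<Sum>i\<in>I. Polynomial.monom
      (xpow s (\<sigma> * of_int (fls_subdegree (\<alpha> i))) * c i (fls_subdegree (\<alpha> i))) (i - Min I)) m"
      unfolding E_def coeff_sum coeff_map_poly[of "ram_x s", OF ram_x_0] ram_sum
      by (rule sum.cong) (auto simp: coef)
  qed
  then show ?thesis unfolding poly Let_def order[symmetric] I_def using Max by (simp add: order)
qed

end
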